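(* Let $\lambda_1,\lambda_2>0$ and let $(u,v)$ be a blow-up solution, with (finite) blow-up time $T$, of the problem $$u_t=\Delta u+\lambda_1e^{v},\quad v_t=\Delta v+\lambda_2 e^{u}\quad\text{in } B_R\times(0,T),$$ $$\frac{\partial u}{\partial \eta}=e^{v},\quad \frac{\partial v}{\partial \eta}=e^{u}\quad\text{on }\partial B_R\times(0,T),$$ $$u(x,0)=u_0(x),\quad v(x,0)=v_0(x),\quad x\in B_R,$$ where the initial data $u_0,v_0$ satisfy the standing assumptions listed in the context. Then there is a positive constant $C$ such that $$u(R,t)\le \log C-\log(T-t),\qquad v(R,t)\le \log C-\log(T-t),\qquad t\in(0,T).$$
   Context: $B_R\subset\mathbb{R}^n$ is the open ball of radius $R>0$ centered at the origin, $\partial B_R$ its boundary, $\eta$ the outward unit normal on $\partial B_R$. Solutions are classical; they are radial in $x$, and one writes $r=|x|$, $u(r,t)=u(x,t)$, with the subscript $r$ denoting the radial derivative. A blow-up solution with blow-up time $T<\infty$ is a classical solution whose maximal existence interval is $[0,T)$ and which becomes unbounded (in sup norm over $B_R$) as $t\to T^-$. Standing assumptions on the initial data: $u_0,v_0$ are nonnegative, radial, radially nondecreasing, smooth functions on $\overline{B}_R$ satisfying (a) $\frac{\partial u_0}{\partial\eta}=e^{v_0}$ and $\frac{\partial v_0}{\partial\eta}=e^{u_0}$ on $\partial B_R$; (b) $\Delta u_0+e^{v_0}\ge 0$ and $\Delta v_0+e^{u_0}\ge 0$ on $\overline{B}_R$; (c) $u_{0r}(|x|)\ge 0$ and $v_{0r}(|x|)\ge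 0$ for $x\in\overline{B}_R$. *)

theory Defs
  imports "HOL-Analysis.Analysis"
begin

section \<open>Partial derivatives and regularity classes\<close>

definition partial :: "'a::euclidean_space \<Rightarrow> ('a \<Rightarrow> real) \<Rightarrow> 'a \<Rightarrow> real" where
  "partial b f x = deriv (\<lambda>s. f (x + s *\<^sub>R b)) 0"

definition has_partial :: "'a::euclidean_space \<Rightarrow> ('a \<Rightarrow> real) \<Rightarrow> 'a \<Rightarrow> bool" where
  "has_partial b f x \<longleftrightarrow> (\<lambda>s. f (x + s *\<^sub>R b)) differentiable (at 0)"

definition laplacian :: "('a::euclidean_space \<Rightarrow> real) \<Rightarrow> 'a \<Rightarrow> real" where
  "laplacian f x = (\<Sum>b\<in>Basis. partial b (partial b f) x)"

text \<open>The map \<open>g\<close> is a continuous function on \<open>S'\<close> that agrees with \<open>f\<close> on \<open>S\<close>. It is used with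
  \<open>S\<close> dense in \<open>S'\<close>, so that \<open>g\<close> is unique on \<open>S'\<close> and gives the values of a derivative up to
  the boundary.\<close>

definition continuous_extension ::
    "'b::topological_space set \<Rightarrow> 'b set \<Rightarrow> ('b \<Rightarrow> real) \<Rightarrow> ('b \<Rightarrow> real) \<Rightarrow> bool" where
  "continuous_extension S S' f g \<longleftrightarrow> continuous_on S' g \<and> (\<forall>x\<in>S. g x = f x)"

text \<open>\<open>C\<^sup>\<infinity>\<close> on the closed ball: all iterated partial derivatives (indexed by lists of coordinate
  directions) exist in the open ball and extend continuously to the closed ball.\<close>

definition smooth_on_cball :: "real \<Rightarrow> ('a::euclidean_space \<Rightarrow> real) \<Rightarrow> bool" where
  "smooth_on_cball R f \<longleftrightarrow>
     continuous_on (cball 0 R) f \<and>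
     (\<forall>bs\<in>lists Basis.
        (\<forall>b\<in>Basis. \<forall>x\<in>ball 0 R. has_partial b (foldr partial bs f) x) \<and>
        (\<exists>g. continuous_extension (ball 0 R) (cball 0 R) (foldr partial bs f) g))"

text \<open>\<open>C\<^sup>2\<^sup>,\<^sup>1(B\<^sub>R \<times> (0,T)) \<inter> C\<^sup>1\<^sup>,\<^sup>0(cl B\<^sub>R \<times> (0,T)) \<inter> C(cl B\<^sub>R \<times> [0,T))\<close>: the regularity of a
  classical solution of a Neumann problem.\<close>

definition classical_regularity ::
    "real \<Rightarrow> real \<Rightarrow> ('a::euclidean_space \<Rightarrow> real \<Rightarrow> real) \<Rightarrow> bool" where
  "classical_regularity R T u \<longleftrightarrow>
     continuous_on (cball 0 R \<times> {0..<T}) (\<lambda>(x, t). u x t) \<and>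
     (\<forall>x\<in>ball 0 R. \<forall>t\<in>{0<..<T}. u x differentiable (at t)) \<and>
     continuous_on (ball 0 R \<times> {0<..<T}) (\<lambda>(x, t). deriv (u x) t) \<and>
     (\<forall>b\<in>Basis.
        (\<forall>x\<in>ball 0 R. \<forall>t\<in>{0<..<T}. has_partial b (\<lambda>y. u y t) x) \<and>
        (\<exists>g. continuous_extension (ball 0 R \<times> {0<..<T}) (cball 0 R \<times> {0<..<T})
               (\<lambda>(x, t). partial b (\<lambda>y. u y t) x) g)) \<and>
     (\<forall>b\<in>Basis. \<forall>c\<in>Basis.
        (\<forall>x\<in>ball 0 R. \<forall>t\<in>{0<..<T}. has_partial c (partial b (\<lambda>y. u y t)) x) \<and>
        continuous_on (ball 0 R \<times> {0<..<T}) (\<lambda>(x, t). partial c (partial b (\<lambda>y. u y t)) x))"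

text \<open>Derivative at a boundary point \<open>x\<close> of the ball along \<open>\<eta> = x / |x|\<close>. It is one-sided, since
  only the values for parameters \<open>s \<le> 0\<close> lie in the closed ball.\<close>

definition has_normal_derivative ::
    "('a::euclidean_space \<Rightarrow> real) \<Rightarrow> real \<Rightarrow> 'a \<Rightarrow> bool" where
  "has_normal_derivative f d x \<longleftrightarrow>
     ((\<lambda>s. f (x + s *\<^sub>R (x /\<^sub>R norm x))) has_real_derivative d) (at 0 within {..0})"

section \<open>Radial functions\<close>

definition radial_on :: "'a::euclidean_space set \<Rightarrow> ('a \<Rightarrow> real) \<Rightarrow> bool" where
  "radial_on S f \<longleftrightarrow> (\<forall>x\<in>S. \<forall>y\<in>S. norm x = norm y \<longrightarrow> f x = f y)"

definition radially_nondecreasing_on :: "'a::euclidean_space set \<Rightarrow> ('a \<Rightarrow> real) \<Rightarrow> bool" where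
  "radially_nondecreasing_on S f \<longleftrightarrow> (\<forall>x\<in>S. \<forall>y\<in>S. norm x \<le> norm y \<longrightarrow> f x \<le> f y)"

text \<open>The profile \<open>r \<mapsto> f(r e)\<close> does not depend on the unit vector \<open>e\<close> if \<open>f\<close> is radial. Its
  derivative on \<open>[0,R]\<close> is one-sided at the endpoints.\<close>

definition has_radial_derivative ::
    "real \<Rightarrow> ('a::euclidean_space \<Rightarrow> real) \<Rightarrow> real \<Rightarrow> real \<Rightarrow> bool" where
  "has_radial_derivative R f d r \<longleftrightarrow>
     (\<forall>e. norm e = 1 \<longrightarrow> ((\<lambda>s. f (s *\<^sub>R e)) has_real_derivative d) (at r within {0..R}))"

section \<open>The initial data\<close>

text \<open>The Laplacian is taken up to the boundary by continuous extension. Conditions (b) carry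
  no factors \<open>lam1\<close>, \<open>lam2\<close>.\<close>

definition admissible_data ::
    "real \<Rightarrow> ('a::euclidean_space \<Rightarrow> real) \<Rightarrow> ('a \<Rightarrow> real) \<Rightarrow> bool" where
  "admissible_data R u0 v0 \<longleftrightarrow>
     (\<forall>x\<in>cball 0 R. 0 \<le> u0 x \<and> 0 \<le> v0 x) \<and>
     radial_on (cball 0 R) u0 \<and> radial_on (cball 0 R) v0 \<and>
     radially_nondecreasing_on (cball 0 R) u0 \<and> radially_nondecreasing_on (cball 0 R) v0 \<and>
     smooth_on_cball R u0 \<and> smooth_on_cball R v0 \<and>
     (\<forall>x\<in>sphere 0 R. has_normal_derivative u0 (exp (v0 x)) x \<and>
                       has_normal_derivative v0 (exp (u0 x)) x) \<and>
     (\<exists>Lu Lv. continuous_extension (ball 0 R) (cball 0 R) (laplacian u0) Lu \<and>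
              continuous_extension (ball 0 R) (cball 0 R) (laplacian v0) Lv \<and>
              (\<forall>x\<in>cball 0 R. 0 \<le> Lu x + exp (v0 x) \<and> 0 \<le> Lv x + exp (u0 x))) \<and>
     (\<forall>x\<in>(cball 0 R :: 'a set). (\<exists>d\<ge>0. has_radial_derivative R u0 d (norm x)) \<and>
                      (\<exists>d\<ge>0. has_radial_derivative R v0 d (norm x)))"

section \<open>Blow-up solutions\<close>

definition classical_solution ::
    "real \<Rightarrow> real \<Rightarrow> real \<Rightarrow> ('a::euclidean_space \<Rightarrow> real) \<Rightarrow> ('a \<Rightarrow> real) \<Rightarrow>
     real \<Rightarrow> ('a \<Rightarrow> real \<Rightarrow> real) \<Rightarrow> ('a \<Rightarrow> real \<Rightarrow> real) \<Rightarrow> bool" where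
  "classical_solution lam1 lam2 R u0 v0 T u v \<longleftrightarrow>
     classical_regularity R T u \<and> classical_regularity R T v \<and>
     (\<forall>t\<in>{0..<T}. radial_on (cball 0 R) (\<lambda>x. u x t) \<and> radial_on (cball 0 R) (\<lambda>x. v x t)) \<and>
     (\<forall>x\<in>ball 0 R. \<forall>t\<in>{0<..<T}.
        deriv (u x) t = laplacian (\<lambda>y. u y t) x + lam1 * exp (v x t) \<and>
        deriv (v x) t = laplacian (\<lambda>y. v y t) x + lam2 * exp (u x t)) \<and>
     (\<forall>x\<in>sphere 0 R. \<forall>t\<in>{0<..<T}.
        has_normal_derivative (\<lambda>y. u y t) (exp (v x t)) x \<and>
        has_normal_derivative (\<lambda>y. v y t) (exp (u x t)) x) \<and>
     (\<forall>x\<in>ball 0 R. u x 0 = u0 x \<and> v x 0 = v0 x)"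

definition sup_norm :: "real \<Rightarrow> ('a::euclidean_space \<Rightarrow> real) \<Rightarrow> real" where
  "sup_norm R f = (SUP x\<in>ball 0 R. \<bar>f x\<bar>)"

text \<open>The last two conjuncts say that \<open>[0,T)\<close> is the maximal existence interval and that the pair
  \<open>(u,v)\<close> is unbounded near \<open>T\<close>, i.e. the limes superior of the sup norm is infinite.\<close>

definition blow_up_solution ::
    "real \<Rightarrow> real \<Rightarrow> real \<Rightarrow> ('a::euclidean_space \<Rightarrow> real) \<Rightarrow> ('a \<Rightarrow> real) \<Rightarrow>
     real \<Rightarrow> ('a \<Rightarrow> real \<Rightarrow> real) \<Rightarrow> ('a \<Rightarrow> real \<Rightarrow> real) \<Rightarrow> bool" where
  "blow_up_solution lam1 lam2 R u0 v0 T u v \<longleftrightarrow>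
     0 < T \<and>
     classical_solution lam1 lam2 R u0 v0 T u v \<and>
     \<not> (\<exists>T' u' v'. T < T' \<and> classical_solution lam1 lam2 R u0 v0 T' u' v' \<and>
          (\<forall>x\<in>cball 0 R. \<forall>t\<in>{0..<T}. u' x t = u x t \<and> v' x t = v x t)) \<and>
     (\<forall>M. \<exists>\<^sub>F t in at_left T.
        M < max (sup_norm R (\<lambda>x. u x t)) (sup_norm R (\<lambda>x. v x t)))"

end

theory Submission
  imports Defs
begin

text \<open>
  Let \<open>w = (u + v) / 2\<close>, and let \<open>F = (exp u + exp v) / 2\<close> on the sphere, which is the boundary flux of
  \<open>w\<close>. Since \<open>F \<ge> exp w\<close> and the reaction terms are positive, \<open>w\<close> is a supersolution of the scalar
  problem \<open>w\<^sub>t = \<Delta> w\<close> with boundary flux \<open>exp w\<close>. In terms of the distance \<open>y\<close> to the sphere this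
  problem has the steady profiles \<open>ln l - l y\<close>. They are unstable: an initial profile above
  \<open>ln l - l y + \<epsilon> exp (- l y)\<close> forces blow-up within the time \<open>1 / (2 \<epsilon> l\<^sup>2)\<close>
  (\<open>remaining_time_bound\<close>).

  The boundary flux need not be monotone in time. The idea is to look at record times, where \<open>F\<close> attains
  its largest value \<open>G\<close> so far. At such a time the profile of \<open>w\<close> turns out to lie above an unstable
  profile with \<open>l\<close> close to \<open>G\<close> and \<open>\<epsilon>\<close> of order \<open>1 / ln G\<close>, so that the remaining time is at most a
  multiple of \<open>ln G / G\<^sup>2\<close> and in particular of \<open>1 / G\<close> (\<open>record_flux_bound\<close>). At any other time the
  flux is bounded by an earlier record, from which even more time remains
  (\<open>boundary_blow_up_rate\<close>).

  Two facts place \<open>w\<close> above the unstable profile. First, \<open>w\<close> on the sphere is nearly \<open>ln G\<close>, that is,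
  the arithmetic mean \<open>F\<close> and the geometric mean \<open>exp w\<close> of the fluxes nearly agree. This holds because
  \<open>u - v\<close> is bounded and is damped by the boundary condition with a coefficient of order \<open>exp w\<close>. As the
  solution needs a time of order \<open>exp (- 2 m)\<close> to rise from level \<open>m\<close> to level \<open>m + 1\<close>, the damping
  before a record lasts long enough to make \<open>u - v\<close> smaller than a negative power of \<open>G\<close>
  (\<open>slow_growth\<close>, \<open>boundary_value_lower_bound\<close>, \<open>component_gap_at_record\<close>). Secondly, \<open>w\<close> falls off
  more slowly than \<open>G y\<close>, with a gain of order \<open>(G y)\<^sup>2 / ln G\<close>: slopes are at most about \<open>G\<close>, since
  the flux was, and they cannot all be of this size on a layer of width much larger than \<open>ln G / G\<close>,
  since \<open>0 \<le> w \<le> ln G\<close> (\<open>slope_bound_at_record\<close>).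

  All estimates are comparison arguments at a first touching point. Estimates of slopes compare the values
  at two points and thus involve derivatives of the solution up to second order in space only.
\<close>

section \<open>First-touching arguments\<close>

text \<open>All comparison arguments below have this form: a function that starts negative on a compact set
  stays negative if it cannot touch \<open>0\<close> for the first time. The last premise of \<open>no_touch\<close> is the
  information about the past that makes the time derivative nonnegative at the touching point.\<close>

lemma first_touch:
  fixes g :: "'b::metric_space \<Rightarrow> real \<Rightarrow> real"
  assumes X: "compact X" and cont: "continuous_on (X \<times> {a..b}) (\<lambda>(x, t). g x t)"
    and start: "\<And>x. x \<in> X \<Longrightarrow> g x a < 0"
    and no_touch: "\<And>x t. \<lbrakk>x \<in> X; a < t; t \<le> b; g x t = 0; \<And>y. y \<in> X \<Longrightarrow> g y t \<le> 0;
        \<And>s. \<lbrakk>a \<le> s; s < t\<rbrakk> \<Longrightarrow> g x s < 0\<rbrakk> \<Longrightarrow> False"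
    and xt: "x \<in> X" "a \<le> t" "t \<le> b"
  shows "g x t < 0"
proof (rule ccontr)
  assume "\<not> g x t < 0"
  define Z where "Z = {p \<in> X \<times> {a..b}. (\<lambda>(x, t). g x t) p \<in> {0..}}"
  have Zc: "compact Z"
  proof -
    have "closed (X \<times> {a..b})"
      using X by (intro closed_Times compact_imp_closed) auto
    then have "closedin (top_of_set (X \<times> {a..b})) ((X \<times> {a..b}) \<inter> (\<lambda>(x, t). g x t) -` {0..})"
      using cont continuous_closedin_preimage by blast
    then have "closed ((X \<times> {a..b}) \<inter> (\<lambda>(x, t). g x t) -` {0..})"
      using \<open>closed (X \<times> {a..b})\<close> closedin_closed_trans by blast
    moreover have "Z = (X \<times> {a..b}) \<inter> ((X \<times> {a..b}) \<inter> (\<lambda>(x, t). g x t) -` {0..})"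
      unfolding Z_def by auto
    ultimately show ?thesis
      using X by (metis compact_Icc compact_Int_closed compact_Times)
  qed
  have "(x, t) \<in> Z"
    using xt \<open>\<not> g x t < 0\<close> unfolding Z_def by auto
  then have ne: "Z \<noteq> {}" by auto
  obtain p where p: "p \<in> Z" "\<And>q. q \<in> Z \<Longrightarrow> snd p \<le> snd q"
    using continuous_attains_inf[OF Zc ne, of snd] continuous_on_snd[OF continuous_on_id, of Z]
    by (auto simp: id_def)
  obtain y \<tau> where yt: "p = (y, \<tau>)" by force
  have y: "y \<in> X" "a \<le> \<tau>" "\<tau> \<le> b" "0 \<le> g y \<tau>"
    using p(1) yt unfolding Z_def by auto
  have before: "g z s < 0" if "z \<in> X" "a \<le> s" "s < \<tau>" for z s
  proof (rule ccontr)
    assume "\<not> g z s < 0"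
    then have "(z, s) \<in> Z" using that y unfolding Z_def by auto
    from p(2)[OF this] yt that show False by auto
  qed
  have "a < \<tau>" using start[OF y(1)] y by (metis leD order_le_less)
  have le: "g z \<tau> \<le> 0" if z: "z \<in> X" for z
  proof -
    have c: "continuous_on {a..b} (\<lambda>s. g z s)"
    proof -
      have "continuous_on {a..b} ((\<lambda>(x, t). g x t) \<circ> (\<lambda>s. (z, s)))"
        by (rule continuous_on_compose)
          (use z in \<open>auto intro!: continuous_intros intro: continuous_on_subset[OF cont]\<close>)
      then show ?thesis by (simp add: o_def)
    qed
    then have "continuous (at \<tau> within {a..b}) (\<lambda>s. g z s)"
      using y by (auto simp: continuous_on_eq_continuous_within)
    then have "((\<lambda>s. g z s) \<longlongrightarrow> g z \<tau>) (at \<tau> within {a..b})"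
      by (simp add: continuous_within)
    then have lim: "((\<lambda>s. g z s) \<longlongrightarrow> g z \<tau>) (at \<tau> within {a..<\<tau>})"
      by (rule tendsto_within_subset) (use y in auto)
    have "at \<tau> within {a..<\<tau>} \<noteq> bot"
      using \<open>a < \<tau>\<close> by (simp add: at_within_eq_bot_iff)
    then show ?thesis
      by (rule tendsto_upperbound[OF lim, rotated])
        (use before[OF z] in \<open>auto simp: eventually_at_filter intro!: always_eventually less_imp_le\<close>)
  qed
  show False
    by (rule no_touch[OF y(1) \<open>a < \<tau>\<close> y(3)]) (use y le before in \<open>auto intro: antisym\<close>)
qed

lemma time_derivative_at_touch:
  fixes f :: "real \<Rightarrow> real"
  assumes "(f has_real_derivative D) (at t)" "a < t" "f t = 0"
    and "\<And>s. \<lbrakk>a \<le> s; s < t\<rbrakk> \<Longrightarrow> f s < 0"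
  shows "0 \<le> D"
proof (rule ccontr)
  assume "\<not> 0 \<le> D"
  then obtain d where d: "d > 0" "\<And>h. \<lbrakk>0 < h; h < d\<rbrakk> \<Longrightarrow> f t < f (t - h)"
    using DERIV_neg_dec_left[OF assms(1)] by auto
  define h where "h = min (d / 2) (t - a)"
  have "0 < h" "h < d" "a \<le> t - h" "t - h < t"
    using d assms(2) by (auto simp: h_def)
  with d(2)[of h] assms(3) assms(4)[of "t - h"] show False by auto
qed

lemma left_derivative_at_max:
  fixes f :: "real \<Rightarrow> real"
  assumes "(f has_real_derivative D) (at b within {..b})" "a < b"
    and "\<And>s. \<lbrakk>a \<le> s; s < b\<rbrakk> \<Longrightarrow> f s \<le> f b"
  shows "0 \<le> D"
proof (rule ccontr)
  assume "\<not> 0 \<le> D"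
  then obtain d where d: "d > 0" "\<And>h. \<lbrakk>0 < h; b - h \<in> {..b}; h < d\<rbrakk> \<Longrightarrow> f b < f (b - h)"
    using has_real_derivative_neg_dec_left[OF assms(1)] by auto
  define h where "h = min (d / 2) (b - a)"
  have "0 < h" "h < d" "a \<le> b - h" "b - h < b"
    using d assms(2) by (auto simp: h_def)
  with d(2)[of h] assms(3)[of "b - h"] show False by auto
qed

section \<open>Second derivatives at a maximum\<close>

text \<open>The first derivative is required near \<open>a\<close>, the second one only at \<open>a\<close>. This is what the
  existence of the iterated partial derivative at a point gives along a coordinate line.\<close>

definition has_second_derivative :: "(real \<Rightarrow> real) \<Rightarrow> real \<Rightarrow> real \<Rightarrow> bool" where
  "has_second_derivative f d2 a \<longleftrightarrow>
     (\<exists>f'. (\<forall>\<^sub>F s in nhds a. (f has_real_derivative f' s) (at s)) \<and>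
           (f' has_real_derivative d2) (at a))"

lemma has_second_derivativeI:
  assumes "open S" "a \<in> S" "\<And>s. s \<in> S \<Longrightarrow> (f has_real_derivative f' s) (at s)"
    and "(f' has_real_derivative d2) (at a)"
  shows "has_second_derivative f d2 a"
  unfolding has_second_derivative_def eventually_nhds using assms by blast

lemma has_second_derivative_diff:
  assumes "has_second_derivative f d a" "has_second_derivative g e a"
  shows "has_second_derivative (\<lambda>s. f s - g s) (d - e) a"
proof -
  obtain f' g' where "\<forall>\<^sub>F s in nhds a. (f has_real_derivative f' s) (at s)"
      "(f' has_real_derivative d) (at a)"
      "\<forall>\<^sub>F s in nhds a. (g has_real_derivative g' s) (at s)"
      "(g' has_real_derivative e) (at a)"
    using assms unfolding has_second_derivative_def by blast
  then show ?thesis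
    unfolding has_second_derivative_def
    by (intro exI[of _ "\<lambda>s. f' s - g' s"]) (auto intro!: derivative_intros elim: eventually_elim2)
qed

lemma has_second_derivative_const [simp]: "has_second_derivative (\<lambda>s. c) 0 a"
  unfolding has_second_derivative_def by (intro exI[of _ "\<lambda>s. 0"]) auto

lemma has_second_derivative_uminus:
  assumes "has_second_derivative f d a"
  shows "has_second_derivative (\<lambda>s. - f s) (- d) a"
  using has_second_derivative_diff[OF has_second_derivative_const[of 0] assms] by simp

lemma second_derivative_at_max:
  assumes D2: "has_second_derivative f d2 a" and max: "\<forall>\<^sub>F s in nhds a. f s \<le> f a"
  shows "d2 \<le> 0"
proof (rule ccontr)
  assume "\<not> d2 \<le> 0"
  obtain f' where f': "\<forall>\<^sub>F s in nhds a. (f has_real_derivative f' s) (at s)"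
    and f'': "(f' has_real_derivative d2) (at a)"
    using D2 unfolding has_second_derivative_def by blast
  have "\<forall>\<^sub>F s in nhds a. (f has_real_derivative f' s) (at s) \<and> f s \<le> f a"
    using f' max by eventually_elim auto
  then obtain e where e: "e > 0" "\<And>s. dist s a < e \<Longrightarrow> (f has_real_derivative f' s) (at s) \<and> f s \<le> f a"
    unfolding eventually_nhds_metric by blast
  have "f' a = 0"
    by (rule DERIV_local_max[of f _ a e]) (use e in \<open>auto simp: dist_real_def abs_minus_commute\<close>)
  obtain d where d: "d > 0" "\<And>h. \<lbrakk>0 < h; h < d\<rbrakk> \<Longrightarrow> f' a < f' (a + h)"
    using DERIV_pos_inc_right[OF f''] \<open>\<not> d2 \<le> 0\<close> by auto
  define h where "h = min d e / 2"
  have h: "0 < h" "h < d" "h < e" using d e by (auto simp: h_def)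
  have "f a < f (a + h)"
  proof (rule DERIV_pos_imp_increasing_open[of a "a + h" f])
    fix x assume "a < x" "x < a + h"
    moreover have "f' x > 0" using d(2)[of "x - a"] \<open>f' a = 0\<close> calculation h by auto
    ultimately show "\<exists>y. (f has_real_derivative y) (at x) \<and> y > 0"
      using e(2)[of x] h by (auto simp: dist_real_def)
  next
    have "isCont f x" if "a \<le> x" "x \<le> a + h" for x
      using e(2)[of x] h that by (auto simp: dist_real_def dest: DERIV_isCont)
    then show "continuous_on {a..a + h} f" by (auto intro!: continuous_at_imp_continuous_on)
  qed (use h in auto)
  with e(2)[of "a + h"] h show False by (auto simp: dist_real_def)
qed

lemma second_derivative_le_at_max:
  assumes "has_second_derivative f d a" "has_second_derivative g e a"
    and "\<forall>\<^sub>F s in nhds a. f s - g s \<le> f a - g a"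
  shows "d \<le> e"
  using second_derivative_at_max[OF has_second_derivative_diff[OF assms(1,2)]] assms(3) by simp

lemma has_second_derivative_cmult:
  assumes "has_second_derivative f d a"
  shows "has_second_derivative (\<lambda>s. c * f s) (c * d) a"
proof -
  obtain f' where f': "\<forall>\<^sub>F s in nhds a. (f has_real_derivative f' s) (at s)"
    and f'': "(f' has_real_derivative d) (at a)"
    using assms unfolding has_second_derivative_def by blast
  have "\<forall>\<^sub>F s in nhds a. ((\<lambda>s. c * f s) has_real_derivative c * f' s) (at s)"
    using f' by eventually_elim (rule DERIV_cmult)
  with DERIV_cmult[OF f'', of c] show ?thesis
    unfolding has_second_derivative_def by (intro exI[of _ "\<lambda>s. c * f' s"]) simp
qed

lemma has_second_derivative_add:
  assumes "has_second_derivative f d a" "has_second_derivative g e a"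
  shows "has_second_derivative (\<lambda>s. f s + g s) (d + e) a"
  using has_second_derivative_diff[OF assms(1) has_second_derivative_uminus[OF assms(2)]] by simp

lemma has_real_derivative_reflect:
  assumes "(f has_real_derivative d) (at (R - r))"
  shows "((\<lambda>r. f (R - r)) has_real_derivative - d) (at r)"
proof -
  have "((\<lambda>r. R - r) has_real_derivative - 1) (at r)" by (auto intro!: derivative_eq_intros)
  from DERIV_chain2[OF assms this] show ?thesis by simp
qed

lemma has_second_derivative_reflect:
  assumes "has_second_derivative f d2 (R - r)"
  shows "has_second_derivative (\<lambda>r. f (R - r)) d2 r"
proof -
  obtain f' where f': "\<forall>\<^sub>F s in nhds (R - r). (f has_real_derivative f' s) (at s)"
    and f'': "(f' has_real_derivative d2) (at (R - r))"
    using assms unfolding has_second_derivative_def by blast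
  have "((\<lambda>s. R - s) \<longlongrightarrow> R - r) (at r)" by (intro tendsto_intros)
  then have "((\<lambda>s. R - s) \<longlongrightarrow> R - r) (nhds r)"
    using tendsto_at_iff_tendsto_nhds[of "\<lambda>s. R - s" r] by simp
  then have "\<forall>\<^sub>F s in nhds r. (f has_real_derivative f' (R - s)) (at (R - s))"
    using f' unfolding filterlim_iff by blast
  then have "\<forall>\<^sub>F s in nhds r. ((\<lambda>s. f (R - s)) has_real_derivative - f' (R - s)) (at s)"
    by eventually_elim (rule has_real_derivative_reflect)
  moreover have "((\<lambda>s. - f' (R - s)) has_real_derivative - (- d2)) (at r)"
    by (intro DERIV_minus has_real_derivative_reflect f'')
  ultimately show ?thesis unfolding has_second_derivative_def by auto
qed

lemma interior_max_derivatives: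
  fixes f h :: "real \<Rightarrow> real"
  assumes r: "a < r" "r < b"
    and f: "(f has_real_derivative f1) (at r)" "has_second_derivative f f2 r"
    and h: "(h has_real_derivative h1) (at r)" "has_second_derivative h h2 r"
    and max: "\<And>s. \<lbrakk>a < s; s < b\<rbrakk> \<Longrightarrow> f s - h s \<le> f r - h r"
  shows "f1 = h1" "f2 \<le> h2"
proof -
  have "f1 - h1 = 0"
    by (rule DERIV_local_max[OF DERIV_diff[OF f(1) h(1)], of "min (r - a) (b - r)"])
      (use r max in auto)
  then show "f1 = h1" by simp
  have "\<forall>\<^sub>F s in nhds r. s \<in> {a<..<b}" by (rule eventually_nhds_in_open) (use r in auto)
  then have "\<forall>\<^sub>F s in nhds r. f s - h s \<le> f r - h r"
    by eventually_elim (use max in auto)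
  then show "f2 \<le> h2" by (rule second_derivative_le_at_max[OF f(2) h(2)])
qed

section \<open>Classical solutions\<close>

locale classical_system =
  fixes lam1 lam2 R T :: real
    and u0 v0 :: "'a::euclidean_space \<Rightarrow> real"
    and u v :: "'a \<Rightarrow> real \<Rightarrow> real"
  assumes R_pos: "0 < R" and T_pos: "0 < T" and lam1_pos: "0 < lam1" and lam2_pos: "0 < lam2"
    and data: "admissible_data R u0 v0"
    and sol: "classical_solution lam1 lam2 R u0 v0 T u v"
begin

text \<open>The hypotheses are symmetric in the two components, so statements are made for \<open>u\<close> only and
  transferred to \<open>v\<close> by exchanging the roles.\<close>

lemma swapped: "classical_system lam2 lam1 R T v0 u0 v u"
proof
  show "admissible_data R v0 u0"
    using data unfolding admissible_data_def by fast
  show "classical_solution lam2 lam1 R v0 u0 T v u"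
    using sol unfolding classical_solution_def by fast
qed (use R_pos T_pos lam1_pos lam2_pos in auto)

lemma regular: "classical_regularity R T u"
  using sol unfolding classical_solution_def by blast

lemma continuous_u: "continuous_on (cball 0 R \<times> {0..<T}) (\<lambda>(x, t). u x t)"
  using regular unfolding classical_regularity_def by blast

lemma continuous_u_compose:
  assumes "continuous_on S f" "continuous_on S h"
    and "\<And>p. p \<in> S \<Longrightarrow> f p \<in> cball 0 R" "\<And>p. p \<in> S \<Longrightarrow> 0 \<le> h p \<and> h p < T"
  shows "continuous_on S (\<lambda>p. u (f p) (h p))"
proof -
  have "continuous_on S ((\<lambda>(x, t). u x t) \<circ> (\<lambda>p. (f p, h p)))"
  proof (rule continuous_on_compose)
    show "continuous_on S (\<lambda>p. (f p, h p))" using assms by (intro continuous_intros)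
    show "continuous_on ((\<lambda>p. (f p, h p)) ` S) (\<lambda>(x, t). u x t)"
      by (rule continuous_on_subset[OF continuous_u]) (use assms in auto)
  qed
  then show ?thesis by (simp add: o_def)
qed

lemma radial_u:
  assumes "0 \<le> t" "t < T" "norm x \<le> R" "norm y = norm x"
  shows "u x t = u y t"
proof -
  have "radial_on (cball 0 R) (\<lambda>x. u x t)"
    using sol assms unfolding classical_solution_def by fastforce
  moreover have "x \<in> cball 0 R" "y \<in> cball 0 R"
    using assms by auto
  ultimately show ?thesis
    using assms(4) unfolding radial_on_def by metis
qed

lemma time_derivative_u:
  assumes "x \<in> ball 0 R" "0 < t" "t < T"
  shows "(u x has_real_derivative laplacian (\<lambda>y. u y t) x + lam1 * exp (v x t)) (at t)"
proof -
  have "u x differentiable (at t)"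
    using regular assms unfolding classical_regularity_def by simp
  then have "(u x has_real_derivative deriv (u x) t) (at t)"
    unfolding DERIV_deriv_iff_real_differentiable .
  moreover have "deriv (u x) t = laplacian (\<lambda>y. u y t) x + lam1 * exp (v x t)"
    using sol assms unfolding classical_solution_def by simp
  ultimately show ?thesis by simp
qed

lemma partial_derivative_u:
  assumes "b \<in> Basis" "x + s *\<^sub>R b \<in> ball 0 R" "0 < t" "t < T"
  shows "((\<lambda>s. u (x + s *\<^sub>R b) t) has_real_derivative partial b (\<lambda>y. u y t) (x + s *\<^sub>R b)) (at s)"
proof -
  have "has_partial b (\<lambda>y. u y t) (x + s *\<^sub>R b)"
    using regular assms unfolding classical_regularity_def by simp
  then have "((\<lambda>r. u (x + s *\<^sub>R b + r *\<^sub>R b) t) has_real_derivative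
      partial b (\<lambda>y. u y t) (x + s *\<^sub>R b)) (at 0)"
    unfolding has_partial_def partial_def DERIV_deriv_iff_real_differentiable .
  then show ?thesis
    using DERIV_shift[of "\<lambda>s. u (x + s *\<^sub>R b) t" _ 0 s] by (simp add: algebra_simps)
qed

lemma second_derivative_u:
  assumes "b \<in> Basis" "x \<in> ball 0 R" "0 < t" "t < T"
  shows "has_second_derivative (\<lambda>s. u (x + s *\<^sub>R b) t) (partial b (partial b (\<lambda>y. u y t)) x) 0"
proof (rule has_second_derivativeI)
  let ?S = "(\<lambda>s::real. x + s *\<^sub>R b) -` ball 0 R"
  show "open ?S" by (intro open_vimage continuous_intros) auto
  show "0 \<in> ?S" using assms by simp
  show "((\<lambda>s. u (x + s *\<^sub>R b) t) has_real_derivative partial b (\<lambda>y. u y t) (x + s *\<^sub>R b)) (at s)"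
    if "s \<in> ?S" for s using that assms by (intro partial_derivative_u) auto
  have "has_partial b (partial b (\<lambda>y. u y t)) x"
    using regular assms unfolding classical_regularity_def by simp
  then have "((\<lambda>s. partial b (\<lambda>y. u y t) (x + s *\<^sub>R b)) has_real_derivative
      deriv (\<lambda>s. partial b (\<lambda>y. u y t) (x + s *\<^sub>R b)) 0) (at 0)"
    unfolding has_partial_def DERIV_deriv_iff_real_differentiable .
  then show "((\<lambda>s. partial b (\<lambda>y. u y t) (x + s *\<^sub>R b)) has_real_derivative
      partial b (partial b (\<lambda>y. u y t)) x) (at 0)"
    unfolding partial_def[of b "partial b (\<lambda>y. u y t)" x] .
qed

lemma boundary_derivative_u:
  assumes "norm e = 1" "0 < t" "t < T"
  shows "((\<lambda>r. u (r *\<^sub>R e) t) has_real_derivative exp (v (R *\<^sub>R e) t)) (at R within {..R})"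
proof -
  have "has_normal_derivative (\<lambda>y. u y t) (exp (v (R *\<^sub>R e) t)) (R *\<^sub>R e)"
    using sol assms R_pos unfolding classical_solution_def by (auto simp: mem_sphere_0)
  then have "((\<lambda>s. u ((R + s) *\<^sub>R e) t) has_real_derivative exp (v (R *\<^sub>R e) t)) (at 0 within {..0})"
    unfolding has_normal_derivative_def using assms R_pos by (simp add: scaleR_add_left)
  moreover have "(+) R ` {..0} = {..R}"
  proof -
    have "x \<in> (+) R ` {..0}" if "x \<le> R" for x
      using that by (intro image_eqI[of _ _ "x - R"]) auto
    then show ?thesis by auto
  qed
  ultimately show ?thesis
    using DERIV_at_within_shift[of "\<lambda>r. u (r *\<^sub>R e) t" _ R 0 "{..0}"] by simp
qed

lemma initial_u:
  assumes "x \<in> cball 0 R"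
  shows "u x 0 = u0 x"
proof -
  have c0: "continuous_on (cball 0 R) u0"
    using data unfolding admissible_data_def smooth_on_cball_def by blast
  have c: "continuous_on (cball 0 R) (\<lambda>x. u x 0)"
    by (rule continuous_u_compose) (use T_pos in \<open>auto intro: continuous_intros\<close>)
  have "continuous_on (closure (ball 0 R)) (\<lambda>x. u x 0 - u0 x)"
    using R_pos c c0 by (auto intro!: continuous_intros)
  moreover have "u x 0 - u0 x = 0" if "x \<in> ball 0 R" for x
    using sol that unfolding classical_solution_def by auto
  ultimately have "u x 0 - u0 x = 0"
    by (rule continuous_constant_on_closure) (use assms R_pos in auto)
  then show ?thesis by simp
qed

lemma u_has_max_on_slab:
  assumes "0 \<le> b" "b < T"
  obtains M where "\<And>x t. \<lbrakk>norm x \<le> R; 0 \<le> t; t \<le> b\<rbrakk> \<Longrightarrow> u x t \<le> M"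
proof -
  have "continuous_on (cball 0 R \<times> {0..b}) (\<lambda>p. u (fst p) (snd p))"
    by (rule continuous_u_compose) (use assms in \<open>auto intro: continuous_intros\<close>)
  then have "bdd_above ((\<lambda>p. u (fst p) (snd p)) ` (cball 0 R \<times> {0..b}))"
    by (intro bounded_imp_bdd_above compact_imp_bounded compact_continuous_image compact_Times) auto
  then obtain M where M: "\<And>p. p \<in> cball 0 R \<times> {0..b} \<Longrightarrow> u (fst p) (snd p) \<le> M"
    unfolding bdd_above_def by blast
  show thesis
  proof (rule that)
    fix x :: 'a and t :: real assume "norm x \<le> R" "0 \<le> t" "t \<le> b"
    with M[of "(x, t)"] show "u x t \<le> M" by simp
  qed
qed

text \<open>The comparison function \<open>h\<close> needs second derivatives along the coordinate lines only, so that it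
  may itself be a component of the solution as well as an explicit barrier.\<close>

lemma laplacian_le_at_max:
  assumes x: "x \<in> ball 0 R" and t: "0 < t" "t < T"
    and h: "\<And>b. b \<in> Basis \<Longrightarrow> has_second_derivative (\<lambda>s. h (x + s *\<^sub>R b)) (H b) 0"
    and max: "\<forall>\<^sub>F y in nhds x. u y t - h y \<le> u x t - h x"
  shows "laplacian (\<lambda>y. u y t) x \<le> (\<Sum>b\<in>Basis. H b)"
  unfolding laplacian_def
proof (rule sum_mono)
  fix b :: 'a assume b: "b \<in> Basis"
  have "((\<lambda>s::real. x + s *\<^sub>R b) \<longlongrightarrow> x + 0 *\<^sub>R b) (at 0)"
    by (intro tendsto_intros)
  then have "((\<lambda>s::real. x + s *\<^sub>R b) \<longlongrightarrow> x) (nhds 0)"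
    using tendsto_at_iff_tendsto_nhds[of "\<lambda>s::real. x + s *\<^sub>R b" 0] by simp
  then have "\<forall>\<^sub>F s in nhds 0. u (x + s *\<^sub>R b) t - h (x + s *\<^sub>R b) \<le> u x t - h x"
    using max unfolding filterlim_iff by blast
  then show "partial b (partial b (\<lambda>y. u y t)) x \<le> H b"
    by (intro second_derivative_le_at_max[OF second_derivative_u[OF b x t] h[OF b]]) simp
qed

lemma laplacian_nonneg_at_min:
  assumes x: "x \<in> ball 0 R" and t: "0 < t" "t < T"
    and min: "\<forall>\<^sub>F y in nhds x. u x t \<le> u y t"
  shows "0 \<le> laplacian (\<lambda>y. u y t) x"
  unfolding laplacian_def
proof (rule sum_nonneg)
  fix b :: 'a assume b: "b \<in> Basis"
  have "((\<lambda>s::real. x + s *\<^sub>R b) \<longlongrightarrow> x + 0 *\<^sub>R b) (at 0)"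
    by (intro tendsto_intros)
  then have "((\<lambda>s::real. x + s *\<^sub>R b) \<longlongrightarrow> x) (nhds 0)"
    using tendsto_at_iff_tendsto_nhds[of "\<lambda>s::real. x + s *\<^sub>R b" 0] by simp
  then have "\<forall>\<^sub>F s in nhds 0. u x t \<le> u (x + s *\<^sub>R b) t"
    using min unfolding filterlim_iff by blast
  then show "0 \<le> partial b (partial b (\<lambda>y. u y t)) x"
    using second_derivative_le_at_max[OF has_second_derivative_const second_derivative_u[OF b x t], of 0]
    by simp
qed

lemma sphere_ray:
  assumes "x \<in> cball (0::'a) R" "x \<notin> ball 0 R"
  obtains e where "norm e = 1" "x = R *\<^sub>R e"
proof
  have "norm x = R" using assms by auto
  then show "norm (x /\<^sub>R R) = 1" "x = R *\<^sub>R (x /\<^sub>R R)" using R_pos by auto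
qed

lemma eventually_in_ball: "x \<in> ball (0::'a) R \<Longrightarrow> \<forall>\<^sub>F y in nhds x. y \<in> ball 0 R"
  by (rule eventually_nhds_in_open) auto

lemma ray_in_cball: "\<lbrakk>norm (e::'a) = 1; 0 \<le> r; r \<le> R\<rbrakk> \<Longrightarrow> r *\<^sub>R e \<in> cball 0 R"
  by auto

section \<open>Positivity, comparability and radial monotonicity\<close>

text \<open>A first zero of \<open>u + \<epsilon>\<close> would be a spatial minimum. Inside, the reaction term pushes \<open>u\<close> upwards
  there, and on the sphere the positive flux contradicts minimality.\<close>

lemma u_nonneg:
  assumes "norm x \<le> R" "0 \<le> t" "t < T"
  shows "0 \<le> u x t"
proof (rule field_le_epsilon)
  fix \<epsilon> :: real assume "0 < \<epsilon>"
  have "- u x t - \<epsilon> < 0"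
  proof (rule first_touch[where g = "\<lambda>x t. - u x t - \<epsilon>" and X = "cball 0 R" and a = 0 and b = t])
    show "continuous_on (cball 0 R \<times> {0..t}) (\<lambda>(x, t). - u x t - \<epsilon>)"
      unfolding case_prod_beta
      by (intro continuous_intros continuous_u_compose) (use assms in auto)
    show "- u y 0 - \<epsilon> < 0" if "y \<in> cball 0 R" for y
      using initial_u[OF that] data that \<open>0 < \<epsilon>\<close> unfolding admissible_data_def by force
  next
    fix y s
    assume y: "y \<in> cball 0 R" and s: "0 < s" "s \<le> t" and g0: "- u y s - \<epsilon> = 0"
      and le: "\<And>z. z \<in> cball 0 R \<Longrightarrow> - u z s - \<epsilon> \<le> 0"
      and before: "\<And>\<tau>. \<lbrakk>0 \<le> \<tau>; \<tau> < s\<rbrakk> \<Longrightarrow> - u y \<tau> - \<epsilon> < 0"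
    have sT: "s < T" using s assms by auto
    have min: "u y s \<le> u z s" if "z \<in> cball 0 R" for z
      using le[OF that] g0 by simp
    show False
    proof (cases "y \<in> ball 0 R")
      case True
      have "\<forall>\<^sub>F z in nhds y. u y s \<le> u z s"
        using eventually_in_ball[OF True] by eventually_elim (rule min, simp)
      then have "0 < laplacian (\<lambda>y. u y s) y + lam1 * exp (v y s)"
        using laplacian_nonneg_at_min[OF True s(1) sT] lam1_pos by (intro add_nonneg_pos) auto
      moreover have "((\<lambda>\<tau>. - u y \<tau> - \<epsilon>) has_real_derivative
          - (laplacian (\<lambda>y. u y s) y + lam1 * exp (v y s))) (at s)"
        by (rule derivative_eq_intros time_derivative_u[OF True s(1) sT] refl)+ simp
      then have "0 \<le> - (laplacian (\<lambda>y. u y s) y + lam1 * exp (v y s))"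
        by (rule time_derivative_at_touch[where a = 0]) (use s g0 before in auto)
      ultimately show False by simp
    next
      case False
      then obtain e where e: "norm e = 1" "y = R *\<^sub>R e" using sphere_ray y by blast
      have "((\<lambda>r. - u (r *\<^sub>R e) s) has_real_derivative - exp (v (R *\<^sub>R e) s)) (at R within {..R})"
        using boundary_derivative_u[OF e(1) s(1) sT] by (rule DERIV_minus)
      then have "0 \<le> - exp (v (R *\<^sub>R e) s)"
        by (rule left_derivative_at_max[OF _ R_pos])
          (use min[OF ray_in_cball[OF e(1)]] e in auto)
      then show False by simp
    qed
  qed (use assms in auto)
  then show "0 \<le> u x t + \<epsilon>" by simp
qed

text \<open>Where \<open>u - v\<close> equals a large constant \<open>K\<close>, both the reaction difference
  \<open>lam1 exp v - lam2 exp u\<close> and the flux difference \<open>exp v - exp u\<close> are negative, so this value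
  cannot be reached as a maximum.\<close>

lemma difference_bounded:
  obtains K where "0 \<le> K"
    and "\<And>x t. \<lbrakk>norm x \<le> R; 0 \<le> t; t < T\<rbrakk> \<Longrightarrow> u x t - v x t \<le> K"
proof -
  obtain M where M: "\<And>x t. \<lbrakk>norm x \<le> R; 0 \<le> t; t \<le> 0\<rbrakk> \<Longrightarrow> u x t \<le> M"
    using u_has_max_on_slab[of 0] T_pos by auto
  define K where "K = \<bar>M\<bar> + \<bar>ln (lam1 / lam2)\<bar> + 1"
  have K: "0 < K" "M < K" "lam1 < lam2 * exp K"
  proof -
    show "0 < K" "M < K" unfolding K_def by auto
    have "ln (lam1 / lam2) < K" unfolding K_def by auto
    then have "lam1 / lam2 < exp K"
      using lam1_pos lam2_pos by (metis divide_pos_pos exp_less_cancel_iff exp_ln)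
    then show "lam1 < lam2 * exp K" using lam2_pos by (simp add: field_simps)
  qed
  interpret vu: classical_system lam2 lam1 R T v0 u0 v u by (rule swapped)
  have "u x t - v x t \<le> K" if x: "norm x \<le> R" and t: "0 \<le> t" "t < T" for x t
  proof -
    have "u x t - v x t - K < 0"
    proof (rule first_touch[where g = "\<lambda>x t. u x t - v x t - K" and X = "cball 0 R" and a = 0 and b = t])
      show "continuous_on (cball 0 R \<times> {0..t}) (\<lambda>(x, t). u x t - v x t - K)"
        unfolding case_prod_beta
        by (intro continuous_intros continuous_u_compose vu.continuous_u_compose) (use t in auto)
      show "u y 0 - v y 0 - K < 0" if "y \<in> cball 0 R" for y
        using M[of y 0] vu.u_nonneg[of y 0] that K T_pos by auto
    next
      fix y s
      assume y: "y \<in> cball 0 R" and s: "0 < s" "s \<le> t" and g0: "u y s - v y s - K = 0"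
        and le: "\<And>z. z \<in> cball 0 R \<Longrightarrow> u z s - v z s - K \<le> 0"
        and before: "\<And>\<tau>. \<lbrakk>0 \<le> \<tau>; \<tau> < s\<rbrakk> \<Longrightarrow> u y \<tau> - v y \<tau> - K < 0"
      have sT: "s < T" using s t by auto
      have max: "u z s - v z s \<le> u y s - v y s" if "z \<in> cball 0 R" for z
        using le[OF that] g0 by simp
      show False
      proof (cases "y \<in> ball 0 R")
        case True
        have "\<forall>\<^sub>F z in nhds y. u z s - v z s \<le> u y s - v y s"
          using eventually_in_ball[OF True] by eventually_elim (rule max, simp)
        then have lap: "laplacian (\<lambda>y. u y s) y \<le> laplacian (\<lambda>y. v y s) y"
          unfolding laplacian_def[of "\<lambda>y. v y s"]
          by (intro laplacian_le_at_max[OF True s(1) sT, where h = "\<lambda>y. v y s"]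
              vu.second_derivative_u[OF _ True s(1) sT])
        have "((\<lambda>\<tau>. u y \<tau> - v y \<tau> - K) has_real_derivative
            (laplacian (\<lambda>y. u y s) y + lam1 * exp (v y s)) -
            (laplacian (\<lambda>y. v y s) y + lam2 * exp (u y s)) - 0) (at s)"
          by (intro DERIV_diff time_derivative_u[OF True s(1) sT]
              vu.time_derivative_u[OF True s(1) sT] DERIV_const)
        then have "0 \<le> (laplacian (\<lambda>y. u y s) y + lam1 * exp (v y s)) -
            (laplacian (\<lambda>y. v y s) y + lam2 * exp (u y s)) - 0"
          by (rule time_derivative_at_touch[where a = 0]) (use s g0 before in auto)
        with lap have "lam2 * exp (u y s) \<le> lam1 * exp (v y s)" by simp
        moreover have "exp (u y s) = exp K * exp (v y s)"
          using g0 by (simp flip: exp_add)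
        ultimately have "lam2 * exp K \<le> lam1" by simp
        with K show False by simp
      next
        case False
        then obtain e where e: "norm e = 1" "y = R *\<^sub>R e" using sphere_ray y by blast
        have "((\<lambda>r. u (r *\<^sub>R e) s - v (r *\<^sub>R e) s) has_real_derivative
            exp (v (R *\<^sub>R e) s) - exp (u (R *\<^sub>R e) s)) (at R within {..R})"
          by (intro DERIV_diff boundary_derivative_u[OF e(1) s(1) sT]
              vu.boundary_derivative_u[OF e(1) s(1) sT])
        then have "0 \<le> exp (v (R *\<^sub>R e) s) - exp (u (R *\<^sub>R e) s)"
          by (rule left_derivative_at_max[OF _ R_pos])
            (use max[OF ray_in_cball[OF e(1)]] e in auto)
        with g0 e K show False by simp
      qed
    qed (use x t in auto)
    then show ?thesis by simp
  qed
  then show thesis using that[of K] K by auto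
qed

text \<open>Differentiating the equation in \<open>r\<close> would require third derivatives. The two-point function
  \<open>u(y) - u(x)\<close> on the pairs with \<open>|y| \<le> |x|\<close> avoids this: at a positive maximum the two Laplacians
  have the right signs separately, radial symmetry excludes the boundary \<open>|y| = |x|\<close>, and the
  positive flux excludes \<open>|x| = R\<close>. The cooperative coupling is handled by treating both components at
  once with an error \<open>E\<close> that grows exponentially in time.\<close>

lemma radially_monotone:
  assumes xy: "norm y \<le> norm x" "norm x \<le> R" and t: "0 \<le> t" "t < T"
  shows "u y t \<le> u x t"
proof -
  interpret vu: classical_system lam2 lam1 R T v0 u0 v u by (rule swapped)
  obtain M1 M2 where
      M1: "\<And>x s. \<lbrakk>norm x \<le> R; 0 \<le> s; s \<le> t\<rbrakk> \<Longrightarrow> u x s \<le> M1" and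
      M2: "\<And>x s. \<lbrakk>norm x \<le> R; 0 \<le> s; s \<le> t\<rbrakk> \<Longrightarrow> v x s \<le> M2"
    using u_has_max_on_slab[OF t] vu.u_has_max_on_slab[OF t] by metis
  \<comment> \<open>the growth rate of the error has to beat the Lipschitz constant of the reaction on \<open>[0, t]\<close>\<close>
  define C where "C = 2 * (lam1 + lam2) * exp (max M1 M2) + 1"
  define X where "X = {(x::'a, y::'a). x \<in> cball 0 R \<and> y \<in> cball 0 R \<and> norm y \<le> norm x}"
  have X: "compact X"
  proof -
    have "closed {p::'a \<times> 'a. norm (snd p) \<le> norm (fst p)}"
      by (intro closed_Collect_le continuous_intros)
    then have "compact ((cball 0 R \<times> cball 0 R) \<inter> {p::'a \<times> 'a. norm (snd p) \<le> norm (fst p)})"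
      by (intro compact_Int_closed compact_Times) auto
    moreover have "X = (cball 0 R \<times> cball 0 R) \<inter> {p::'a \<times> 'a. norm (snd p) \<le> norm (fst p)}"
      unfolding X_def by auto
    ultimately show ?thesis by simp
  qed
  have C: "C > 0" using lam1_pos lam2_pos unfolding C_def by (simp add: add_pos_pos)
  \<comment> \<open>the reaction at two points whose \<open>v\<close>-values are ordered up to a small error\<close>
  have reaction: "lam * (exp b - exp a) < d * C"
    if "b - a \<le> d" "0 < d" "d \<le> 1" "a \<le> max M1 M2" "0 < lam" "lam \<le> lam1 + lam2" for a b d lam :: real
  proof -
    have "exp b - exp a \<le> exp a * (exp d - 1)"
      using that by (simp add: algebra_simps flip: exp_add)
    also have "\<dots> \<le> exp (max M1 M2) * (2 * d)"
    proof (rule mult_mono)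
      have "exp d \<le> 1 + d + d\<^sup>2" using that by (intro exp_bound) auto
      also have "d\<^sup>2 \<le> d" using that by (simp add: power2_eq_square mult_left_le)
      finally show "exp d - 1 \<le> 2 * d" by simp
    qed (use that in auto)
    finally have "lam * (exp b - exp a) \<le> lam * (exp (max M1 M2) * (2 * d))"
      using that by (intro mult_left_mono) auto
    also have "\<dots> \<le> (lam1 + lam2) * (exp (max M1 M2) * (2 * d))"
      using that by (intro mult_right_mono) auto
    also have "\<dots> < d * C"
      using that unfolding C_def by (simp add: algebra_simps)
    finally show ?thesis .
  qed
  show ?thesis
  proof (rule field_le_epsilon)
    fix \<epsilon> :: real assume \<epsilon>: "0 < \<epsilon>"
    define E where "E s = min \<epsilon> 1 * exp (C * (s - t))" for s
    have E: "0 < E s" for s using \<epsilon> unfolding E_def by auto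
    have E1: "E s \<le> 1" "E s \<le> \<epsilon>" if "s \<le> t" for s
    proof -
      have "exp (C * (s - t)) \<le> 1" using C that by (simp add: mult_nonneg_nonpos)
      then have "E s \<le> min \<epsilon> 1 * 1" unfolding E_def using \<epsilon> by (intro mult_left_mono) auto
      then show "E s \<le> 1" "E s \<le> \<epsilon>" by auto
    qed
    have E': "(E has_real_derivative E s * C) (at s)" for s
      unfolding E_def by (auto intro!: derivative_eq_intros)
    have contE: "continuous_on S (\<lambda>p. E (snd p))" for S :: "(('a \<times> 'a) \<times> real) set"
      unfolding E_def by (intro continuous_intros)
    define g where "g p s = max (u (snd p) s - u (fst p) s - E s) (v (snd p) s - v (fst p) s - E s)"
      for p :: "'a \<times> 'a" and s
    have "g (x, y) t < 0"
    proof (rule first_touch[where g = g and X = X and a = 0 and b = t])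
      show "continuous_on (X \<times> {0..t}) (\<lambda>(x, t). g x t)"
        unfolding case_prod_beta g_def
        by (intro continuous_intros continuous_u_compose vu.continuous_u_compose contE)
          (use t in \<open>auto simp: X_def\<close>)
    next
      fix p assume p: "p \<in> X"
      then have "u (snd p) 0 \<le> u (fst p) 0" "v (snd p) 0 \<le> v (fst p) 0"
        using data initial_u[of "fst p"] initial_u[of "snd p"] vu.initial_u[of "fst p"] vu.initial_u[of "snd p"]
        unfolding admissible_data_def radially_nondecreasing_on_def X_def by auto
      then show "g p 0 < 0" using E[of 0] unfolding g_def by auto
    next
      fix p s
      assume p: "p \<in> X" and s: "0 < s" "s \<le> t" and g0: "g p s = 0"
        and le: "\<And>z. z \<in> X \<Longrightarrow> g z s \<le> 0"
        and before: "\<And>\<tau>. \<lbrakk>0 \<le> \<tau>; \<tau> < s\<rbrakk> \<Longrightarrow> g p \<tau> < 0"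
      have sT: "s < T" using s t by auto
      \<comment> \<open>both components are treated by the same argument\<close>
      have impossible: False
        if sys: "classical_system l1 l2 R T f0 h0 f h" and l1: "l1 \<le> lam1 + lam2"
          and f0: "f (snd p) s - f (fst p) s - E s = 0"
          and fle: "\<And>x y. (x, y) \<in> X \<Longrightarrow> f y s - f x s - E s \<le> 0"
          and fbefore: "\<And>\<tau>. \<lbrakk>0 \<le> \<tau>; \<tau> < s\<rbrakk> \<Longrightarrow> f (snd p) \<tau> - f (fst p) \<tau> - E \<tau> < 0"
          and hle: "h (snd p) s - h (fst p) s \<le> E s"
          and hM: "h (fst p) s \<le> max M1 M2"
        for l1 l2 f0 h0 f h
      proof -
        interpret f: classical_system l1 l2 R T f0 h0 f h by (rule sys)
        obtain a b where ab: "p = (a, b)" by (rule prod.exhaust)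
        have "(a, b) \<in> X" using p ab by simp
        then have a: "norm a \<le> R" and b: "norm b \<le> norm a" by (simp_all add: X_def)
        have "norm b \<noteq> norm a"
        proof
          assume *: "norm b = norm a"
          have "f b s = f a s"
            by (rule f.radial_u) (use s sT in simp, rule sT, simp add: * a, simp add: *)
          then show False using f0 E[of s] unfolding ab by auto
        qed
        then have ba: "norm b < norm a" using b by auto
        have b_ball: "b \<in> ball 0 R" using ba a by auto
        show False
        proof (cases "a \<in> ball 0 R")
          case True
          have "f a s \<le> f z s" if "norm b < norm z" "norm z < R" for z
            using fle[of z b] f0 that ba unfolding ab X_def by auto
          moreover have "\<forall>\<^sub>F z in nhds a. norm z \<in> {norm b<..<R}"
            by (rule eventually_compose_filterlim[OF eventually_nhds_in_open, of "{norm b<..<R}" "norm a"])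
              (use ba True in \<open>auto intro!: tendsto_norm filterlim_ident\<close>)
          ultimately have "\<forall>\<^sub>F z in nhds a. f a s \<le> f z s"
            by (auto elim: eventually_mono)
          then have la: "0 \<le> laplacian (\<lambda>y. f y s) a"
            by (rule f.laplacian_nonneg_at_min[OF True s(1) sT])
          have "f z s \<le> f b s" if "norm z < norm a" for z
            using fle[of a z] f0 that ba a unfolding ab X_def by auto
          moreover have "\<forall>\<^sub>F z in nhds b. norm z \<in> {..<norm a}"
            by (rule eventually_compose_filterlim[OF eventually_nhds_in_open, of "{..<norm a}" "norm b"])
              (use ba in \<open>auto intro!: tendsto_norm filterlim_ident\<close>)
          ultimately have "\<forall>\<^sub>F z in nhds b. f z s - 0 \<le> f b s - 0"
            by (auto elim: eventually_mono)
          then have "laplacian (\<lambda>y. f y s) b \<le> (\<Sum>b\<in>(Basis::'a set). 0)"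
            by (intro f.laplacian_le_at_max[OF b_ball s(1) sT, where h = "\<lambda>_. 0"]) auto
          then have lb: "laplacian (\<lambda>y. f y s) b \<le> 0" by simp
          have "((\<lambda>\<tau>. f b \<tau> - f a \<tau> - E \<tau>) has_real_derivative
              (laplacian (\<lambda>y. f y s) b + l1 * exp (h b s)) -
              (laplacian (\<lambda>y. f y s) a + l1 * exp (h a s)) - E s * C) (at s)"
            by (intro DERIV_diff f.time_derivative_u[OF True s(1) sT]
                f.time_derivative_u[OF b_ball s(1) sT] E')
          then have "0 \<le> (laplacian (\<lambda>y. f y s) b + l1 * exp (h b s)) -
              (laplacian (\<lambda>y. f y s) a + l1 * exp (h a s)) - E s * C"
            by (rule time_derivative_at_touch[where a = 0]) (use s f0 fbefore ab in auto)
          moreover have "l1 * (exp (h b s) - exp (h a s)) < E s * C"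
            by (rule reaction) (use hle hM E[of s] E1[of s] s l1 f.lam1_pos ab in auto)
          ultimately show False using la lb by (simp add: algebra_simps)
        next
          case False
          then obtain e where e: "norm e = 1" "a = R *\<^sub>R e" using sphere_ray a by (auto simp: mem_cball_0)
          have D: "((\<lambda>r. - f (r *\<^sub>R e) s) has_real_derivative - exp (h (R *\<^sub>R e) s)) (at R within {..R})"
            using f.boundary_derivative_u[OF e(1) s(1) sT] by (rule DERIV_minus)
          have max: "- f (r *\<^sub>R e) s \<le> - f (R *\<^sub>R e) s" if "norm b \<le> r" "r < R" for r
          proof -
            have "0 \<le> r" using that norm_ge_zero[of b] by linarith
            then have "norm (r *\<^sub>R e) = r" using e by simp
            then have "(r *\<^sub>R e, b) \<in> X" using that ba a unfolding X_def by auto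
            from fle[OF this] f0 show ?thesis using ab e by auto
          qed
          have "0 \<le> - exp (h (R *\<^sub>R e) s)"
            by (rule left_derivative_at_max[OF D, where a = "norm b"]) (use ba a max in auto)
          then show False by simp
        qed
      qed
      have hu: "u (snd p) s - u (fst p) s - E s \<le> 0" "v (snd p) s - v (fst p) s - E s \<le> 0"
        using g0 unfolding g_def by auto
      have pM: "u (fst p) s \<le> max M1 M2" "v (fst p) s \<le> max M1 M2"
        using M1[of "fst p" s] M2[of "fst p" s] p s unfolding X_def by auto
      consider "u (snd p) s - u (fst p) s - E s = 0" | "v (snd p) s - v (fst p) s - E s = 0"
        using g0 unfolding g_def by (auto simp: max_def split: if_splits)
      then show False
      proof cases
        case 1
        show False
        proof (rule impossible[of lam1 lam2 u0 v0 u v])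
          show "classical_system lam1 lam2 R T u0 v0 u v" by unfold_locales
          show "u y s - u x s - E s \<le> 0" if "(x, y) \<in> X" for x y
            using le[OF that] unfolding g_def by auto
          show "u (snd p) \<tau> - u (fst p) \<tau> - E \<tau> < 0" if "0 \<le> \<tau>" "\<tau> < s" for \<tau>
            using before[OF that] unfolding g_def by auto
        qed (use 1 hu pM lam2_pos in auto)
      next
        case 2
        show False
        proof (rule impossible[of lam2 lam1 v0 u0 v u])
          show "classical_system lam2 lam1 R T v0 u0 v u" by unfold_locales
          show "v y s - v x s - E s \<le> 0" if "(x, y) \<in> X" for x y
            using le[OF that] unfolding g_def by auto
          show "v (snd p) \<tau> - v (fst p) \<tau> - E \<tau> < 0" if "0 \<le> \<tau>" "\<tau> < s" for \<tau>
            using before[OF that] unfolding g_def by auto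
        qed (use 2 hu pM lam1_pos in auto)
      qed
    next
      show "(x, y) \<in> X" using xy by (simp add: X_def)
    qed (use X t in auto)
    then have "u y t - u x t - E t < 0" unfolding g_def by auto
    then show "u y t \<le> u x t + \<epsilon>" using E1[of t] by auto
  qed
qed

end

section \<open>The time needed to grow\<close>

lemma gaussian_barrier_second_derivative:
  fixes y b :: "'a::euclidean_space"
  assumes "b \<in> Basis"
  shows "has_second_derivative (\<lambda>\<sigma>. k * exp (\<beta> * ((norm (y + \<sigma> *\<^sub>R b))\<^sup>2 - c)) + d)
    (k * exp (\<beta> * ((norm y)\<^sup>2 - c)) * (4 * \<beta>\<^sup>2 * (y \<bullet> b)\<^sup>2 + 2 * \<beta>)) 0"
proof -
  have eq: "(norm (y + \<sigma> *\<^sub>R b))\<^sup>2 = (norm y)\<^sup>2 + 2 * \<sigma> * (y \<bullet> b) + \<sigma>\<^sup>2" for \<sigma>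
    using assms unfolding power2_norm_eq_inner
    by (simp add: algebra_simps inner_commute power2_eq_square)
  show ?thesis
    unfolding eq
    by (rule has_second_derivativeI[where S = UNIV and f' =
          "\<lambda>\<sigma>. k * exp (\<beta> * ((norm y)\<^sup>2 + 2 * \<sigma> * (y \<bullet> b) + \<sigma>\<^sup>2 - c)) * (\<beta> * (2 * (y \<bullet> b) + 2 * \<sigma>))"])
      (auto intro!: derivative_eq_intros simp: algebra_simps power2_eq_square)
qed

context classical_system
begin

text \<open>To rise from level \<open>m\<close> to \<open>m + 1\<close> takes a time of order \<open>exp (- 2 m)\<close>: as long as both components
  are below \<open>m + 1\<close>, the flux is at most \<open>a = exp (m + 1)\<close> and creates a boundary layer of width
  \<open>1 / a\<close>, whose height becomes comparable to \<open>1\<close> only after the diffusion time \<open>1 / a\<^sup>2\<close>. The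
  supersolution \<open>m + Z\<close> models this layer by an exponential of \<open>|x|\<^sup>2\<close>, which is smooth at the
  origin.\<close>

lemma slow_growth:
  obtains c where "0 < c"
    and "\<And>m s t x. \<lbrakk>0 \<le> m; 0 \<le> s; s \<le> t; t < T; (t - s) * exp (2 * m) \<le> c;
      \<And>y. norm y \<le> R \<Longrightarrow> u y s < m \<and> v y s < m; norm x \<le> R\<rbrakk> \<Longrightarrow> u x t < m + 1 \<and> v x t < m + 1"
proof -
  interpret vu: classical_system lam2 lam1 R T v0 u0 v u by (rule swapped)
  define n where "n = real DIM('a)"
  define L where "L = lam1 + lam2"
  define c where "c = 1 / ((exp 1)\<^sup>2 * (25 + 5 * n / R + 4 * L))"
  have n: "0 \<le> n" and L: "0 < L" using lam1_pos lam2_pos by (auto simp: n_def L_def)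
  have D: "25 + 5 * n / R + 4 * L > 0" using n L R_pos by (intro add_pos_pos add_pos_nonneg) auto
  then have c: "0 < c" unfolding c_def by (intro divide_pos_pos mult_pos_pos) auto
  moreover have "u x t < m + 1 \<and> v x t < m + 1"
    if m: "0 \<le> m" and st: "0 \<le> s" "s \<le> t" "t < T" and tc: "(t - s) * exp (2 * m) \<le> c"
      and init: "\<And>y. norm y \<le> R \<Longrightarrow> u y s < m \<and> v y s < m" and x: "norm x \<le> R" for m s t x
  proof -
    define a where "a = exp (m + 1)"
    \<comment> \<open>with amplitude at least \<open>1 / 4\<close> the normal derivative \<open>b / 4\<close> of the layer exceeds the flux \<open>a\<close>\<close>
    define b where "b = 5 * a"
    define \<mu> where "\<mu> = b\<^sup>2 + n * b / R"
    define \<beta> where "\<beta> = b / (2 * R)"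
    define Z where "Z y \<tau> = 1 / 4 * exp (\<mu> * (\<tau> - s)) * exp (\<beta> * ((norm y)\<^sup>2 - R\<^sup>2)) + L * a * (\<tau> - s)"
      for y :: 'a and \<tau>
    have a1: "1 \<le> a" unfolding a_def using m by simp
    then have b: "0 < b" and \<beta>: "0 < \<beta>" using R_pos by (auto simp: b_def \<beta>_def)
    have a2: "(t - s) * a\<^sup>2 * (25 + 5 * n / R + 4 * L) \<le> 1"
    proof -
      have "a\<^sup>2 = exp (2 * m) * (exp 1)\<^sup>2"
        unfolding a_def by (simp add: power2_eq_square algebra_simps flip: exp_add)
      then have "(t - s) * a\<^sup>2 * (25 + 5 * n / R + 4 * L) =
          (t - s) * exp (2 * m) * ((exp 1)\<^sup>2 * (25 + 5 * n / R + 4 * L))"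
        by simp
      also have "\<dots> \<le> c * ((exp 1)\<^sup>2 * (25 + 5 * n / R + 4 * L))"
        using tc D by (intro mult_right_mono) auto
      also have "\<dots> = 1" unfolding c_def using D by simp
      finally show ?thesis .
    qed
    have aa: "a \<le> a\<^sup>2" using a1 by (simp add: power2_eq_square)
    have \<mu>: "\<mu> * (t - s) \<le> 1" and La: "L * a * (t - s) \<le> 1 / 4"
    proof -
      have "\<mu> \<le> a\<^sup>2 * (25 + 5 * n / R)"
      proof -
        have "5 * n / R * a \<le> 5 * n / R * a\<^sup>2" using n R_pos aa by (intro mult_left_mono) auto
        then show ?thesis unfolding \<mu>_def b_def by (simp add: algebra_simps power2_eq_square)
      qed
      then have "\<mu> * (t - s) \<le> (a\<^sup>2 * (25 + 5 * n / R)) * (t - s)"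
        using st by (intro mult_right_mono) auto
      also have "\<dots> = (t - s) * a\<^sup>2 * (25 + 5 * n / R)" by simp
      finally have 1: "\<mu> * (t - s) \<le> (t - s) * a\<^sup>2 * (25 + 5 * n / R)" .
      have 2: "(t - s) * a\<^sup>2 * (25 + 5 * n / R) + (t - s) * a\<^sup>2 * (4 * L) \<le> 1"
        using a2 by (simp only: distrib_left)
      have "0 \<le> (t - s) * a\<^sup>2 * (4 * L)" using st L by simp
      with 1 2 show "\<mu> * (t - s) \<le> 1" by linarith
      have "L * a * (t - s) \<le> L * a\<^sup>2 * (t - s)"
        using st L aa by (intro mult_right_mono mult_left_mono) auto
      also have "\<dots> = (t - s) * a\<^sup>2 * (4 * L) / 4" by simp
      finally have 3: "L * a * (t - s) \<le> (t - s) * a\<^sup>2 * (4 * L) / 4" .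
      have "0 \<le> (t - s) * a\<^sup>2 * (25 + 5 * n / R)" using st n R_pos by simp
      with 2 3 show "L * a * (t - s) \<le> 1 / 4" by linarith
    qed
    have \<mu>0: "0 < \<mu>" using b n R_pos unfolding \<mu>_def by (simp add: add_pos_nonneg)
    have Z1: "Z y \<tau> < 1" if "norm y \<le> R" "s \<le> \<tau>" "\<tau> \<le> t" for y \<tau>
    proof -
      have "\<mu> * (\<tau> - s) \<le> \<mu> * (t - s)"
        using \<mu>0 that by (intro mult_left_mono) auto
      then have "exp (\<mu> * (\<tau> - s)) \<le> exp 1"
        using \<mu> by simp
      moreover have "(norm y)\<^sup>2 \<le> R\<^sup>2" using that by (intro power_mono) auto
      then have "\<beta> * ((norm y)\<^sup>2 - R\<^sup>2) \<le> 0" using \<beta> by (intro mult_nonneg_nonpos) auto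
      then have "exp (\<beta> * ((norm y)\<^sup>2 - R\<^sup>2)) \<le> 1" by simp
      ultimately have "exp (\<mu> * (\<tau> - s)) * exp (\<beta> * ((norm y)\<^sup>2 - R\<^sup>2)) \<le> exp 1 * 1"
        by (intro mult_mono) auto
      moreover have "L * a * (\<tau> - s) \<le> L * a * (t - s)"
        using that L a1 by (intro mult_left_mono) auto
      moreover have "exp 1 < (3::real)" using e_less_272 by simp
      ultimately show ?thesis unfolding Z_def using La by simp
    qed
    define g where "g y \<tau> = max (u y \<tau> - Z y \<tau> - m) (v y \<tau> - Z y \<tau> - m)" for y \<tau>
    have "g x t < 0"
    proof (rule first_touch[where g = g and X = "cball 0 R" and a = s and b = t])
      have contZ: "continuous_on (cball 0 R \<times> {s..t}) (\<lambda>p. Z (fst p) (snd p))"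
        unfolding Z_def by (intro continuous_intros)
      show "continuous_on (cball 0 R \<times> {s..t}) (\<lambda>(x, t). g x t)"
        unfolding case_prod_beta g_def
        by (intro continuous_intros continuous_u_compose vu.continuous_u_compose contZ)
          (use st in auto)
    next
      fix y :: 'a assume y: "y \<in> cball 0 R"
      have "0 \<le> Z y s" unfolding Z_def by simp
      with y init[of y] show "g y s < 0" unfolding g_def by auto
    next
      fix y \<tau>
      assume y: "y \<in> cball 0 R" and \<tau>: "s < \<tau>" "\<tau> \<le> t" and g0: "g y \<tau> = 0"
        and le: "\<And>z. z \<in> cball 0 R \<Longrightarrow> g z \<tau> \<le> 0"
        and before: "\<And>\<sigma>. \<lbrakk>s \<le> \<sigma>; \<sigma> < \<tau>\<rbrakk> \<Longrightarrow> g y \<sigma> < 0"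
      have \<tau>T: "0 < \<tau>" "\<tau> < T" using \<tau> st by auto
      have impossible: False
        if sys: "classical_system l1 l2 R T f0 h0 f h" and l1: "l1 < L"
          and fg0: "f y \<tau> - Z y \<tau> - m = 0"
          and fle: "\<And>z. z \<in> cball 0 R \<Longrightarrow> f z \<tau> - Z z \<tau> - m \<le> 0"
          and fbefore: "\<And>\<sigma>. \<lbrakk>s \<le> \<sigma>; \<sigma> < \<tau>\<rbrakk> \<Longrightarrow> f y \<sigma> - Z y \<sigma> - m < 0"
          and hle: "h y \<tau> - Z y \<tau> - m \<le> 0"
        for l1 l2 f0 h0 f h
      proof -
        interpret f: classical_system l1 l2 R T f0 h0 f h by (rule sys)
        define k where "k = 1 / 4 * exp (\<mu> * (\<tau> - s))"
        have k: "1 / 4 \<le> k" unfolding k_def using \<mu>0 \<tau> by simp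
        have "h y \<tau> \<le> m + 1" using hle Z1[of y \<tau>] y \<tau> by auto
        then have ha: "exp (h y \<tau>) \<le> a" unfolding a_def by simp
        have max: "f z \<tau> - Z z \<tau> \<le> f y \<tau> - Z y \<tau>" if "z \<in> cball 0 R" for z
          using fle[OF that] fg0 by simp
        show False
        proof (cases "y \<in> ball 0 R")
          case True
          define \<Phi> where "\<Phi> = k * exp (\<beta> * ((norm y)\<^sup>2 - R\<^sup>2))"
          have \<Phi>: "0 \<le> \<Phi>" using k unfolding \<Phi>_def by simp
          have "laplacian (\<lambda>y. f y \<tau>) y \<le> (\<Sum>b\<in>Basis. \<Phi> * (4 * \<beta>\<^sup>2 * (y \<bullet> b)\<^sup>2 + 2 * \<beta>))"
          proof (rule f.laplacian_le_at_max[OF True \<tau>T, where h = "\<lambda>z. Z z \<tau>"])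
            show "has_second_derivative (\<lambda>\<sigma>. Z (y + \<sigma> *\<^sub>R b) \<tau>) (\<Phi> * (4 * \<beta>\<^sup>2 * (y \<bullet> b)\<^sup>2 + 2 * \<beta>)) 0"
              if "b \<in> Basis" for b
              using gaussian_barrier_second_derivative[OF that, of k \<beta> y "R\<^sup>2" "L * a * (\<tau> - s)"]
              unfolding Z_def k_def \<Phi>_def by simp
            show "\<forall>\<^sub>F z in nhds y. f z \<tau> - Z z \<tau> \<le> f y \<tau> - Z y \<tau>"
              using eventually_in_ball[OF True] by eventually_elim (rule max, simp)
          qed
          also have "\<dots> = \<Phi> * (4 * \<beta>\<^sup>2 * (norm y)\<^sup>2 + 2 * \<beta> * n)"
            unfolding n_def norm_eq_sqrt_inner euclidean_inner[of y y]
            by (simp add: sum.distrib sum_distrib_left power2_eq_square algebra_simps sum_nonneg)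
          also have "\<dots> \<le> \<Phi> * \<mu>"
          proof (rule mult_left_mono[OF _ \<Phi>])
            have "(norm y)\<^sup>2 \<le> R\<^sup>2" using True by (intro power_mono) auto
            then have "4 * \<beta>\<^sup>2 * (norm y)\<^sup>2 \<le> 4 * \<beta>\<^sup>2 * R\<^sup>2" by (intro mult_left_mono) auto
            also have "\<dots> = b\<^sup>2" using R_pos unfolding \<beta>_def by (simp add: power2_eq_square field_simps)
            finally show "4 * \<beta>\<^sup>2 * (norm y)\<^sup>2 + 2 * \<beta> * n \<le> \<mu>"
              using R_pos unfolding \<mu>_def \<beta>_def by (simp add: field_simps)
          qed
          finally have lap: "laplacian (\<lambda>y. f y \<tau>) y \<le> \<Phi> * \<mu>" .
          have Zt: "(Z y has_real_derivative \<Phi> * \<mu> + L * a) (at \<tau>)"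
            unfolding Z_def \<Phi>_def k_def by (auto intro!: derivative_eq_intros simp: algebra_simps)
          have "((\<lambda>\<tau>. f y \<tau> - Z y \<tau> - m) has_real_derivative
              (laplacian (\<lambda>y. f y \<tau>) y + l1 * exp (h y \<tau>)) - (\<Phi> * \<mu> + L * a) - 0) (at \<tau>)"
            by (intro DERIV_diff f.time_derivative_u[OF True \<tau>T] Zt DERIV_const)
          then have "0 \<le> (laplacian (\<lambda>y. f y \<tau>) y + l1 * exp (h y \<tau>)) - (\<Phi> * \<mu> + L * a) - 0"
            by (rule time_derivative_at_touch[where a = s]) (use \<tau> fg0 fbefore in auto)
          moreover have "l1 * exp (h y \<tau>) < L * a"
            by (rule mult_less_le_imp_less) (use l1 ha f.lam1_pos in auto)
          ultimately show False using lap by simp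
        next
          case False
          then obtain e where e: "norm e = 1" "y = R *\<^sub>R e" using sphere_ray y by blast
          have Zr: "Z (r *\<^sub>R e) \<tau> = k * exp (\<beta> * (r\<^sup>2 - R\<^sup>2)) + L * a * (\<tau> - s)" for r
            unfolding Z_def k_def using e by simp
          have "((\<lambda>r. k * exp (\<beta> * (r\<^sup>2 - R\<^sup>2)) + L * a * (\<tau> - s)) has_real_derivative k * b) (at R within {..R})"
            using R_pos unfolding \<beta>_def by (auto intro!: derivative_eq_intros simp: field_simps)
          then have "((\<lambda>r. f (r *\<^sub>R e) \<tau> - Z (r *\<^sub>R e) \<tau>) has_real_derivative
              exp (h (R *\<^sub>R e) \<tau>) - k * b) (at R within {..R})"
            unfolding Zr by (intro DERIV_diff f.boundary_derivative_u[OF e(1) \<tau>T])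
          then have "0 \<le> exp (h (R *\<^sub>R e) \<tau>) - k * b"
            by (rule left_derivative_at_max[OF _ R_pos])
              (use max[OF ray_in_cball[OF e(1)]] e in auto)
          moreover have "1 / 4 * b \<le> k * b" using k b by (intro mult_right_mono) auto
          moreover have "exp (h (R *\<^sub>R e) \<tau>) \<le> a" using ha e by simp
          ultimately show False using a1 unfolding b_def by linarith
        qed
      qed
      have hle: "u y \<tau> - Z y \<tau> - m \<le> 0" "v y \<tau> - Z y \<tau> - m \<le> 0"
        using g0 unfolding g_def by auto
      consider "u y \<tau> - Z y \<tau> - m = 0" | "v y \<tau> - Z y \<tau> - m = 0"
        using g0 unfolding g_def by (auto simp: max_def split: if_splits)
      then show False
      proof cases
        case 1
        show False
        proof (rule impossible[of lam1 lam2 u0 v0 u v])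
          show "classical_system lam1 lam2 R T u0 v0 u v" by unfold_locales
          show "u z \<tau> - Z z \<tau> - m \<le> 0" if "z \<in> cball 0 R" for z
            using le[OF that] unfolding g_def by auto
          show "u y \<sigma> - Z y \<sigma> - m < 0" if "s \<le> \<sigma>" "\<sigma> < \<tau>" for \<sigma>
            using before[OF that] unfolding g_def by auto
        qed (use 1 hle lam2_pos L_def in auto)
      next
        case 2
        show False
        proof (rule impossible[of lam2 lam1 v0 u0 v u])
          show "classical_system lam2 lam1 R T v0 u0 v u" by unfold_locales
          show "v z \<tau> - Z z \<tau> - m \<le> 0" if "z \<in> cball 0 R" for z
            using le[OF that] unfolding g_def by auto
          show "v y \<sigma> - Z y \<sigma> - m < 0" if "s \<le> \<sigma>" "\<sigma> < \<tau>" for \<sigma>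
            using before[OF that] unfolding g_def by auto
        qed (use 2 hle lam1_pos L_def in auto)
      qed
    qed (use x st in auto)
    then show ?thesis using Z1[of x t] x st unfolding g_def by auto
  qed
  ultimately show thesis using that by blast
qed

end

section \<open>Reduction to the radial variable\<close>

context classical_system
begin

lemma has_second_partial_u:
  assumes "b \<in> Basis" "x \<in> ball 0 R" "0 < t" "t < T"
  shows "has_partial b (partial b (\<lambda>y. u y t)) x"
  using regular assms unfolding classical_regularity_def by simp

lemma radial_derivatives:
  assumes e: "e \<in> Basis" and r: "0 < r" "r < R" and t: "0 < t" "t < T"
  shows "((\<lambda>r. u (r *\<^sub>R e) t) has_real_derivative partial e (\<lambda>y. u y t) (r *\<^sub>R e)) (at r)"
    and "((\<lambda>r. partial e (\<lambda>y. u y t) (r *\<^sub>R e)) has_real_derivative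
          partial e (partial e (\<lambda>y. u y t)) (r *\<^sub>R e)) (at r)"
proof -
  have n: "norm e = 1" using e by simp
  show "((\<lambda>r. u (r *\<^sub>R e) t) has_real_derivative partial e (\<lambda>y. u y t) (r *\<^sub>R e)) (at r)"
    using partial_derivative_u[OF e, of 0 r t] r t n by simp
  let ?g = "partial e (\<lambda>y. u y t)"
  have "has_partial e ?g (r *\<^sub>R e)"
    by (rule has_second_partial_u) (use e t r n in auto)
  then have "((\<lambda>s. ?g (r *\<^sub>R e + s *\<^sub>R e)) has_real_derivative
      deriv (\<lambda>s. ?g (r *\<^sub>R e + s *\<^sub>R e)) 0) (at 0)"
    unfolding has_partial_def DERIV_deriv_iff_real_differentiable .
  then have "((\<lambda>s. ?g ((s + r) *\<^sub>R e)) has_real_derivative partial e ?g (r *\<^sub>R e)) (at 0)"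
    unfolding partial_def[of e ?g "r *\<^sub>R e"] scaleR_add_left[symmetric] by (simp only: add.commute)
  then show "((\<lambda>r. ?g (r *\<^sub>R e)) has_real_derivative partial e ?g (r *\<^sub>R e)) (at r)"
    using DERIV_shift[of "\<lambda>s. ?g (s *\<^sub>R e)" _ 0 r] by simp
qed

text \<open>A direction \<open>b\<close> orthogonal to \<open>e\<close> is tangential at \<open>r e\<close>. There the profile is read off along
  \<open>s \<mapsto> \<surd>(r\<^sup>2 + s\<^sup>2)\<close>, whose curvature at \<open>0\<close> is \<open>1 / r\<close>.\<close>

lemma tangential_second_derivative:
  assumes e: "e \<in> Basis" and b: "b \<in> Basis" and eb: "b \<noteq> e"
    and r: "0 < r" "r < R" and t: "0 < t" "t < T"
  shows "partial b (partial b (\<lambda>y. u y t)) (r *\<^sub>R e) = partial e (\<lambda>y. u y t) (r *\<^sub>R e) / r"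
proof -
  define w where "w = (\<lambda>r. partial e (\<lambda>y. u y t) (r *\<^sub>R e))"
  define \<phi> where "\<phi> s = sqrt (r\<^sup>2 + s\<^sup>2)" for s :: real
  have pos: "r\<^sup>2 + s\<^sup>2 > 0" for s using r by (simp add: add_pos_nonneg)
  have \<phi>0: "0 < \<phi> s" for s using pos unfolding \<phi>_def by simp
  have \<phi>_r: "\<phi> 0 = r" using r unfolding \<phi>_def by simp
  have \<phi>': "(\<phi> has_real_derivative s / \<phi> s) (at s)" for s
    unfolding \<phi>_def using pos[of s] by (auto intro!: derivative_eq_intros simp: field_simps)
  have norm_line: "norm (r *\<^sub>R e + s *\<^sub>R b) = \<phi> s" for s
  proof -
    have "e \<bullet> b = 0" using e b eb by (simp add: inner_Basis)
    then have "(r *\<^sub>R e + s *\<^sub>R b) \<bullet> (r *\<^sub>R e + s *\<^sub>R b) = r\<^sup>2 + s\<^sup>2"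
      using e b by (simp add: algebra_simps inner_commute power2_eq_square)
    then show ?thesis unfolding \<phi>_def norm_eq_sqrt_inner by simp
  qed
  have \<phi>_tendsto: "(\<phi> \<longlongrightarrow> \<phi> s) (nhds s)" for s
    using DERIV_isCont[OF \<phi>'[of s]] tendsto_at_iff_tendsto_nhds[of \<phi> s] by (simp add: isCont_def)
  have "(\<phi> \<longlongrightarrow> r) (nhds 0)" using \<phi>_tendsto[of 0] \<phi>_r by simp
  then have near: "\<forall>\<^sub>F s in nhds 0. \<phi> s < R" using r by (intro order_tendstoD)
  have tangential: "partial b (\<lambda>y. u y t) (r *\<^sub>R e + s *\<^sub>R b) = w (\<phi> s) * (s / \<phi> s)" if s: "\<phi> s < R" for s
  proof -
    have ball: "r *\<^sub>R e + s *\<^sub>R b \<in> ball 0 R" using that norm_line[of s] by simp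
    have line: "((\<lambda>s. u (r *\<^sub>R e + s *\<^sub>R b) t) has_real_derivative partial b (\<lambda>y. u y t) (r *\<^sub>R e + s *\<^sub>R b)) (at s)"
      by (rule partial_derivative_u[OF b ball t])
    have D: "((\<lambda>s. u (\<phi> s *\<^sub>R e) t) has_real_derivative w (\<phi> s) * (s / \<phi> s)) (at s)"
      unfolding w_def by (rule DERIV_chain2[OF radial_derivatives(1)[OF e \<phi>0 s t] \<phi>'])
    have ev: "\<forall>\<^sub>F s in nhds s. u (\<phi> s *\<^sub>R e) t = u (r *\<^sub>R e + s *\<^sub>R b) t"
    proof -
      have "\<forall>\<^sub>F s in nhds s. \<phi> s < R" using s by (rule order_tendstoD(2)[OF \<phi>_tendsto])
      then show ?thesis
      proof eventually_elim
        case (elim \<sigma>)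
        have "norm (\<phi> \<sigma> *\<^sub>R e) = \<phi> \<sigma>" using e \<phi>0[of \<sigma>] by simp
        then show ?case
          using t elim norm_line by (intro radial_u) simp_all
      qed
    qed
    have "((\<lambda>s. u (r *\<^sub>R e + s *\<^sub>R b) t) has_real_derivative w (\<phi> s) * (s / \<phi> s)) (at s)"
      by (rule iffD1[OF DERIV_cong_ev[OF refl ev refl] D])
    then show ?thesis by (rule DERIV_unique[OF line])
  qed
  have wd: "(w has_real_derivative partial e (partial e (\<lambda>y. u y t)) (r *\<^sub>R e)) (at (\<phi> 0))"
    unfolding w_def \<phi>_r by (rule radial_derivatives(2)[OF e r t])
  have dw: "((\<lambda>s. w (\<phi> s)) has_real_derivative
      partial e (partial e (\<lambda>y. u y t)) (r *\<^sub>R e) * (0 / \<phi> 0)) (at 0)"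
    by (rule DERIV_chain2[OF wd \<phi>'])
  have dq: "((\<lambda>s. s / \<phi> s) has_real_derivative (1 * \<phi> 0 - 0 * (0 / \<phi> 0)) / (\<phi> 0 * \<phi> 0)) (at 0)"
    by (rule DERIV_divide[OF DERIV_ident \<phi>']) (use \<phi>_r r in simp)
  have D: "((\<lambda>s. w (\<phi> s) * (s / \<phi> s)) has_real_derivative w r / r) (at 0)"
    using DERIV_mult[OF dw dq] r unfolding \<phi>_r by simp
  have ev: "\<forall>\<^sub>F s in nhds 0. w (\<phi> s) * (s / \<phi> s) = partial b (\<lambda>y. u y t) (r *\<^sub>R e + s *\<^sub>R b)"
    using near by eventually_elim (rule tangential[symmetric])
  have "((\<lambda>s. partial b (\<lambda>y. u y t) (r *\<^sub>R e + s *\<^sub>R b)) has_real_derivative w r / r) (at 0)"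
    by (rule iffD1[OF DERIV_cong_ev[OF refl ev refl] D])
  then have "deriv (\<lambda>s. partial b (\<lambda>y. u y t) (r *\<^sub>R e + s *\<^sub>R b)) 0 = w r / r"
    by (rule DERIV_imp_deriv)
  then show ?thesis
    unfolding partial_def[of b "partial b (\<lambda>y. u y t)" "r *\<^sub>R e"] by (simp only: w_def)
qed

lemma radial_laplacian:
  assumes e: "e \<in> Basis" and r: "0 < r" "r < R" and t: "0 < t" "t < T"
  shows "laplacian (\<lambda>y. u y t) (r *\<^sub>R e) = partial e (partial e (\<lambda>y. u y t)) (r *\<^sub>R e) +
    (real DIM('a) - 1) / r * partial e (\<lambda>y. u y t) (r *\<^sub>R e)"
proof -
  have "(\<Sum>b\<in>Basis - {e}. partial b (partial b (\<lambda>y. u y t)) (r *\<^sub>R e)) =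
      (\<Sum>b\<in>Basis - {e}. partial e (\<lambda>y. u y t) (r *\<^sub>R e) / r)"
    by (intro sum.cong refl tangential_second_derivative e r t) auto
  also have "\<dots> = real (card (Basis - {e})) * (partial e (\<lambda>y. u y t) (r *\<^sub>R e) / r)"
    by simp
  also have "real (card (Basis - {e})) = real DIM('a) - 1"
    using e by (simp add: card_Diff_singleton of_nat_diff DIM_positive Suc_leI)
  finally show ?thesis
    unfolding laplacian_def sum.remove[OF finite_Basis e] by simp
qed

lemma radial_lipschitz:
  assumes e: "e \<in> Basis" and t: "0 < t" "t < T"
  obtains P where "0 \<le> P"
    and "\<And>r r'. \<lbrakk>0 \<le> r'; r' \<le> r; r \<le> R\<rbrakk> \<Longrightarrow> u (r *\<^sub>R e) t - u (r' *\<^sub>R e) t \<le> P * (r - r')"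
proof -
  have n: "norm e = 1" using e by simp
  have "\<exists>g. continuous_extension (ball 0 R \<times> {0<..<T}) (cball 0 R \<times> {0<..<T})
      (\<lambda>(x, t). partial e (\<lambda>y. u y t) x) g"
    using regular e unfolding classical_regularity_def by blast
  then obtain g where "continuous_extension (ball 0 R \<times> {0<..<T}) (cball 0 R \<times> {0<..<T})
      (\<lambda>(x, t). partial e (\<lambda>y. u y t) x) g" ..
  then have gc: "continuous_on (cball 0 R \<times> {0<..<T}) g"
    and g': "\<forall>p\<in>ball 0 R \<times> {0<..<T}. g p = (\<lambda>(x, t). partial e (\<lambda>y. u y t) x) p"
    unfolding continuous_extension_def by blast+
  have g: "g (x, t) = partial e (\<lambda>y. u y t) x" if "x \<in> ball 0 R" for x
    using bspec[OF g', of "(x, t)"] that t by simp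
  have "compact (g ` (cball 0 R \<times> {t}))"
    by (intro compact_continuous_image compact_Times continuous_on_subset[OF gc]) (use t in auto)
  then have "bdd_above (g ` (cball 0 R \<times> {t}))"
    by (intro bounded_imp_bdd_above compact_imp_bounded)
  then obtain P where "\<And>y. y \<in> g ` (cball 0 R \<times> {t}) \<Longrightarrow> y \<le> P"
    unfolding bdd_above_def by blast
  then have P: "g (x, t) \<le> P" if "x \<in> cball 0 R" for x using that by auto
  have "u (r *\<^sub>R e) t - u (r' *\<^sub>R e) t \<le> \<bar>P\<bar> * (r - r')" if r: "0 \<le> r'" "r' \<le> r" "r \<le> R" for r r'
  proof (cases "r' = r")
    case False
    have "\<exists>l z. r' < z \<and> z < r \<and> ((\<lambda>r. u (r *\<^sub>R e) t) has_real_derivative l) (at z) \<and>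
        u (r *\<^sub>R e) t - u (r' *\<^sub>R e) t = (r - r') * l"
    proof (rule MVT)
      show "continuous_on {r'..r} (\<lambda>r. u (r *\<^sub>R e) t)"
        by (intro continuous_u_compose continuous_intros) (use r n t in auto)
      show "(\<lambda>r. u (r *\<^sub>R e) t) differentiable (at z)" if "r' < z" "z < r" for z
        using radial_derivatives(1)[OF e _ _ t, of z] that r unfolding real_differentiable_def by auto
    qed (use r False in auto)
    then obtain l z where z: "r' < z" "z < r" "((\<lambda>r. u (r *\<^sub>R e) t) has_real_derivative l) (at z)"
      and eq: "u (r *\<^sub>R e) t - u (r' *\<^sub>R e) t = (r - r') * l" by blast
    have "l = partial e (\<lambda>y. u y t) (z *\<^sub>R e)"
      by (rule DERIV_unique[OF z(3) radial_derivatives(1)[OF e _ _ t]]) (use z r in auto)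
    also have "\<dots> = g (z *\<^sub>R e, t)" using g[of "z *\<^sub>R e"] z r n by auto
    also have "\<dots> \<le> \<bar>P\<bar>" using P[of "z *\<^sub>R e"] z r n by auto
    finally have "(r - r') * l \<le> (r - r') * \<bar>P\<bar>" using r by (intro mult_left_mono) auto
    with eq show ?thesis by (simp add: mult.commute)
  qed auto
  then show thesis using that[of "\<bar>P\<bar>"] by auto
qed

end

section \<open>Radial profiles\<close>

text \<open>The profiles along a ray, together with the consequences of the previous sections that are used
  for them; \<open>k\<close> stands for the dimension minus one. The derivatives are parameters, since only their
  defining properties matter. The slopes are known to be bounded at the time \<open>T / 2\<close>, where they serve
  as initial values.\<close>

locale radial_system =
  fixes R T lam1 lam2 k K c P :: real
    and U V Ur Vr Urr Vrr :: "real \<Rightarrow> real \<Rightarrow> real"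
  assumes R_pos: "0 < R" and T_pos: "0 < T" and lam1_pos: "0 < lam1" and lam2_pos: "0 < lam2"
    and k_nonneg: "0 \<le> k"
    and continuous_U: "continuous_on ({0..R} \<times> {0..<T}) (\<lambda>(r, t). U r t)"
    and continuous_V: "continuous_on ({0..R} \<times> {0..<T}) (\<lambda>(r, t). V r t)"
    and U_r: "\<lbrakk>0 < r; r < R; 0 < t; t < T\<rbrakk> \<Longrightarrow> ((\<lambda>r. U r t) has_real_derivative Ur r t) (at r)"
    and V_r: "\<lbrakk>0 < r; r < R; 0 < t; t < T\<rbrakk> \<Longrightarrow> ((\<lambda>r. V r t) has_real_derivative Vr r t) (at r)"
    and U_rr: "\<lbrakk>0 < r; r < R; 0 < t; t < T\<rbrakk> \<Longrightarrow> ((\<lambda>r. Ur r t) has_real_derivative Urr r t) (at r)"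
    and V_rr: "\<lbrakk>0 < r; r < R; 0 < t; t < T\<rbrakk> \<Longrightarrow> ((\<lambda>r. Vr r t) has_real_derivative Vrr r t) (at r)"
    and U_t: "\<lbrakk>0 < r; r < R; 0 < t; t < T\<rbrakk> \<Longrightarrow>
      (U r has_real_derivative Urr r t + k / r * Ur r t + lam1 * exp (V r t)) (at t)"
    and V_t: "\<lbrakk>0 < r; r < R; 0 < t; t < T\<rbrakk> \<Longrightarrow>
      (V r has_real_derivative Vrr r t + k / r * Vr r t + lam2 * exp (U r t)) (at t)"
    and U_R: "\<lbrakk>0 < t; t < T\<rbrakk> \<Longrightarrow> ((\<lambda>r. U r t) has_real_derivative exp (V R t)) (at R within {..R})"
    and V_R: "\<lbrakk>0 < t; t < T\<rbrakk> \<Longrightarrow> ((\<lambda>r. V r t) has_real_derivative exp (U R t)) (at R within {..R})"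
    and U_nonneg: "\<lbrakk>0 \<le> r; r \<le> R; 0 \<le> t; t < T\<rbrakk> \<Longrightarrow> 0 \<le> U r t"
    and V_nonneg: "\<lbrakk>0 \<le> r; r \<le> R; 0 \<le> t; t < T\<rbrakk> \<Longrightarrow> 0 \<le> V r t"
    and U_mono: "\<lbrakk>0 \<le> r'; r' \<le> r; r \<le> R; 0 \<le> t; t < T\<rbrakk> \<Longrightarrow> U r' t \<le> U r t"
    and V_mono: "\<lbrakk>0 \<le> r'; r' \<le> r; r \<le> R; 0 \<le> t; t < T\<rbrakk> \<Longrightarrow> V r' t \<le> V r t"
    and K_nonneg: "0 \<le> K"
    and UV_bounded: "\<lbrakk>0 \<le> r; r \<le> R; 0 \<le> t; t < T\<rbrakk> \<Longrightarrow> \<bar>U r t - V r t\<bar> \<le> K"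
    and c_pos: "0 < c"
    and growth: "\<lbrakk>0 \<le> m; 0 \<le> s; s \<le> t; t < T; (t - s) * exp (2 * m) \<le> c; U R s < m; V R s < m\<rbrakk>
      \<Longrightarrow> U R t < m + 1 \<and> V R t < m + 1"
    and P_nonneg: "0 \<le> P"
    and U_lipschitz: "\<lbrakk>0 \<le> r'; r' \<le> r; r \<le> R\<rbrakk> \<Longrightarrow> U r (T / 2) - U r' (T / 2) \<le> P * (r - r')"
    and V_lipschitz: "\<lbrakk>0 \<le> r'; r' \<le> r; r \<le> R\<rbrakk> \<Longrightarrow> V r (T / 2) - V r' (T / 2) \<le> P * (r - r')"
begin

definition w :: "real \<Rightarrow> real \<Rightarrow> real" where
  "w r t = (U r t + V r t) / 2"

definition flux :: "real \<Rightarrow> real" where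
  "flux t = (exp (U R t) + exp (V R t)) / 2"

text \<open>The flux may oscillate in time. Estimates are made at times where it attains the largest value so
  far. The restriction to the second half of the time interval leaves \<open>T / 2\<close> as a fixed starting time
  for comparison arguments.\<close>

definition record_flux :: "real \<Rightarrow> real \<Rightarrow> bool" where
  "record_flux G t \<longleftrightarrow> T / 2 \<le> t \<and> t < T \<and> flux t = G \<and> (\<forall>s\<in>{0..t}. flux s \<le> G)"

lemma swapped: "radial_system R T lam2 lam1 k K c P V U Vr Ur Vrr Urr"
proof
  show "\<bar>V r t - U r t\<bar> \<le> K" if "0 \<le> r" "r \<le> R" "0 \<le> t" "t < T" for r t
    using UV_bounded[OF that] by simp
  show "V R t < m + 1 \<and> U R t < m + 1"
    if "0 \<le> m" "0 \<le> s" "s \<le> t" "t < T" "(t - s) * exp (2 * m) \<le> c" "V R s < m" "U R s < m" for m s t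
    using growth[of m s t] that by blast
qed (rule R_pos T_pos lam1_pos lam2_pos k_nonneg continuous_U continuous_V U_r V_r U_rr V_rr U_t V_t
    U_R V_R U_nonneg V_nonneg U_mono V_mono K_nonneg c_pos P_nonneg U_lipschitz V_lipschitz; assumption)+

lemma flux_swapped: "radial_system.flux R V U = flux"
  unfolding radial_system.flux_def[OF swapped] flux_def by (simp add: add.commute)

lemma record_flux_swapped: "radial_system.record_flux R T V U = record_flux"
  unfolding radial_system.record_flux_def[OF swapped] record_flux_def flux_swapped ..

lemma continuous_on_profile:
  assumes "continuous_on ({0..R} \<times> {0..<T}) (\<lambda>(r, t). f r t)"
    and "continuous_on S g" "continuous_on S h"
    and "\<And>p. p \<in> S \<Longrightarrow> 0 \<le> g p \<and> g p \<le> R" "\<And>p. p \<in> S \<Longrightarrow> 0 \<le> h p \<and> h p < T"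
  shows "continuous_on S (\<lambda>p. f (g p) (h p))"
proof -
  have "continuous_on S ((\<lambda>(r, t). f r t) \<circ> (\<lambda>p. (g p, h p)))"
  proof (rule continuous_on_compose)
    show "continuous_on S (\<lambda>p. (g p, h p))" using assms by (intro continuous_intros)
    show "continuous_on ((\<lambda>p. (g p, h p)) ` S) (\<lambda>(r, t). f r t)"
      by (rule continuous_on_subset[OF assms(1)]) (use assms(4,5) in auto)
  qed
  then show ?thesis by (simp add: o_def)
qed

lemmas continuous_U_compose = continuous_on_profile[OF continuous_U]
lemmas continuous_V_compose = continuous_on_profile[OF continuous_V]

lemma continuous_w_compose:
  assumes "continuous_on S g" "continuous_on S h"
    and "\<And>p. p \<in> S \<Longrightarrow> 0 \<le> g p \<and> g p \<le> R" "\<And>p. p \<in> S \<Longrightarrow> 0 \<le> h p \<and> h p < T"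
  shows "continuous_on S (\<lambda>p. w (g p) (h p))"
  unfolding w_def
  by (intro continuous_intros continuous_U_compose continuous_V_compose assms) (use assms(3,4) in auto)

lemma U_second:
  assumes "0 < r" "r < R" "0 < t" "t < T"
  shows "has_second_derivative (\<lambda>r. U r t) (Urr r t) r"
  by (rule has_second_derivativeI[where S = "{0<..<R}" and f' = "\<lambda>r. Ur r t"])
    (use assms U_r U_rr in auto)

lemma V_second:
  assumes "0 < r" "r < R" "0 < t" "t < T"
  shows "has_second_derivative (\<lambda>r. V r t) (Vrr r t) r"
  by (rule has_second_derivativeI[where S = "{0<..<R}" and f' = "\<lambda>r. Vr r t"])
    (use assms V_r V_rr in auto)

text \<open>This inequality between the geometric and the arithmetic mean of the boundary fluxes makes \<open>w\<close> a
  supersolution of the scalar problem with boundary flux \<open>exp w\<close>.\<close>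

lemma exp_w_le_flux: "exp (w R t) \<le> flux t"
proof -
  have "0 \<le> (exp (U R t / 2) - exp (V R t / 2))\<^sup>2" by simp
  also have "\<dots> = exp (U R t) + exp (V R t) - 2 * exp (w R t)"
  proof -
    have sq: "(exp (x / 2))\<^sup>2 = exp x" for x :: real
      by (simp add: power2_eq_square flip: exp_add)
    have "exp (w R t) = exp (U R t / 2) * exp (V R t / 2)"
      unfolding w_def by (simp add: add_divide_distrib exp_add)
    then show ?thesis by (simp add: power2_diff sq)
  qed
  finally show ?thesis unfolding flux_def by simp
qed

lemma two_flux: "2 * flux t = exp (U R t) + exp (V R t)"
  unfolding flux_def by simp

lemma flux_ge_1:
  assumes "0 \<le> t" "t < T"
  shows "1 \<le> flux t"
proof -
  have "1 \<le> exp (U R t)" "1 \<le> exp (V R t)"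
    using U_nonneg[of R t] V_nonneg[of R t] R_pos assms by auto
  then show ?thesis using two_flux[of t] by linarith
qed

section \<open>The difference of the components at a record time\<close>

definition robin_const :: real where
  "robin_const = min (sqrt c * exp (- 1)) (exp (- 2)) * exp (- K / 2)"

lemma robin_const_pos: "0 < robin_const"
  unfolding robin_const_def using c_pos by auto

text \<open>If \<open>w R s\<close> were much smaller than \<open>- ln (t0 - s) / 2\<close>, the slow growth of the solution would not
  leave enough time to reach the record \<open>G\<close> at \<open>t0\<close>. The summand \<open>1 / G\<^sup>2\<close> is the natural time scale of
  the level \<open>G\<close> and keeps the estimate meaningful up to \<open>s = t0\<close>.\<close>

lemma boundary_value_lower_bound:
  assumes rec: "record_flux G t0" and s: "0 \<le> s" "s \<le> t0"
  shows "robin_const \<le> exp (w R s) * sqrt (t0 - s + 1 / G\<^sup>2)"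
proof -
  have t0: "t0 < T" "flux t0 = G" and G: "1 \<le> G"
    using rec flux_ge_1[of t0] T_pos unfolding record_flux_def by auto
  define m where "m = max (U R s) (V R s)"
  define \<rho> where "\<rho> = t0 - s + 1 / G\<^sup>2"
  have sT: "s < T" using s t0 by simp
  have m0: "0 \<le> m" using U_nonneg[of R s] R_pos s sT unfolding m_def by auto
  have "m - K / 2 \<le> w R s"
    using UV_bounded[of R s] R_pos s sT unfolding m_def w_def by (auto simp: max_def abs_le_iff field_simps)
  then have wm: "exp m * exp (- K / 2) \<le> exp (w R s)" by (simp flip: exp_add)
  have "min (sqrt c * exp (- 1)) (exp (- 2)) \<le> exp m * sqrt \<rho>"
  proof (cases "(t0 - s) * exp (2 * (m + 1)) \<le> c")
    case True
    have "U R t0 < m + 1 + 1 \<and> V R t0 < m + 1 + 1"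
      by (rule growth[of "m + 1" s t0]) (use m0 s t0 True m_def in auto)
    then have "exp (U R t0) < exp (m + 2)" "exp (V R t0) < exp (m + 2)" by auto
    then have "G \<le> exp (m + 2)" using t0 two_flux[of t0] by linarith
    then have Gm: "G * exp (- 2) \<le> exp m" by (simp add: exp_add exp_minus field_simps)
    have "sqrt (1 / G\<^sup>2) \<le> sqrt \<rho>" using s unfolding \<rho>_def by simp
    then have "1 / G \<le> sqrt \<rho>" using G by (simp add: real_sqrt_divide)
    then have "G * exp (- 2) * (1 / G) \<le> exp m * sqrt \<rho>"
      using Gm G by (intro mult_mono) auto
    then show ?thesis using G by simp
  next
    case False
    have "sqrt c \<le> sqrt ((t0 - s) * exp (2 * (m + 1)))" using False by simp
    also have "\<dots> = sqrt (t0 - s) * exp (m + 1)"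
      by (simp only: real_sqrt_mult exp_double real_sqrt_abs abs_exp_cancel)
    also have "\<dots> \<le> sqrt \<rho> * exp (m + 1)"
      using s unfolding \<rho>_def by (intro mult_right_mono) auto
    finally have "sqrt c * exp (- 1) \<le> exp m * sqrt \<rho>"
      by (simp add: exp_add exp_minus field_simps)
    then show ?thesis by simp
  qed
  then have "robin_const \<le> exp m * sqrt \<rho> * exp (- K / 2)"
    unfolding robin_const_def by (intro mult_right_mono) auto
  also have "\<dots> = exp m * exp (- K / 2) * sqrt \<rho>" by simp
  also have "\<dots> \<le> exp (w R s) * sqrt \<rho>"
    using wm s unfolding \<rho>_def by (intro mult_right_mono) auto
  finally show ?thesis unfolding \<rho>_def .
qed

definition decay_rate :: real where
  "decay_rate = min (1 / 8) (robin_const / 5)"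

text \<open>The difference \<open>U - V\<close> is damped at the boundary: its outer slope is
  \<open>exp V - exp U \<le> - exp w (U - V)\<close>, a Robin condition whose coefficient is at least a multiple of
  \<open>1 / sqrt \<rho>\<close> with \<open>\<rho> = t0 - s + 1 / G\<^sup>2\<close>. This is the scaling of the heat equation, so the
  difference decays like a power \<open>\<rho> ^ \<gamma>\<close> while \<open>\<rho>\<close> decreases from a multiple \<open>q\<close> of \<open>1 / G\<close> to
  \<open>1 / G\<^sup>2\<close>. The barrier \<open>B\<close> is a multiple of \<open>\<rho> ^ (- \<gamma>) (sqrt \<rho> + y) ^ (4 \<gamma>)\<close>, where
  \<open>y = R - r\<close>: the second factor makes it larger than the trivial bound \<open>K\<close> away from the boundary. The
  layer width \<open>sqrt q\<close> is so small that the reaction, which is at most a multiple of \<open>G\<close>, is absorbed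
  by the strict supersolution property.\<close>

lemma component_gap_at_record:
  "\<forall>\<^sub>F G in at_top. \<forall>t0. record_flux G t0 \<longrightarrow>
     U R t0 - V R t0 \<le> (2 * K + 1) * exp (- decay_rate * (ln G + ln (decay_rate / (8 * (lam1 + lam2)))))"
proof -
  define \<gamma> where "\<gamma> = decay_rate"
  define L where "L = lam1 + lam2"
  have \<gamma>: "0 < \<gamma>" "\<gamma> \<le> 1 / 8" "4 * \<gamma> < robin_const"
    using robin_const_pos unfolding \<gamma>_def decay_rate_def by auto
  have L: "0 < L" "lam1 < L" using lam1_pos lam2_pos unfolding L_def by auto
  have ev: "\<forall>\<^sub>F G in at_top. 1 / G\<^sup>2 \<le> \<gamma> / (8 * L * G) \<and> \<gamma> / (8 * L * G) \<le> T / 2 \<and>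
      sqrt (\<gamma> / (8 * L * G)) < R \<and> 1 \<le> G"
    using \<gamma>(1) L(1) T_pos R_pos
    by (intro eventually_conj) (real_asymp | (rule eventually_ge_at_top))+
  show ?thesis
    using ev
  proof eventually_elim
    case (elim G)
    define q where "q = \<gamma> / (8 * L * G)"
    define l where "l = sqrt q"
    have G: "1 \<le> G" and q: "0 < q" "1 / G\<^sup>2 \<le> q" "q \<le> T / 2" and l: "0 < l" "l < R" "l\<^sup>2 = q"
      using elim \<gamma> L by (auto simp: q_def l_def)
    show ?case
    proof (intro allI impI)
      fix t0 assume rec: "record_flux G t0"
      then have t0: "T / 2 \<le> t0" "t0 < T" "flux t0 = G" and rec_le: "\<And>s. \<lbrakk>0 \<le> s; s \<le> t0\<rbrakk> \<Longrightarrow> flux s \<le> G"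
        unfolding record_flux_def by auto
      define \<rho> where "\<rho> s = t0 - s + 1 / G\<^sup>2" for s
      define B where "B y s = (2 * K + 1) * exp (\<gamma> * (4 * ln (sqrt (\<rho> s) + y) - ln (\<rho> s) - ln q))" for y s
      have \<rho>: "0 < \<rho> s" if "s \<le> t0" for s using that G unfolding \<rho>_def by (simp add: add_nonneg_pos)
      have \<rho>2: "\<rho> s \<le> 2 * q" if "t0 - q \<le> s" for s using that q unfolding \<rho>_def by simp
      have B_pos: "0 < B y s" for y s unfolding B_def using K_nonneg by simp
      have ln_\<rho>: "2 * ln (\<rho> s) \<le> 4 * ln (sqrt (\<rho> s) + y)" if "s \<le> t0" "0 \<le> y" for y s
      proof -
        have "2 * ln (\<rho> s) = 4 * ln (sqrt (\<rho> s))" using \<rho>[OF that(1)] by (simp add: ln_sqrt)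
        also have "ln (sqrt (\<rho> s)) \<le> ln (sqrt (\<rho> s) + y)"
          using \<rho>[OF that(1)] that by (intro ln_mono) auto
        finally show ?thesis by simp
      qed
      have B_large: "K < B y s" if "s \<le> t0" "0 \<le> y" "q \<le> \<rho> s" for y s
      proof -
        have "0 \<le> 4 * ln (sqrt (\<rho> s) + y) - ln (\<rho> s) - ln q"
          using ln_mono[OF that(3) q(1)] ln_\<rho>[OF that(1,2)] by simp
        then have "1 \<le> exp (\<gamma> * (4 * ln (sqrt (\<rho> s) + y) - ln (\<rho> s) - ln q))" using \<gamma> by simp
        then have "(2 * K + 1) * 1 \<le> B y s" unfolding B_def using K_nonneg by (intro mult_left_mono) auto
        then show ?thesis using K_nonneg by simp
      qed
      have B_side: "K < B l s" if s: "t0 - q \<le> s" "s \<le> t0" for s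
      proof -
        have "2 * ln q = 4 * ln l" unfolding l_def using q by (simp add: ln_sqrt)
        also have "ln l \<le> ln (sqrt (\<rho> s) + l)" using \<rho>[OF s(2)] l by (intro ln_mono) auto
        finally have 1: "2 * ln q \<le> 4 * ln (sqrt (\<rho> s) + l)" by simp
        have "ln (\<rho> s) \<le> ln (2 * q)" using \<rho>2[OF s(1)] \<rho>[OF s(2)] by (rule ln_mono)
        then have "- ln 2 \<le> 4 * ln (sqrt (\<rho> s) + l) - ln (\<rho> s) - ln q"
          using 1 q by (simp add: ln_mult)
        then have "\<gamma> * (- ln 2) \<le> \<gamma> * (4 * ln (sqrt (\<rho> s) + l) - ln (\<rho> s) - ln q)"
          using \<gamma> by (intro mult_left_mono) auto
        moreover have "\<gamma> * ln 2 \<le> 1 * ln (2::real)"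
          using \<gamma> by (intro mult_right_mono) auto
        ultimately have "- ln 2 \<le> \<gamma> * (4 * ln (sqrt (\<rho> s) + l) - ln (\<rho> s) - ln q)" by linarith
        then have "exp (- ln 2) \<le> exp (\<gamma> * (4 * ln (sqrt (\<rho> s) + l) - ln (\<rho> s) - ln q))"
          by (rule iffD2[OF exp_le_cancel_iff])
        then have "1 / 2 \<le> exp (\<gamma> * (4 * ln (sqrt (\<rho> s) + l) - ln (\<rho> s) - ln q))"
          by (simp add: exp_minus)
        then have "(2 * K + 1) * (1 / 2) \<le> B l s" unfolding B_def using K_nonneg by (intro mult_left_mono) auto
        then show ?thesis by simp
      qed
      have B_source: "L * G < \<gamma> * B y s / (2 * \<rho> s)" if s: "t0 - q \<le> s" "s \<le> t0" and y: "0 \<le> y" for y s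
      proof -
        define x where "x = \<rho> s / q"
        have x: "0 < x" "x \<le> 2" using \<rho>[OF s(2)] \<rho>2[OF s(1)] q unfolding x_def by (auto simp: field_simps)
        have "ln x \<le> 4 * ln (sqrt (\<rho> s) + y) - ln (\<rho> s) - ln q"
          unfolding x_def using \<rho>[OF s(2)] q ln_\<rho>[OF s(2) y] by (simp add: ln_div)
        then have "\<gamma> * ln x \<le> \<gamma> * (4 * ln (sqrt (\<rho> s) + y) - ln (\<rho> s) - ln q)"
          using \<gamma> by (intro mult_left_mono) auto
        moreover have "min 0 (ln x) \<le> \<gamma> * ln x"
        proof (cases "0 \<le> ln x")
          case True then show ?thesis using \<gamma> by simp
        next
          case False then show ?thesis using \<gamma> mult_right_mono_neg[of \<gamma> 1 "ln x"] by simp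
        qed
        ultimately have "min 0 (ln x) \<le> \<gamma> * (4 * ln (sqrt (\<rho> s) + y) - ln (\<rho> s) - ln q)"
          by linarith
        then have "exp (min 0 (ln x)) \<le> exp (\<gamma> * (4 * ln (sqrt (\<rho> s) + y) - ln (\<rho> s) - ln q))"
          by (rule iffD2[OF exp_le_cancel_iff])
        moreover have "x / 2 \<le> exp (min 0 (ln x))"
          using x by (cases "0 \<le> ln x") (auto simp: min_def)
        ultimately have "x / 2 \<le> exp (\<gamma> * (4 * ln (sqrt (\<rho> s) + y) - ln (\<rho> s) - ln q))"
          by linarith
        then have "1 * (x / 2) \<le> B y s"
          unfolding B_def using K_nonneg x by (intro mult_mono) auto
        then have "\<gamma> * (x / 2) / (2 * \<rho> s) \<le> \<gamma> * B y s / (2 * \<rho> s)"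
          using \<gamma> \<rho>[OF s(2)] by (intro divide_right_mono mult_left_mono) auto
        moreover have "\<gamma> * (x / 2) / (2 * \<rho> s) = 2 * (L * G)"
          unfolding x_def q_def using \<rho>[OF s(2)] \<gamma> L G by (simp add: field_simps)
        moreover have "0 < L * G" using L G by simp
        ultimately show ?thesis by linarith
      qed
      have B_y: "((\<lambda>r. B (R - r) s) has_real_derivative - (B (R - r) s * (4 * \<gamma> / (sqrt (\<rho> s) + (R - r))))) (at r within S)"
        if "s \<le> t0" "r \<le> R" for r s S
      proof -
        define z where "z = sqrt (\<rho> s) + (R - r)"
        have z: "0 < z" using \<rho>[OF that(1)] that unfolding z_def by (simp add: add_pos_nonneg)
        have "((\<lambda>r. \<gamma> * (4 * ln (sqrt (\<rho> s) + (R - r)) - ln (\<rho> s) - ln q)) has_real_derivative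
            - (4 * \<gamma> / z)) (at r within S)"
          using z unfolding z_def by (auto intro!: derivative_eq_intros)
        from DERIV_cmult[OF DERIV_chain2[OF DERIV_exp this], of "2 * K + 1"] show ?thesis
          unfolding B_def z_def by (simp add: mult.assoc)
      qed
      have B_yy: "has_second_derivative (\<lambda>r. B (R - r) s)
          (B (R - r) s * (4 * \<gamma> * (4 * \<gamma> - 1) / (sqrt (\<rho> s) + (R - r))\<^sup>2)) r"
        if "s \<le> t0" "r < R" for r s
      proof (rule has_second_derivativeI[where S = "{..<R}"])
        show "((\<lambda>r. B (R - r) s) has_real_derivative - (B (R - x) s * (4 * \<gamma> / (sqrt (\<rho> s) + (R - x))))) (at x)"
          if "x \<in> {..<R}" for x using B_y[of s x UNIV] that \<open>s \<le> t0\<close> by simp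
        define z where "z = sqrt (\<rho> s) + (R - r)"
        have z: "z > 0" using \<rho>[OF that(1)] that unfolding z_def by (simp add: add_pos_pos)
        have 1: "((\<lambda>r. 4 * \<gamma> / (sqrt (\<rho> s) + (R - r))) has_real_derivative 4 * \<gamma> / z\<^sup>2) (at r)"
          using z unfolding z_def by (auto intro!: derivative_eq_intros simp: field_simps power2_eq_square)
        have "((\<lambda>x. - (B (R - x) s * (4 * \<gamma> / (sqrt (\<rho> s) + (R - x))))) has_real_derivative
            - (- (B (R - r) s * (4 * \<gamma> / z)) * (4 * \<gamma> / z) + 4 * \<gamma> / z\<^sup>2 * B (R - r) s)) (at r)"
          using B_y[of s r UNIV] that unfolding z_def
          by (intro DERIV_minus DERIV_mult 1[unfolded z_def]) auto
        moreover have "- (- (B (R - r) s * (4 * \<gamma> / z)) * (4 * \<gamma> / z) + 4 * \<gamma> / z\<^sup>2 * B (R - r) s) =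
            B (R - r) s * (4 * \<gamma> * (4 * \<gamma> - 1) / z\<^sup>2)"
          using z by (simp add: field_simps power2_eq_square)
        ultimately show "((\<lambda>x. - (B (R - x) s * (4 * \<gamma> / (sqrt (\<rho> s) + (R - x))))) has_real_derivative
            B (R - r) s * (4 * \<gamma> * (4 * \<gamma> - 1) / (sqrt (\<rho> s) + (R - r))\<^sup>2)) (at r)"
          unfolding z_def by simp
      qed (use that in auto)
      have B_t: "(B y has_real_derivative B y s * (\<gamma> * (1 / \<rho> s - 2 / (sqrt (\<rho> s) * (sqrt (\<rho> s) + y))))) (at s)"
        if "s \<le> t0" "0 \<le> y" for y s
      proof -
        have \<rho>': "(\<rho> has_real_derivative - 1) (at s)"
          unfolding \<rho>_def by (auto intro!: derivative_eq_intros)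
        have sq: "((\<lambda>s. sqrt (\<rho> s)) has_real_derivative inverse (sqrt (\<rho> s)) / 2 * - 1) (at s)"
          by (rule DERIV_chain2[OF DERIV_real_sqrt \<rho>']) (use \<rho>[OF that(1)] in auto)
        have pos: "0 < sqrt (\<rho> s) + y" using \<rho>[OF that(1)] that by (simp add: add_pos_nonneg)
        have "((\<lambda>s. \<gamma> * (4 * ln (sqrt (\<rho> s) + y) - ln (\<rho> s) - ln q)) has_real_derivative
            \<gamma> * (1 / \<rho> s - 2 / (sqrt (\<rho> s) * (sqrt (\<rho> s) + y)))) (at s)"
        proof -
          define d where "d = sqrt (\<rho> s)"
          have d: "0 < d" "\<rho> s = d * d" using \<rho>[OF that(1)] unfolding d_def by auto
          have alg: "\<gamma> * (4 * (inverse z * (inverse d / 2 * - 1 + 0)) - inverse (d * d) * - 1 - 0) =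
              \<gamma> * (1 / (d * d) - 2 / (d * z))" if "0 < z" "0 < d" for z d :: real
            using that by (simp add: field_simps)
          have "((\<lambda>s. ln (sqrt (\<rho> s) + y)) has_real_derivative inverse (sqrt (\<rho> s) + y) * (inverse d / 2 * - 1 + 0)) (at s)"
            unfolding d_def by (rule DERIV_chain2[OF DERIV_ln[OF pos] DERIV_add[OF sq DERIV_const]])
          moreover have "((\<lambda>s. ln (\<rho> s)) has_real_derivative inverse (\<rho> s) * - 1) (at s)"
            by (rule DERIV_chain2[OF DERIV_ln[OF \<rho>[OF that(1)]] \<rho>'])
          ultimately have "((\<lambda>s. \<gamma> * (4 * ln (sqrt (\<rho> s) + y) - ln (\<rho> s) - ln q)) has_real_derivative
            \<gamma> * (4 * (inverse (sqrt (\<rho> s) + y) * (inverse d / 2 * - 1 + 0)) - inverse (\<rho> s) * - 1 - 0)) (at s)"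
            by (intro DERIV_cmult DERIV_diff DERIV_const)
          moreover have "\<gamma> * (4 * (inverse (sqrt (\<rho> s) + y) * (inverse d / 2 * - 1 + 0)) - inverse (\<rho> s) * - 1 - 0) =
            \<gamma> * (1 / \<rho> s - 2 / (sqrt (\<rho> s) * (sqrt (\<rho> s) + y)))"
            using alg[OF pos d(1)] unfolding d(2)[symmetric] d_def[symmetric] .
          ultimately show ?thesis by (rule DERIV_cong)
        qed
        from DERIV_cmult[OF DERIV_chain2[OF DERIV_exp this], of "2 * K + 1"] show ?thesis
          unfolding B_def[abs_def] by (simp only: mult.assoc)
      qed
      have B_super: "L * G < B y s * (\<gamma> * (1 / \<rho> s - 2 / (sqrt (\<rho> s) * (sqrt (\<rho> s) + y)))) -
          B y s * (4 * \<gamma> * (4 * \<gamma> - 1) / (sqrt (\<rho> s) + y)\<^sup>2)"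
        if s: "t0 - q \<le> s" "s \<le> t0" and y: "0 \<le> y" for y s
      proof -
        define d where "d = sqrt (\<rho> s)"
        define x where "x = d / (d + y)"
        have d: "0 < d" "d\<^sup>2 = \<rho> s" using \<rho>[OF s(2)] unfolding d_def by auto
        have dy: "0 < d + y" using d y by simp
        have alg: "b * (\<gamma> * (1 / d\<^sup>2 - 2 / (d * z))) - b * (4 * \<gamma> * (4 * \<gamma> - 1) / z\<^sup>2)
            = \<gamma> * b / d\<^sup>2 * (1 - 2 * (d / z) + 4 * (1 - 4 * \<gamma>) * (d / z)\<^sup>2)"
          if "0 < d" "0 < z" for b d z :: real
          using that by (simp add: field_simps power2_eq_square)
        have "B y s * (\<gamma> * (1 / \<rho> s - 2 / (d * (d + y)))) - B y s * (4 * \<gamma> * (4 * \<gamma> - 1) / (d + y)\<^sup>2)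
            = \<gamma> * B y s / \<rho> s * (1 - 2 * x + 4 * (1 - 4 * \<gamma>) * x\<^sup>2)"
          unfolding x_def d(2)[symmetric] by (rule alg[OF d(1) dy])
        also have "\<dots> \<ge> \<gamma> * B y s / \<rho> s * (1 / 2)"
        proof (rule mult_left_mono)
          have "2 * x\<^sup>2 \<le> 4 * (1 - 4 * \<gamma>) * x\<^sup>2" using \<gamma> by (intro mult_right_mono) auto
          moreover have "0 \<le> (1 - 2 * x)\<^sup>2" by simp
          ultimately show "1 / 2 \<le> 1 - 2 * x + 4 * (1 - 4 * \<gamma>) * x\<^sup>2"
            by (simp add: power2_eq_square algebra_simps)
          show "0 \<le> \<gamma> * B y s / \<rho> s" using \<gamma> B_pos[of y s] \<rho>[OF s(2)] by simp
        qed
        finally show ?thesis using B_source[OF s y] unfolding d_def by simp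
      qed
      have "U R t0 - V R t0 - B (R - R) t0 < 0"
      proof (rule first_touch[where g = "\<lambda>r s. U r s - V r s - B (R - r) s" and X = "{R - l..R}"
            and a = "t0 - q" and b = t0])
        show "continuous_on ({R - l..R} \<times> {t0 - q..t0}) (\<lambda>(r, s). U r s - V r s - B (R - r) s)"
        proof -
          have "\<rho> (snd p) \<noteq> 0" "sqrt (\<rho> (snd p)) + (R - fst p) \<noteq> 0"
            if "p \<in> {R - l..R} \<times> {t0 - q..t0}" for p
          proof -
            have "0 < \<rho> (snd p)" using that by (intro \<rho>) auto
            moreover have "0 \<le> R - fst p" using that by auto
            ultimately show "\<rho> (snd p) \<noteq> 0" "sqrt (\<rho> (snd p)) + (R - fst p) \<noteq> 0"
              using real_sqrt_gt_zero[of "\<rho> (snd p)"] by linarith+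
          qed
          then have "continuous_on ({R - l..R} \<times> {t0 - q..t0}) (\<lambda>p. B (R - fst p) (snd p))"
            unfolding B_def \<rho>_def by (intro continuous_intros) auto
          then show ?thesis
            unfolding case_prod_beta
            by (intro continuous_intros continuous_U_compose continuous_V_compose)
              (use l q t0 in auto)
        qed
      next
        fix r assume r: "r \<in> {R - l..R}"
        have "K < B (R - r) (t0 - q)"
          by (rule B_large) (use q r in \<open>auto simp: \<rho>_def\<close>)
        with UV_bounded[of r "t0 - q"] r l q t0 show "U r (t0 - q) - V r (t0 - q) - B (R - r) (t0 - q) < 0"
          by auto
      next
        fix r s
        assume r: "r \<in> {R - l..R}" and s: "t0 - q < s" "s \<le> t0"
          and g0: "U r s - V r s - B (R - r) s = 0"
          and le: "\<And>z. z \<in> {R - l..R} \<Longrightarrow> U z s - V z s - B (R - z) s \<le> 0"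
          and before: "\<And>\<tau>. \<lbrakk>t0 - q \<le> \<tau>; \<tau> < s\<rbrakk> \<Longrightarrow> U r \<tau> - V r \<tau> - B (R - r) \<tau> < 0"
        have sT: "0 < s" "s < T" using s q t0 by auto
        have max: "(U z s - V z s) - B (R - z) s \<le> (U r s - V r s) - B (R - r) s"
          if "R - l \<le> z" "z \<le> R" for z using le[of z] that g0 by simp
        have pos: "0 < U r s - V r s" using g0 B_pos[of "R - r" s] by simp
        consider "r = R - l" | "r = R" | "R - l < r" "r < R" using r by fastforce
        then show False
        proof cases
          case 1
          then show False
            using B_side[of s] s UV_bounded[of r s] g0 r l sT by auto
        next
          case 2
          have "((\<lambda>r. (U r s - V r s) - B (R - r) s) has_real_derivative
              exp (V R s) - exp (U R s) - - (B (R - R) s * (4 * \<gamma> / (sqrt (\<rho> s) + (R - R))))) (at R within {..R})"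
            using s by (intro DERIV_diff U_R V_R sT B_y) auto
          then have "0 \<le> exp (V R s) - exp (U R s) - - (B (R - R) s * (4 * \<gamma> / (sqrt (\<rho> s) + (R - R))))"
            by (rule left_derivative_at_max[where a = "R - l"]) (use max 2 l in auto)
          then have 1: "exp (U R s) - exp (V R s) \<le> (U R s - V R s) * (4 * \<gamma> / sqrt (\<rho> s))"
            using g0 2 by simp
          have "exp (w R s) * (U R s - V R s) \<le> exp (U R s) - exp (V R s)"
          proof -
            define x where "x = (U R s - V R s) / 2"
            have x2: "2 * x = U R s - V R s" unfolding x_def by simp
            have "2 * x \<le> exp x - exp (- x)"
              using real_le_x_sinh[of x] pos 2 unfolding x_def by (simp add: exp_minus)
            then have "exp (w R s) * (2 * x) \<le> exp (w R s) * (exp x - exp (- x))" by simp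
            also have "\<dots> = exp (U R s) - exp (V R s)"
              unfolding w_def x_def by (simp add: algebra_simps field_simps flip: exp_add)
            finally show ?thesis unfolding x2 .
          qed
          with 1 have "(U R s - V R s) * exp (w R s) \<le> (U R s - V R s) * (4 * \<gamma> / sqrt (\<rho> s))"
            by (simp add: mult.commute)
          then have "exp (w R s) \<le> 4 * \<gamma> / sqrt (\<rho> s)"
            by (rule mult_left_le_imp_le) (use pos 2 in simp)
          then have "exp (w R s) * sqrt (\<rho> s) \<le> 4 * \<gamma>" using \<rho>[OF s(2)] by (simp add: field_simps)
          moreover have "robin_const \<le> exp (w R s) * sqrt (\<rho> s)"
            using boundary_value_lower_bound[OF rec, of s] s sT unfolding \<rho>_def by simp
          ultimately show False using \<gamma> by simp
        next
          case 3
          have r0: "0 < r" using 3 l by simp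
          let ?z = "sqrt (\<rho> s) + (R - r)"
          have D1: "((\<lambda>r. U r s - V r s) has_real_derivative Ur r s - Vr r s) (at r)"
            by (intro DERIV_diff U_r V_r r0 3 sT)
          have D2: "has_second_derivative (\<lambda>r. U r s - V r s) (Urr r s - Vrr r s) r"
            by (intro has_second_derivative_diff U_second V_second r0 3 sT)
          have B1: "((\<lambda>r. B (R - r) s) has_real_derivative - (B (R - r) s * (4 * \<gamma> / ?z))) (at r)"
            using B_y[of s r UNIV] s 3 by simp
          note m = interior_max_derivatives[OF 3 D1 D2 B1 B_yy[OF s(2) 3(2)] max]
          have slope: "Ur r s - Vr r s = - (B (R - r) s * (4 * \<gamma> / ?z))"
            by (rule m(1)) auto
          have curv: "Urr r s - Vrr r s \<le> B (R - r) s * (4 * \<gamma> * (4 * \<gamma> - 1) / ?z\<^sup>2)"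
            by (rule m(2)) auto
          have "0 < ?z" using \<rho>[OF s(2)] 3 by (simp add: add_pos_pos)
          then have "Ur r s - Vr r s \<le> 0" unfolding slope using B_pos[of "R - r" s] \<gamma> by simp
          then have drift: "k / r * (Ur r s - Vr r s) \<le> 0"
            using k_nonneg r0 by (intro mult_nonneg_nonpos) auto
          have "((\<lambda>s. U r s - V r s - B (R - r) s) has_real_derivative
              (Urr r s + k / r * Ur r s + lam1 * exp (V r s)) - (Vrr r s + k / r * Vr r s + lam2 * exp (U r s)) -
              B (R - r) s * (\<gamma> * (1 / \<rho> s - 2 / (sqrt (\<rho> s) * ?z)))) (at s)"
            using 3 s by (intro DERIV_diff U_t V_t r0 sT B_t) auto
          then have "0 \<le> (Urr r s + k / r * Ur r s + lam1 * exp (V r s)) - (Vrr r s + k / r * Vr r s + lam2 * exp (U r s)) -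
              B (R - r) s * (\<gamma> * (1 / \<rho> s - 2 / (sqrt (\<rho> s) * ?z)))"
            by (rule time_derivative_at_touch[where a = "t0 - q"]) (use s g0 before in auto)
          moreover have "lam1 * exp (V r s) \<le> L * G"
          proof (rule mult_mono)
            have "exp (V r s) \<le> exp (V R s)" "exp (V r s) \<le> exp (U r s)" "exp (U r s) \<le> exp (U R s)"
              using V_mono[of r R s] U_mono[of r R s] r0 3 sT pos by auto
            then have "exp (V r s) \<le> exp (V R s)" "exp (V r s) \<le> exp (U R s)" by linarith+
              then have "exp (V r s) \<le> flux s" using two_flux[of s] by linarith
            also have "\<dots> \<le> G" using rec_le[of s] sT s by simp
            finally show "exp (V r s) \<le> G" .
          qed (use L in auto)
          moreover have "0 \<le> lam2 * exp (U r s)" using lam2_pos by simp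
          moreover have "L * G < B (R - r) s * (\<gamma> * (1 / \<rho> s - 2 / (sqrt (\<rho> s) * ?z))) -
              B (R - r) s * (4 * \<gamma> * (4 * \<gamma> - 1) / ?z\<^sup>2)"
            by (rule B_super) (use s 3 in auto)
          ultimately show False using curv drift by (simp add: algebra_simps)
        qed
      qed (use l q in auto)
      then have "U R t0 - V R t0 \<le> B 0 t0" by simp
      also have "B 0 t0 = (2 * K + 1) * exp (- \<gamma> * (ln G + ln (\<gamma> / (8 * L))))"
      proof -
        have \<rho>0: "\<rho> t0 = 1 / G\<^sup>2" unfolding \<rho>_def by simp
        have "ln (\<rho> t0) = - 2 * ln G" unfolding \<rho>0 using G by (simp add: ln_div ln_realpow)
        moreover have "ln (sqrt (\<rho> t0)) = - ln G" unfolding \<rho>0 using G by (simp add: real_sqrt_divide ln_div)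
        moreover have "ln q = ln (\<gamma> / (8 * L)) - ln G" unfolding q_def using \<gamma> L G by (simp add: ln_div ln_mult)
        ultimately have "4 * ln (sqrt (\<rho> t0) + 0) - ln (\<rho> t0) - ln q = - (ln G + ln (\<gamma> / (8 * L)))" by simp
        then show ?thesis unfolding B_def by (simp only: mult_minus_left mult_minus_right)
      qed
      finally show "U R t0 - V R t0 \<le> (2 * K + 1) *
          exp (- decay_rate * (ln G + ln (decay_rate / (8 * (lam1 + lam2)))))"
        unfolding \<gamma>_def L_def .
    qed
  qed
qed

end

section \<open>A superharmonic function on the wedge\<close>

text \<open>On the wedge of pairs \<open>0 \<le> y \<le> Y \<le> L\<close>, this function vanishes on the diagonal, equals \<open>1\<close> on the
  side \<open>Y = L\<close>, has zero normal derivative on the side \<open>y = 0\<close>, is superharmonic, and is only of size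
  \<open>Y\<^sup>2 / L\<^sup>2\<close> near the origin. Hence it bounds the influence of unknown values on \<open>Y = L\<close> on pairs
  close to the origin. It is discontinuous at the corner \<open>y = Y = L\<close>.\<close>

definition corner :: "real \<Rightarrow> real \<Rightarrow> real \<Rightarrow> real" where
  "corner L y Y = 1 - ((L\<^sup>2 - Y\<^sup>2) / (L\<^sup>2 - y\<^sup>2))\<^sup>2"

lemma corner_derivative_fst:
  assumes "L\<^sup>2 - y\<^sup>2 \<noteq> 0"
  shows "((\<lambda>y. corner L y Y) has_real_derivative - (4 * (L\<^sup>2 - Y\<^sup>2)\<^sup>2 * y / (L\<^sup>2 - y\<^sup>2) ^ 3)) (at y)"
proof -
  have 1: "((\<lambda>y. L\<^sup>2 - y\<^sup>2) has_real_derivative - (2 * y)) (at y)"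
    by (auto intro!: derivative_eq_intros)
  have alg: "0 - of_nat 2 * ((0 * b - a * - (2 * y)) / (b * b) * (a / b) ^ (2 - Suc 0)) =
      - (4 * a\<^sup>2 * y / b ^ 3)"
    if "b \<noteq> 0" for a b :: real
    using that by (simp add: field_simps power2_eq_square power3_eq_cube)
  have "((\<lambda>y. (L\<^sup>2 - Y\<^sup>2) / (L\<^sup>2 - y\<^sup>2)) has_real_derivative
      (0 * (L\<^sup>2 - y\<^sup>2) - (L\<^sup>2 - Y\<^sup>2) * - (2 * y)) / ((L\<^sup>2 - y\<^sup>2) * (L\<^sup>2 - y\<^sup>2))) (at y)"
    by (rule DERIV_divide[OF DERIV_const 1 assms])
  from DERIV_diff[OF DERIV_const[of 1] DERIV_power[OF this, of 2]]
  show ?thesis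
    unfolding corner_def by (rule DERIV_cong) (rule alg[OF assms])
qed

lemma corner_second_derivative_fst:
  assumes "\<bar>y\<bar> < L"
  shows "has_second_derivative (\<lambda>y. corner L y Y)
    (- (4 * (L\<^sup>2 - Y\<^sup>2)\<^sup>2 / (L\<^sup>2 - y\<^sup>2) ^ 3) - 24 * (L\<^sup>2 - Y\<^sup>2)\<^sup>2 * y\<^sup>2 / (L\<^sup>2 - y\<^sup>2) ^ 4) y"
proof (rule has_second_derivativeI[where S = "{- L<..<L}"])
  have ne: "L\<^sup>2 - x\<^sup>2 \<noteq> 0" if "x \<in> {- L<..<L}" for x
    using that abs_square_less_1 power2_strict_mono[of x L] by (auto simp: abs_less_iff)
  show "((\<lambda>y. corner L y Y) has_real_derivative - (4 * (L\<^sup>2 - Y\<^sup>2)\<^sup>2 * x / (L\<^sup>2 - x\<^sup>2) ^ 3)) (at x)"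
    if "x \<in> {- L<..<L}" for x
    by (rule corner_derivative_fst[OF ne[OF that]])
  have y: "y \<in> {- L<..<L}" using assms by auto
  have 1: "((\<lambda>y. L\<^sup>2 - y\<^sup>2) has_real_derivative - (2 * y)) (at y)"
    by (auto intro!: derivative_eq_intros)
  have 2: "((\<lambda>y. 4 * (L\<^sup>2 - Y\<^sup>2)\<^sup>2 * y) has_real_derivative 4 * (L\<^sup>2 - Y\<^sup>2)\<^sup>2 * 1) (at y)"
    by (intro DERIV_cmult DERIV_ident)
  have 3: "((\<lambda>y. (L\<^sup>2 - y\<^sup>2) ^ 3) has_real_derivative 3 * ((L\<^sup>2 - y\<^sup>2)\<^sup>2 * - (2 * y))) (at y)"
    by (rule DERIV_cong[OF DERIV_power[OF 1, of 3]]) simp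
  have alg: "- ((4 * a * 1 * b ^ 3 - 3 * (b\<^sup>2 * - (2 * y)) * (4 * a * y)) / (b ^ 3 * b ^ 3)) =
      - (4 * a / b ^ 3) - 24 * a * y\<^sup>2 / b ^ 4" if "b \<noteq> 0" for a b :: real
    using that by (simp add: field_simps power2_eq_square power3_eq_cube power4_eq_xxxx)
  have b3: "(L\<^sup>2 - y\<^sup>2) ^ 3 \<noteq> 0" using ne[OF y] by simp
  from DERIV_minus[OF DERIV_divide[OF 2 3 b3]]
  show "((\<lambda>y. - (4 * (L\<^sup>2 - Y\<^sup>2)\<^sup>2 * y / (L\<^sup>2 - y\<^sup>2) ^ 3)) has_real_derivative
    - (4 * (L\<^sup>2 - Y\<^sup>2)\<^sup>2 / (L\<^sup>2 - y\<^sup>2) ^ 3) - 24 * (L\<^sup>2 - Y\<^sup>2)\<^sup>2 * y\<^sup>2 / (L\<^sup>2 - y\<^sup>2) ^ 4) (at y)"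
    by (rule DERIV_cong) (use alg[OF ne[OF y], of "(L\<^sup>2 - Y\<^sup>2)\<^sup>2"] in \<open>simp only: mult.commute mult.left_commute mult.assoc\<close>)
qed (use assms in auto)

lemma corner_derivative_snd:
  "((\<lambda>Y. corner L y Y) has_real_derivative 4 * (L\<^sup>2 - Y\<^sup>2) * Y / (L\<^sup>2 - y\<^sup>2)\<^sup>2) (at Y)"
proof -
  have eq: "corner L y = (\<lambda>Y. 1 - (L\<^sup>2 - Y\<^sup>2)\<^sup>2 / (L\<^sup>2 - y\<^sup>2)\<^sup>2)"
    unfolding corner_def by (simp add: power_divide fun_eq_iff)
  have "((\<lambda>Y. (L\<^sup>2 - Y\<^sup>2)\<^sup>2) has_real_derivative - (4 * (L\<^sup>2 - Y\<^sup>2) * Y)) (at Y)"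
    by (auto intro!: derivative_eq_intros simp: algebra_simps)
  from DERIV_diff[OF DERIV_const[of 1] DERIV_cdivide[OF this, of "(L\<^sup>2 - y\<^sup>2)\<^sup>2"]]
  show ?thesis unfolding eq by simp
qed

lemma corner_second_derivative_snd:
  "has_second_derivative (\<lambda>Y. corner L y Y)
    (4 * (L\<^sup>2 - Y\<^sup>2) / (L\<^sup>2 - y\<^sup>2)\<^sup>2 - 8 * Y\<^sup>2 / (L\<^sup>2 - y\<^sup>2)\<^sup>2) Y"
proof (rule has_second_derivativeI[where S = UNIV, OF _ _ corner_derivative_snd])
  have "((\<lambda>Y. 4 * (L\<^sup>2 - Y\<^sup>2) * Y) has_real_derivative 4 * (L\<^sup>2 - Y\<^sup>2) - 8 * Y\<^sup>2) (at Y)"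
    by (auto intro!: derivative_eq_intros simp: power2_eq_square algebra_simps)
  then have "((\<lambda>Y. 4 * (L\<^sup>2 - Y\<^sup>2) * Y / (L\<^sup>2 - y\<^sup>2)\<^sup>2) has_real_derivative
      (4 * (L\<^sup>2 - Y\<^sup>2) - 8 * Y\<^sup>2) / (L\<^sup>2 - y\<^sup>2)\<^sup>2) (at Y)"
    by (rule DERIV_cdivide)
  then show "((\<lambda>Y. 4 * (L\<^sup>2 - Y\<^sup>2) * Y / (L\<^sup>2 - y\<^sup>2)\<^sup>2) has_real_derivative
      4 * (L\<^sup>2 - Y\<^sup>2) / (L\<^sup>2 - y\<^sup>2)\<^sup>2 - 8 * Y\<^sup>2 / (L\<^sup>2 - y\<^sup>2)\<^sup>2) (at Y)"
    by (simp only: diff_divide_distrib)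
qed auto

lemma corner_bounds:
  assumes "0 \<le> y" "y \<le> Y" "Y \<le> L" "y < L"
  shows "0 \<le> corner L y Y" "corner L y Y \<le> 2 * Y\<^sup>2 / (L\<^sup>2 - y\<^sup>2)"
proof -
  define a b where "a = L\<^sup>2 - Y\<^sup>2" and "b = L\<^sup>2 - y\<^sup>2"
  have b: "0 < b" using assms power_strict_mono[of y L 2] unfolding b_def by simp
  have a: "0 \<le> a" using assms power_mono[of Y L 2] unfolding a_def by simp
  have ab: "a \<le> b" using assms power_mono[of y Y 2] unfolding a_def b_def by simp
  define t where "t = a / b"
  have t: "0 \<le> t" "t \<le> 1" using a ab b unfolding t_def by auto
  have c: "corner L y Y = (1 - t) * (1 + t)"
    unfolding corner_def t_def a_def b_def by (simp add: power2_eq_square algebra_simps)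
  show "0 \<le> corner L y Y" unfolding c using t by simp
  have "(1 - t) * (1 + t) \<le> (1 - t) * 2" using t by (intro mult_left_mono) auto
  also have "\<dots> = 2 * (b - a) / b" unfolding t_def using b by (simp add: field_simps)
  also have "\<dots> \<le> 2 * Y\<^sup>2 / b" using b by (intro divide_right_mono) (auto simp: a_def b_def)
  finally show "corner L y Y \<le> 2 * Y\<^sup>2 / (L\<^sup>2 - y\<^sup>2)" unfolding c b_def .
qed

text \<open>The Laplacian of \<open>corner\<close> is at most \<open>- 4 Y\<^sup>2 / (L\<^sup>2 - y\<^sup>2)\<^sup>2\<close>, which also absorbs a zero-order
  term whose coefficient is small compared to \<open>1 / L\<^sup>2\<close>.\<close>

lemma corner_superharmonic:
  assumes y: "0 \<le> y" "y \<le> Y" "Y \<le> L" "y < L" and \<mu>: "0 \<le> \<mu>" "\<mu> * L\<^sup>2 \<le> 2"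
  shows "(- (4 * (L\<^sup>2 - Y\<^sup>2)\<^sup>2 / (L\<^sup>2 - y\<^sup>2) ^ 3) - 24 * (L\<^sup>2 - Y\<^sup>2)\<^sup>2 * y\<^sup>2 / (L\<^sup>2 - y\<^sup>2) ^ 4) +
    (4 * (L\<^sup>2 - Y\<^sup>2) / (L\<^sup>2 - y\<^sup>2)\<^sup>2 - 8 * Y\<^sup>2 / (L\<^sup>2 - y\<^sup>2)\<^sup>2) + \<mu> * corner L y Y \<le> 0"
proof -
  define a b where "a = L\<^sup>2 - Y\<^sup>2" and "b = L\<^sup>2 - y\<^sup>2"
  have b: "0 < b" using y power_strict_mono[of y L 2] unfolding b_def by simp
  have a: "0 \<le> a" using y power_mono[of Y L 2] unfolding a_def by simp
  have ab: "a \<le> b" using y power_mono[of y Y 2] unfolding a_def b_def by simp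
  have "\<mu> * corner L y Y \<le> \<mu> * (2 * Y\<^sup>2 / b)"
    using corner_bounds(2)[OF y] \<mu> unfolding b_def by (intro mult_left_mono) auto
  also have "\<dots> = (\<mu> * b) * (2 * Y\<^sup>2 / b\<^sup>2)" using b by (simp add: power2_eq_square)
  also have "\<dots> \<le> 2 * (2 * Y\<^sup>2 / b\<^sup>2)"
  proof (rule mult_right_mono)
    have "\<mu> * b \<le> \<mu> * L\<^sup>2" using \<mu> unfolding b_def by (intro mult_left_mono) auto
    then show "\<mu> * b \<le> 2" using \<mu> by simp
  qed simp
  finally have 1: "\<mu> * corner L y Y \<le> 4 * Y\<^sup>2 / b\<^sup>2" by simp
  have "4 * a / b\<^sup>2 - 4 * a\<^sup>2 / b ^ 3 = 4 * (a / b) * (b - a) / b\<^sup>2"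
    using b by (simp add: field_simps power2_eq_square power3_eq_cube)
  also have "\<dots> \<le> 4 * 1 * (b - a) / b\<^sup>2"
    using a ab b by (intro divide_right_mono mult_right_mono mult_left_mono) auto
  also have "\<dots> \<le> 4 * Y\<^sup>2 / b\<^sup>2" by (intro divide_right_mono) (auto simp: a_def b_def)
  finally have 2: "4 * a / b\<^sup>2 - 4 * a\<^sup>2 / b ^ 3 \<le> 4 * Y\<^sup>2 / b\<^sup>2" .
  have 3: "0 \<le> 24 * a\<^sup>2 * y\<^sup>2 / b ^ 4" using b by simp
  have 4: "8 * Y\<^sup>2 / b\<^sup>2 = 4 * Y\<^sup>2 / b\<^sup>2 + 4 * Y\<^sup>2 / b\<^sup>2" by simp
  show ?thesis using 1 2 3 4 unfolding a_def[symmetric] b_def[symmetric] by linarith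
qed

text \<open>The sum of the two partial derivatives of \<open>corner\<close> is nonnegative. The first-order terms
  \<open>k / r\<close> of the radial Laplacian, which differ at the two points of a pair, therefore have the
  favourable sign.\<close>

lemma corner_slope_sum:
  fixes y Y L :: real
  assumes "0 \<le> y" "y \<le> Y" "Y \<le> L" "y < L"
  shows "4 * (L\<^sup>2 - Y\<^sup>2)\<^sup>2 * y / (L\<^sup>2 - y\<^sup>2) ^ 3 \<le> 4 * (L\<^sup>2 - Y\<^sup>2) * Y / (L\<^sup>2 - y\<^sup>2)\<^sup>2"
    and "0 \<le> 4 * (L\<^sup>2 - Y\<^sup>2) * Y / (L\<^sup>2 - y\<^sup>2)\<^sup>2"
proof -
  define a b where "a = L\<^sup>2 - Y\<^sup>2" and "b = L\<^sup>2 - y\<^sup>2"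
  have b: "0 < b" using assms power_strict_mono[of y L 2] unfolding b_def by simp
  have a: "0 \<le> a" using assms power_mono[of Y L 2] unfolding a_def by simp
  have ab: "a \<le> b" using assms power_mono[of y Y 2] unfolding a_def b_def by simp
  have "4 * a\<^sup>2 * y / b ^ 3 = 4 * a * (a / b * y) / b\<^sup>2"
    using b by (simp add: field_simps power2_eq_square power3_eq_cube)
  also have "a / b * y \<le> 1 * Y" using a ab b assms by (intro mult_mono) auto
  finally show "4 * (L\<^sup>2 - Y\<^sup>2)\<^sup>2 * y / (L\<^sup>2 - y\<^sup>2) ^ 3 \<le> 4 * (L\<^sup>2 - Y\<^sup>2) * Y / (L\<^sup>2 - y\<^sup>2)\<^sup>2"
    unfolding a_def[symmetric] b_def[symmetric] using a
    by (simp add: divide_right_mono mult_left_mono)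
  show "0 \<le> 4 * (L\<^sup>2 - Y\<^sup>2) * Y / (L\<^sup>2 - y\<^sup>2)\<^sup>2"
    unfolding a_def[symmetric] using a assms by simp
qed

section \<open>The slope of the mean profile at a record time\<close>

context radial_system
begin

definition reaction_const :: real where
  "reaction_const = 4 * k / R + 6 * (lam1 + lam2)"

lemma reaction_const_pos: "0 < reaction_const"
  unfolding reaction_const_def using k_nonneg R_pos lam1_pos lam2_pos by (intro add_nonneg_pos) auto

lemma reaction_difference:
  assumes r: "0 \<le> r'" "r' \<le> r" "r \<le> R" and t: "0 \<le> t" "t < T"
  shows "(lam1 * exp (V r t) + lam2 * exp (U r t)) / 2 - (lam1 * exp (V r' t) + lam2 * exp (U r' t)) / 2
    \<le> 2 * (lam1 + lam2) * flux t * (w r t - w r' t)"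
proof -
  have *: "lam * exp b - lam * exp a \<le> (lam1 + lam2) * (2 * flux t) * (b - a)"
    if "0 < lam" "lam \<le> lam1 + lam2" "a \<le> b" "exp b \<le> 2 * flux t" for lam a b
  proof -
    have "exp b * (1 + (a - b)) \<le> exp b * exp (a - b)"
      by (intro mult_left_mono) auto
    then have "exp b - exp a \<le> exp b * (b - a)"
      by (simp add: algebra_simps flip: exp_add)
    also have "\<dots> \<le> 2 * flux t * (b - a)" using that by (intro mult_right_mono) auto
    finally have "lam * (exp b - exp a) \<le> lam * (2 * flux t * (b - a))"
      using that by (intro mult_left_mono) auto
    also have "\<dots> \<le> (lam1 + lam2) * (2 * flux t * (b - a))"
      using that flux_ge_1[OF t] by (intro mult_right_mono) auto
    finally show ?thesis by (simp add: algebra_simps)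
  qed
  have "exp (V r t) \<le> exp (V R t)" "exp (U r t) \<le> exp (U R t)" "0 < exp (V R t)" "0 < exp (U R t)"
    using U_mono[of r R t] V_mono[of r R t] r t by auto
  then have "exp (V r t) \<le> 2 * flux t" "exp (U r t) \<le> 2 * flux t"
    using two_flux[of t] by linarith+
  then have "lam1 * exp (V r t) - lam1 * exp (V r' t) \<le> (lam1 + lam2) * (2 * flux t) * (V r t - V r' t)"
    "lam2 * exp (U r t) - lam2 * exp (U r' t) \<le> (lam1 + lam2) * (2 * flux t) * (U r t - U r' t)"
    using lam1_pos lam2_pos U_mono[of r' r t] V_mono[of r' r t] r t by (auto intro!: *)
  then show ?thesis unfolding w_def by (simp add: field_simps)
qed

lemma w_le_ln:
  assumes "record_flux G t0" "0 \<le> s" "s \<le> t0" "0 \<le> r" "r \<le> R"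
  shows "w r s \<le> ln G"
proof -
  have s: "s < T" "flux s \<le> G" using assms unfolding record_flux_def by auto
  have "w r s \<le> w R s"
    using U_mono[of r R s] V_mono[of r R s] assms s unfolding w_def by (auto intro!: divide_right_mono add_mono)
  also have "\<dots> \<le> ln (flux s)"
    using exp_w_le_flux[of s] flux_ge_1[of s] assms s by (subst ln_ge_iff) auto
  also have "\<dots> \<le> ln G" using s flux_ge_1[of s] assms by (intro ln_mono) auto
  finally show ?thesis .
qed

lemma w_nonneg:
  assumes "0 \<le> r" "r \<le> R" "0 \<le> t" "t < T"
  shows "0 \<le> w r t"
  using U_nonneg[OF assms] V_nonneg[OF assms] unfolding w_def by simp

lemma w_r:
  assumes "0 < r" "r < R" "0 < t" "t < T"
  shows "((\<lambda>r. w r t) has_real_derivative (Ur r t + Vr r t) / 2) (at r)"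
  unfolding w_def by (intro DERIV_cdivide DERIV_add U_r V_r assms)

lemma w_second:
  assumes "0 < r" "r < R" "0 < t" "t < T"
  shows "has_second_derivative (\<lambda>r. w r t) ((Urr r t + Vrr r t) / 2) r"
proof (rule has_second_derivativeI[where S = "{0<..<R}"])
  show "((\<lambda>r. w r t) has_real_derivative (Ur x t + Vr x t) / 2) (at x)" if "x \<in> {0<..<R}" for x
    using that assms by (intro w_r) auto
  show "((\<lambda>r. (Ur r t + Vr r t) / 2) has_real_derivative (Urr r t + Vrr r t) / 2) (at r)"
    by (intro DERIV_cdivide DERIV_add U_rr V_rr assms)
qed (use assms in auto)

lemma w_t:
  assumes "0 < r" "r < R" "0 < t" "t < T"
  shows "(w r has_real_derivative (Urr r t + Vrr r t) / 2 + k / r * ((Ur r t + Vr r t) / 2) +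
    (lam1 * exp (V r t) + lam2 * exp (U r t)) / 2) (at t)"
  unfolding w_def
  by (rule DERIV_cong[OF DERIV_cdivide[OF DERIV_add[OF U_t V_t]]]) (use assms in \<open>simp_all add: field_simps\<close>)

lemma w_R:
  assumes "0 < t" "t < T"
  shows "((\<lambda>r. w r t) has_real_derivative flux t) (at R within {..R})"
  unfolding w_def flux_def
  by (rule DERIV_cong[OF DERIV_cdivide[OF DERIV_add[OF U_R V_R]]]) (use assms in auto)

text \<open>Up to the record time the flux is at most \<open>G\<close>, which alone would bound slopes by about \<open>G\<close>. Since
  \<open>w\<close> takes values between \<open>0\<close> and \<open>ln G\<close>, such slopes cannot persist over a distance
  \<open>L = 64 ln G / G\<close>, and diffusion transports this information to the boundary: the slope at distance
  \<open>y\<close> is smaller than \<open>G\<close> by a multiple of \<open>G y / L\<close>. To prove it without third derivatives, the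
  two-point function \<open>w r - w r'\<close> is compared with a stationary barrier \<open>\<Sigma> y Y\<close> for \<open>y = R - r\<close> and
  \<open>Y = R - r'\<close>. Its part \<open>G1 (Y - y) - \<alpha> (Y\<^sup>2 - y\<^sup>2)\<close> is harmonic in both variables and has the slope
  \<open>G1 > G\<close> at the boundary; the terms with \<open>\<beta>\<close> absorb the reaction and the curvature of the sphere; and
  \<open>ln G\<close> times the corner function dominates \<open>w r - w r'\<close> on \<open>Y = L\<close>.\<close>

lemma slope_bound_at_record:
  assumes rec: "record_flux G t0" and G1: "G < G1" "G1 \<le> 2 * G"
    and L_def: "L = 64 * ln G / G" and ln_G: "1 \<le> ln G" and LR: "L \<le> R / 2"
    and CGL: "16 * reaction_const * G * L\<^sup>2 \<le> 1" and PG: "2 * P \<le> G"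
    and Y0: "0 \<le> Y0" "Y0 \<le> L"
  shows "w R t0 - w (R - Y0) t0 \<le> G1 * Y0 - G / (8 * L) * Y0\<^sup>2"
proof -
  have t0: "T / 2 \<le> t0" "t0 < T" and rec_le: "\<And>s. \<lbrakk>0 \<le> s; s \<le> t0\<rbrakk> \<Longrightarrow> flux s \<le> G"
    using rec unfolding record_flux_def by auto
  have G: "1 \<le> G" using rec flux_ge_1[of t0] T_pos unfolding record_flux_def by auto
  have L: "0 < L" unfolding L_def using ln_G G by (intro divide_pos_pos mult_pos_pos; linarith)
  have lnGL: "ln G = G * L / 64" unfolding L_def using G by simp
  define \<Lambda> where "\<Lambda> = lam1 + lam2"
  have \<Lambda>: "0 < \<Lambda>" unfolding \<Lambda>_def using lam1_pos lam2_pos by simp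
  define C where "C = reaction_const"
  have C: "0 < C" "C = 4 * k / R + 6 * \<Lambda>" using reaction_const_pos unfolding C_def reaction_const_def \<Lambda>_def by auto
  define \<alpha> where "\<alpha> = G / (4 * L)"
  define \<beta> where "\<beta> = C * G\<^sup>2"
  have \<alpha>: "0 < \<alpha>" "\<alpha> \<le> G\<^sup>2" "2 * \<alpha> * L = G / 2"
  proof -
    have "1 / (4 * L) = G / (256 * ln G)" unfolding L_def by simp
    also have "\<dots> \<le> G / 1"
    proof (rule divide_left_mono)
      show "1 \<le> 256 * ln G" "0 \<le> G" "0 < 256 * ln G * 1" using ln_G G by linarith+
    qed
    finally have "1 / (4 * L) \<le> G" by simp
    then have "G * (1 / (4 * L)) \<le> G * G" using G by (intro mult_left_mono) auto
    then show "\<alpha> \<le> G\<^sup>2" unfolding \<alpha>_def by (simp add: power2_eq_square)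
  qed (use G L in \<open>auto simp: \<alpha>_def\<close>)
  have \<beta>: "0 < \<beta>" "\<beta> * L\<^sup>2 \<le> G / 16"
  proof -
    have "G * (16 * C * G * L\<^sup>2) \<le> G * 1" using CGL G unfolding C_def by (intro mult_left_mono) auto
    then show "\<beta> * L\<^sup>2 \<le> G / 16" unfolding \<beta>_def by (simp add: power2_eq_square algebra_simps)
  qed (use C G in \<open>auto simp: \<beta>_def\<close>)
  have \<mu>: "2 * \<Lambda> * G * L\<^sup>2 \<le> 2"
  proof -
    have "\<Lambda> \<le> C" using C k_nonneg R_pos \<Lambda> by simp
    then have "2 * \<Lambda> * G * L\<^sup>2 \<le> 16 * C * G * L\<^sup>2" using G C \<Lambda> by (intro mult_right_mono) auto
    then show ?thesis using CGL unfolding C_def by linarith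
  qed
  define S where "S y = G1 * y - \<alpha> * y\<^sup>2 + \<beta> * (L * y\<^sup>2 / 2 - y ^ 3 / 6)" for y
  define S' where "S' y = G1 - 2 * \<alpha> * y + \<beta> * (L * y - y\<^sup>2 / 2)" for y
  define S'' where "S'' y = - 2 * \<alpha> + \<beta> * (L - y)" for y
  have S1: "(S has_real_derivative S' y) (at y)" for y
    unfolding S_def S'_def by (auto intro!: derivative_eq_intros simp: power2_eq_square)
  have S2: "(S' has_real_derivative S'' y) (at y)" for y
    unfolding S'_def S''_def by (auto intro!: derivative_eq_intros simp: algebra_simps)
  have S_diff: "G / 2 * (Y - y) \<le> S Y - S y" "S Y - S y \<le> 3 * G * (Y - y)"
    if y: "0 \<le> y" "y \<le> Y" "Y \<le> L" for y Y
  proof -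
    define q where "q = (3 * (L * Y) + 3 * (L * y) - Y\<^sup>2 - Y * y - y\<^sup>2) / 6"
    have eq: "S Y - S y = (G1 - \<alpha> * (Y + y) + \<beta> * q) * (Y - y)"
      unfolding S_def q_def by (simp add: field_simps power2_eq_square power3_eq_cube)
    have sq: "Y\<^sup>2 \<le> L * Y" "Y * y \<le> L * y" "y\<^sup>2 \<le> L * y" "0 \<le> Y\<^sup>2" "0 \<le> Y * y" "0 \<le> y\<^sup>2"
      unfolding power2_eq_square using y by (auto intro!: mult_right_mono)
    have LY: "0 \<le> L * Y" "0 \<le> L * y" "L * Y \<le> L\<^sup>2" "L * y \<le> L\<^sup>2"
      unfolding power2_eq_square using y L by (auto intro!: mult_left_mono)
    have "0 \<le> 3 * (L * Y) + 3 * (L * y) - Y\<^sup>2 - Y * y - y\<^sup>2"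
      "3 * (L * Y) + 3 * (L * y) - Y\<^sup>2 - Y * y - y\<^sup>2 \<le> 6 * L\<^sup>2"
      using sq LY by linarith+
    then have q0: "0 \<le> q" "q \<le> L\<^sup>2" unfolding q_def by simp_all
    have "\<beta> * q \<le> \<beta> * L\<^sup>2" "0 \<le> \<beta> * q" using \<beta> q0 by auto
    with \<beta>(2) G have bq: "\<beta> * q \<le> G" "0 \<le> \<beta> * q" by linarith+
    have "\<alpha> * (Y + y) \<le> \<alpha> * (L + L)" using y \<alpha> by (intro mult_left_mono) auto
    then have ay: "\<alpha> * (Y + y) \<le> G / 2" using \<alpha>(3) by (simp add: algebra_simps)
    have ay0: "0 \<le> \<alpha> * (Y + y)" using \<alpha> y by simp
    have coeff: "G / 2 \<le> G1 - \<alpha> * (Y + y) + \<beta> * q" "G1 - \<alpha> * (Y + y) + \<beta> * q \<le> 3 * G"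
      using bq ay ay0 G1 by linarith+
    show "G / 2 * (Y - y) \<le> S Y - S y" unfolding eq
      using coeff y by (intro mult_right_mono) auto
    show "S Y - S y \<le> 3 * G * (Y - y)" unfolding eq
      using coeff y by (intro mult_right_mono) auto
  qed
  have S'_nonneg: "0 \<le> S' y" if "0 \<le> y" "y \<le> L" for y
  proof -
    have "2 * \<alpha> * y \<le> 2 * \<alpha> * L" using that \<alpha> by (intro mult_left_mono) auto
    moreover have "y\<^sup>2 \<le> L * y" "0 \<le> L * y"
      unfolding power2_eq_square using that by (auto intro!: mult_right_mono)
    then have "0 \<le> \<beta> * (L * y - y\<^sup>2 / 2)" using \<beta> by (intro mult_nonneg_nonneg) auto
    ultimately show ?thesis unfolding S'_def using \<alpha> G1 G by simp
  qed
  have S'_diff: "S' y - S' Y \<le> 2 * \<alpha> * (Y - y)" if "0 \<le> y" "y \<le> Y" "Y \<le> L" for y Y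
  proof -
    have "S' y - S' Y = 2 * \<alpha> * (Y - y) - \<beta> * ((Y - y) * (L - (Y + y) / 2))"
      unfolding S'_def by (simp add: field_simps power2_eq_square)
    moreover have "0 \<le> \<beta> * ((Y - y) * (L - (Y + y) / 2))"
      using that \<beta> by (intro mult_nonneg_nonneg) auto
    ultimately show ?thesis by simp
  qed
  define \<Sigma> where "\<Sigma> y Y = S Y - S y + ln G * corner L y Y" for y Y
  have bound: "w r t0 - w r' t0 \<le> \<Sigma> (R - r) (R - r')" if rr: "R - L \<le> r'" "r' < r" "r \<le> R" for r r'
  proof (rule field_le_epsilon)
    fix \<epsilon> :: real assume \<epsilon>: "0 < \<epsilon>"
    \<comment> \<open>at a touching point the reaction term is at most \<open>2 \<Lambda> G (\<Sigma> + E)\<close>; this rate takes care of \<open>E\<close>\<close>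
    define M where "M = 2 * \<Lambda> * G + 1"
    define E where "E t = \<epsilon> * exp (M * (t - t0))" for t
    have E: "0 < E t" for t unfolding E_def using \<epsilon> by simp
    have E': "(E has_real_derivative E t * M) (at t)" for t
      unfolding E_def by (auto intro!: derivative_eq_intros)
    define e0 where "e0 = E (T / 2)"
    have e0: "0 < e0" "\<And>t. T / 2 \<le> t \<Longrightarrow> e0 \<le> E t"
    proof -
      have "0 < M" unfolding M_def using \<Lambda> G by (simp add: add_pos_pos)
      then show "e0 \<le> E t" if "T / 2 \<le> t" for t
        unfolding e0_def E_def using \<epsilon> that by simp
    qed (simp add: e0_def E)
    \<comment> \<open>uniform continuity of \<open>w\<close> settles the pairs near the diagonal, and with them the corner where
      the barrier is discontinuous\<close>
    obtain \<eta> where \<eta>: "0 < \<eta>" "\<eta> < r - r'"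
      and close: "\<And>x y t. \<lbrakk>0 \<le> y; y \<le> x; x \<le> R; x - y \<le> \<eta>; T / 2 \<le> t; t \<le> t0\<rbrakk> \<Longrightarrow> w x t - w y t < e0"
    proof -
      have "continuous_on ({0..R} \<times> {T / 2..t0}) (\<lambda>p. w (fst p) (snd p))"
        by (intro continuous_w_compose continuous_intros) (use t0 T_pos in auto)
      then have "uniformly_continuous_on ({0..R} \<times> {T / 2..t0}) (\<lambda>p. w (fst p) (snd p))"
        by (intro compact_uniformly_continuous compact_Times) auto
      then obtain d where d: "0 < d" and unif: "\<And>p q. \<lbrakk>p \<in> {0..R} \<times> {T / 2..t0}; q \<in> {0..R} \<times> {T / 2..t0};
          dist q p < d\<rbrakk> \<Longrightarrow> dist (w (fst q) (snd q)) (w (fst p) (snd p)) < e0"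
        unfolding uniformly_continuous_on_def using e0(1) by meson
      show thesis
      proof (rule that[of "min (d / 2) ((r - r') / 2)"])
        fix x y t assume "0 \<le> y" "y \<le> x" "x \<le> R" "x - y \<le> min (d / 2) ((r - r') / 2)" "T / 2 \<le> t" "t \<le> t0"
        moreover have "dist (x, t) (y, t) = x - y" using calculation by (simp add: dist_Pair_Pair dist_real_def)
        ultimately show "w x t - w y t < e0"
          using unif[of "(y, t)" "(x, t)"] d by (auto simp: dist_real_def)
      next
        show "0 < min (d / 2) ((r - r') / 2)" using d rr by simp
        have "(r - r') / 2 < r - r'" using rr by simp
        then show "min (d / 2) ((r - r') / 2) < r - r'" by linarith
      qed
    qed
    define X where "X = {(r, r'). R - L \<le> r' \<and> r \<le> R \<and> r' + \<eta> \<le> r}"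
    have X_compact: "compact X"
    proof -
      have "closed {p :: real \<times> real. snd p + \<eta> \<le> fst p}"
        by (intro closed_Collect_le continuous_intros)
      then have "compact (({R - L..R} \<times> {R - L..R}) \<inter> {p :: real \<times> real. snd p + \<eta> \<le> fst p})"
        by (intro compact_Int_closed compact_Times) auto
      moreover have "X = ({R - L..R} \<times> {R - L..R}) \<inter> {p :: real \<times> real. snd p + \<eta> \<le> fst p}"
        unfolding X_def using \<eta>(1) by auto
      ultimately show ?thesis by simp
    qed
    define g where "g p t = w (fst p) t - w (snd p) t - \<Sigma> (R - fst p) (R - snd p) - E t" for p :: "real \<times> real" and t
    have X_D: "0 \<le> R - r" "R - r < R - r'" "R - r' \<le> L" "R - r < L" "R / 2 \<le> r'" "0 < r'" "r' + \<eta> \<le> r" "r \<le> R"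
      if "(r, r') \<in> X" for r r'
      using that \<eta>(1) LR R_pos unfolding X_def by auto
    have "g (r, r') t0 < 0"
    proof (rule first_touch[where g = g and X = X and a = "T / 2" and b = t0])
      show "compact X" by (rule X_compact)
      have c\<Sigma>: "continuous_on (X \<times> {T / 2..t0}) (\<lambda>p. \<Sigma> (R - fst (fst p)) (R - snd (fst p)))"
      proof -
        have "L\<^sup>2 - (R - fst (fst p))\<^sup>2 \<noteq> 0" if "p \<in> X \<times> {T / 2..t0}" for p
        proof -
          have "(fst (fst p), snd (fst p)) \<in> X" using that by (cases p) simp
          from X_D(1,4)[OF this] have "(R - fst (fst p))\<^sup>2 < L\<^sup>2"
            by (intro power_strict_mono) auto
          then show ?thesis by simp
        qed
        then show ?thesis
          unfolding \<Sigma>_def S_def corner_def by (intro continuous_intros) auto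
      qed
      have in_domain: "0 \<le> fst (fst p) \<and> fst (fst p) \<le> R" "0 \<le> snd (fst p) \<and> snd (fst p) \<le> R"
        "0 \<le> snd p \<and> snd p < T" if "p \<in> X \<times> {T / 2..t0}" for p
      proof -
        have "(fst (fst p), snd (fst p)) \<in> X" "snd p \<in> {T / 2..t0}" using that by (cases p, simp)+
        then show "0 \<le> fst (fst p) \<and> fst (fst p) \<le> R" "0 \<le> snd (fst p) \<and> snd (fst p) \<le> R"
            "0 \<le> snd p \<and> snd p < T"
          using X_D[of "fst (fst p)" "snd (fst p)"] \<eta>(1) t0 T_pos by auto
      qed
      have cw: "continuous_on (X \<times> {T / 2..t0}) (\<lambda>p. w (fst (fst p)) (snd p))"
        "continuous_on (X \<times> {T / 2..t0}) (\<lambda>p. w (snd (fst p)) (snd p))"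
        by (rule continuous_w_compose; (intro continuous_intros | erule in_domain))+
      have cE: "continuous_on (X \<times> {T / 2..t0}) (\<lambda>p. E (snd p))"
        unfolding E_def by (intro continuous_intros)
      show "continuous_on (X \<times> {T / 2..t0}) (\<lambda>(x, t). g x t)"
        unfolding case_prod_beta g_def
        by (intro continuous_on_diff cw c\<Sigma> cE)
    next
      fix p assume "p \<in> X"
      then obtain r r' where p: "p = (r, r')" "(r, r') \<in> X" by (cases p) auto
      note D = X_D[OF p(2)]
      have "w r (T / 2) - w r' (T / 2) \<le> P * (r - r')"
        using U_lipschitz[of r' r] V_lipschitz[of r' r] D \<eta>(1) unfolding w_def by (simp add: field_simps)
      also have "\<dots> \<le> G / 2 * (r - r')" using PG D \<eta>(1) by (intro mult_right_mono) auto
      also have "\<dots> = G / 2 * ((R - r') - (R - r))" by simp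
      also have "\<dots> \<le> S (R - r') - S (R - r)" by (rule S_diff) (use D in auto)
      also have "\<dots> \<le> \<Sigma> (R - r) (R - r')"
        unfolding \<Sigma>_def using corner_bounds(1)[of "R - r" "R - r'" L] D ln_G by simp
      finally show "g p (T / 2) < 0" unfolding g_def p using E[of "T / 2"] by simp
    next
      fix p t
      assume pX: "p \<in> X" and t: "T / 2 < t" "t \<le> t0" and gp0: "g p t = 0"
        and le: "\<And>z. z \<in> X \<Longrightarrow> g z t \<le> 0"
        and before: "\<And>\<tau>. \<lbrakk>T / 2 \<le> \<tau>; \<tau> < t\<rbrakk> \<Longrightarrow> g p \<tau> < 0"
      obtain r r' where p: "p = (r, r')" "(r, r') \<in> X" using pX by (cases p) auto
      note D = X_D[OF p(2)]
      have tT: "0 < t" "t < T" using t t0 T_pos by auto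
      define y Y where "y = R - r" and "Y = R - r'"
      have yY: "0 \<le> y" "y < Y" "Y \<le> L" "y < L" using D unfolding y_def Y_def by auto
      have touch: "w r t - w r' t = \<Sigma> y Y + E t"
        using gp0 unfolding g_def p y_def Y_def by simp
      have corner0: "0 \<le> ln G * corner L y Y"
        using corner_bounds(1)[of y Y L] yY ln_G by simp
      have S_pos: "0 \<le> S Y - S y"
      proof -
        have "0 \<le> G / 2 * (Y - y)" using G yY by simp
        also have "\<dots> \<le> S Y - S y" by (rule S_diff) (use yY in auto)
        finally show ?thesis .
      qed
      have off_diagonal: "r' + \<eta> < r"
      proof (rule ccontr)
        assume "\<not> r' + \<eta> < r"
        then have "w r t - w r' t < e0" using D t by (intro close) auto
        with touch corner0 S_pos e0(2)[of t] t show False unfolding \<Sigma>_def by simp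
      qed
      have max_fst: "w z t - \<Sigma> (R - z) Y \<le> w r t - \<Sigma> (R - r) Y" if "r' + \<eta> \<le> z" "z \<le> R" for z
      proof -
        have "(z, r') \<in> X" using p(2) that unfolding X_def by auto
        from le[OF this] gp0 show ?thesis unfolding g_def p Y_def by simp
      qed
      have max_snd: "- w z t - \<Sigma> y (R - z) \<le> - w r' t - \<Sigma> y (R - r')" if "R - L \<le> z" "z \<le> r - \<eta>" for z
      proof -
        have "(r, z) \<in> X" using p(2) that unfolding X_def by auto
        from le[OF this] gp0 show ?thesis unfolding g_def p y_def by simp
      qed
      have Y_ne: "Y \<noteq> L"
      proof
        assume "Y = L"
        then have "corner L y Y = 1" unfolding corner_def by simp
        moreover have "w r t - w r' t \<le> ln G - 0"
          using w_le_ln[OF rec, of t r] w_nonneg[of r' t] D tT t \<eta>(1) by (intro diff_mono) auto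
        ultimately show False using touch S_pos E[of t] unfolding \<Sigma>_def by simp
      qed
      let ?a = "L\<^sup>2 - Y\<^sup>2" and ?b = "L\<^sup>2 - y\<^sup>2"
      have bne: "?b \<noteq> 0" using power_strict_mono[of y L 2] yY by simp
      define A where "A = S' y + ln G * (4 * ?a\<^sup>2 * y / ?b ^ 3)"
      define B where "B = S' Y + ln G * (4 * ?a * Y / ?b\<^sup>2)"
      have \<Sigma>_y: "((\<lambda>y. \<Sigma> y Y) has_real_derivative - A) (at y)"
        unfolding \<Sigma>_def A_def
        by (rule DERIV_cong[OF DERIV_add[OF DERIV_diff[OF DERIV_const S1] DERIV_cmult[OF corner_derivative_fst[OF bne]]]]) simp
      have \<Sigma>_r: "((\<lambda>r. \<Sigma> (R - r) Y) has_real_derivative A) (at r)"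
        using has_real_derivative_reflect[of "\<lambda>y. \<Sigma> y Y" "- A" R r] \<Sigma>_y unfolding y_def by simp
      show False
      proof (cases "r = R")
        case True
        then have y0: "y = 0" unfolding y_def by simp
        have \<Sigma>_R: "((\<lambda>r. \<Sigma> (R - r) Y) has_real_derivative A) (at R within {..R})"
          using has_field_derivative_at_within[OF \<Sigma>_r] unfolding True .
        have "((\<lambda>r. w r t - \<Sigma> (R - r) Y) has_real_derivative flux t - A) (at R within {..R})"
          by (intro DERIV_diff w_R tT \<Sigma>_R)
        then have "0 \<le> flux t - A"
          by (rule left_derivative_at_max[where a = "r' + \<eta>"]) (use max_fst True off_diagonal in auto)
        then have "A \<le> G" using rec_le[of t] t tT by simp
        then show False using G1 unfolding A_def y0 S'_def by simp
      next
        case False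
        have r: "r < R" "r' + \<eta> < r" "0 < r" using False D off_diagonal \<eta>(1) by auto
        have r': "R - L < r'" "r' < r - \<eta>" "0 < r'" "r' < R" using Y_ne D off_diagonal \<eta>(1) unfolding Y_def by auto
        define A2 where "A2 = - S'' y + ln G * (- (4 * ?a\<^sup>2 / ?b ^ 3) - 24 * ?a\<^sup>2 * y\<^sup>2 / ?b ^ 4)"
        define B2 where "B2 = S'' Y + ln G * (4 * ?a / ?b\<^sup>2 - 8 * Y\<^sup>2 / ?b\<^sup>2)"
        have S_second: "has_second_derivative S (S'' z) z" for z
          by (rule has_second_derivativeI[where S = UNIV and f' = S']) (auto intro: S1 S2)
        have \<Sigma>_yy: "has_second_derivative (\<lambda>y. \<Sigma> y Y) A2 y"
        proof -
          have "has_second_derivative (\<lambda>y. \<Sigma> y Y) (0 - S'' y + ln G * (- (4 * ?a\<^sup>2 / ?b ^ 3) - 24 * ?a\<^sup>2 * y\<^sup>2 / ?b ^ 4)) y"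
            unfolding \<Sigma>_def
            by (intro has_second_derivative_add has_second_derivative_diff has_second_derivative_const
                has_second_derivative_cmult S_second corner_second_derivative_fst) (use yY in simp)
          then show ?thesis unfolding A2_def by simp
        qed
        have \<Sigma>_rr: "has_second_derivative (\<lambda>r. \<Sigma> (R - r) Y) A2 r"
          using has_second_derivative_reflect[of "\<lambda>y. \<Sigma> y Y" A2 R r] \<Sigma>_yy unfolding y_def by simp
        have \<Sigma>_Y: "((\<lambda>Y. \<Sigma> y Y) has_real_derivative B) (at Y)"
          unfolding \<Sigma>_def B_def
          by (rule DERIV_cong[OF DERIV_add[OF DERIV_diff[OF S1 DERIV_const] DERIV_cmult[OF corner_derivative_snd]]]) simp
        have \<Sigma>_YY: "has_second_derivative (\<lambda>Y. \<Sigma> y Y) B2 Y"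
        proof -
          have "has_second_derivative (\<lambda>Y. \<Sigma> y Y) (S'' Y - 0 + ln G * (4 * ?a / ?b\<^sup>2 - 8 * Y\<^sup>2 / ?b\<^sup>2)) Y"
            unfolding \<Sigma>_def
            by (intro has_second_derivative_add has_second_derivative_diff has_second_derivative_const
                has_second_derivative_cmult S_second corner_second_derivative_snd)
          then show ?thesis unfolding B2_def by simp
        qed
        have \<Sigma>_r': "((\<lambda>r. \<Sigma> y (R - r)) has_real_derivative - B) (at r')"
          using has_real_derivative_reflect[of "\<lambda>Y. \<Sigma> y Y" B R r'] \<Sigma>_Y unfolding Y_def by simp
        have \<Sigma>_r'r': "has_second_derivative (\<lambda>r. \<Sigma> y (R - r)) B2 r'"
          using has_second_derivative_reflect[of "\<lambda>Y. \<Sigma> y Y" B2 R r'] \<Sigma>_YY unfolding Y_def by simp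
        note m = interior_max_derivatives[OF r(2,1) w_r[OF r(3,1) tT] w_second[OF r(3,1) tT] \<Sigma>_r \<Sigma>_rr]
        have wr: "(Ur r t + Vr r t) / 2 = A"
          by (rule m(1)) (use max_fst in auto)
        have wrr: "(Urr r t + Vrr r t) / 2 \<le> A2"
          by (rule m(2)) (use max_fst in auto)
        note m' = interior_max_derivatives[OF r'(1,2) DERIV_minus[OF w_r[OF r'(3,4) tT]]
            has_second_derivative_uminus[OF w_second[OF r'(3,4) tT]] \<Sigma>_r' \<Sigma>_r'r']
        have "- ((Ur r' t + Vr r' t) / 2) = - B"
          by (rule m'(1)) (use max_snd in auto)
        then have wr': "(Ur r' t + Vr r' t) / 2 = B" by simp
        have wrr': "- ((Urr r' t + Vrr r' t) / 2) \<le> B2"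
          by (rule m'(2)) (use max_snd in auto)
        define f where "f r = (lam1 * exp (V r t) + lam2 * exp (U r t)) / 2" for r
        have "((\<lambda>\<tau>. w r \<tau> - w r' \<tau> - \<Sigma> y Y - E \<tau>) has_real_derivative
            ((Urr r t + Vrr r t) / 2 + k / r * ((Ur r t + Vr r t) / 2) + f r) -
            ((Urr r' t + Vrr r' t) / 2 + k / r' * ((Ur r' t + Vr r' t) / 2) + f r') - 0 - E t * M) (at t)"
          unfolding f_def by (intro DERIV_diff w_t DERIV_const E' r r' tT)
        then have time: "0 \<le> ((Urr r t + Vrr r t) / 2 + k / r * ((Ur r t + Vr r t) / 2) + f r) -
            ((Urr r' t + Vrr r' t) / 2 + k / r' * ((Ur r' t + Vr r' t) / 2) + f r') - 0 - E t * M"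
          by (rule time_derivative_at_touch[where a = "T / 2"])
            (use t gp0 before in \<open>auto simp: g_def p y_def Y_def\<close>)
        have reaction: "f r - f r' \<le> 2 * \<Lambda> * G * (\<Sigma> y Y + E t)"
        proof -
          have "f r - f r' \<le> 2 * \<Lambda> * flux t * (w r t - w r' t)"
            unfolding f_def \<Lambda>_def by (rule reaction_difference) (use r r' tT D \<eta>(1) in auto)
          also have "\<dots> \<le> 2 * \<Lambda> * G * (w r t - w r' t)"
            using rec_le[of t] t tT \<Lambda> touch corner0 S_pos E[of t]
            by (intro mult_right_mono mult_left_mono) (auto simp: \<Sigma>_def)
          finally show ?thesis unfolding touch .
        qed
        have drift: "k / r * A - k / r' * B \<le> k / R * G\<^sup>2 * (4 * (Y - y))"
        proof -
          have B0: "0 \<le> B"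
            unfolding B_def using S'_nonneg[of Y] corner_slope_sum(2)[of y Y L] yY ln_G by simp
          have "k / r \<le> k / r'" using r r' k_nonneg \<eta>(1) by (intro divide_left_mono) auto
          then have "k / r * B \<le> k / r' * B" using B0 by (intro mult_right_mono)
          then have "k / r * A - k / r' * B \<le> k / r * A - k / r * B" by (rule diff_left_mono)
          also have "\<dots> = k / r * (A - B)" by (rule right_diff_distrib[symmetric])
          also have "\<dots> \<le> k / r * (2 * \<alpha> * (Y - y))"
          proof (rule mult_left_mono)
            have "ln G * (4 * ?a\<^sup>2 * y / ?b ^ 3) \<le> ln G * (4 * ?a * Y / ?b\<^sup>2)"
              using corner_slope_sum(1)[of y Y L] yY ln_G by (intro mult_left_mono) auto
            then show "A - B \<le> 2 * \<alpha> * (Y - y)"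
              unfolding A_def B_def using S'_diff[of y Y] yY by linarith
          qed (use k_nonneg r in auto)
          also have "\<dots> \<le> (k * 2 / R) * (2 * G\<^sup>2 * (Y - y))"
          proof (rule mult_mono)
            have "k / r \<le> k / (R / 2)" using k_nonneg D r R_pos \<eta>(1) by (intro divide_left_mono) auto
            then show "k / r \<le> k * 2 / R" by simp
            show "2 * \<alpha> * (Y - y) \<le> 2 * G\<^sup>2 * (Y - y)" using \<alpha> yY by (intro mult_right_mono) auto
          qed (use k_nonneg R_pos yY \<alpha> in auto)
          finally show ?thesis by (simp add: algebra_simps)
        qed
        have corner_part: "ln G * (- (4 * ?a\<^sup>2 / ?b ^ 3) - 24 * ?a\<^sup>2 * y\<^sup>2 / ?b ^ 4) +
            ln G * (4 * ?a / ?b\<^sup>2 - 8 * Y\<^sup>2 / ?b\<^sup>2) + 2 * \<Lambda> * G * (ln G * corner L y Y) \<le> 0"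
        proof -
          have "ln G * ((- (4 * ?a\<^sup>2 / ?b ^ 3) - 24 * ?a\<^sup>2 * y\<^sup>2 / ?b ^ 4) +
            (4 * ?a / ?b\<^sup>2 - 8 * Y\<^sup>2 / ?b\<^sup>2) + 2 * \<Lambda> * G * corner L y Y) \<le> 0"
            using ln_G \<Lambda> G yY \<mu> by (intro mult_nonneg_nonpos corner_superharmonic) auto
          then show ?thesis by (simp only: distrib_left mult.left_commute)
        qed
        have S_part: "- S'' y + S'' Y + 2 * \<Lambda> * G * (S Y - S y) + k / R * G\<^sup>2 * (4 * (Y - y)) \<le> 0"
        proof -
          have "2 * \<Lambda> * G * (S Y - S y) \<le> 2 * \<Lambda> * G * (3 * G * (Y - y))"
            using \<Lambda> G S_diff(2)[of y Y] yY by (intro mult_left_mono) auto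
          moreover have "- S'' y + S'' Y = - (\<beta> * (Y - y))"
            unfolding S''_def by (simp add: algebra_simps)
          moreover have "\<beta> * (Y - y) = k / R * G\<^sup>2 * (4 * (Y - y)) + 2 * \<Lambda> * G * (3 * G * (Y - y))"
          proof -
            have "(4 * \<kappa> + 6 * \<Lambda>) * G\<^sup>2 * d = \<kappa> * G\<^sup>2 * (4 * d) + 2 * \<Lambda> * G * (3 * G * d)" for \<kappa> d
              by (simp add: algebra_simps power2_eq_square)
            from this[of "k / R" "Y - y"] show ?thesis unfolding \<beta>_def C(2) by simp
          qed
          ultimately show ?thesis by linarith
        qed
        have "E t * M = 2 * \<Lambda> * G * E t + E t" unfolding M_def by (simp add: algebra_simps)
        moreover have "f r - f r' \<le> 2 * \<Lambda> * G * (S Y - S y) + 2 * \<Lambda> * G * (ln G * corner L y Y) + 2 * \<Lambda> * G * E t"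
          using reaction unfolding \<Sigma>_def by (simp only: distrib_left)
        ultimately show False
          using time drift corner_part S_part wrr wrr' E[of t]
          unfolding wr wr' A2_def B2_def by linarith
      qed
    qed (use rr t0 \<eta> X_def in auto)
    then have "w r t0 - w r' t0 - \<Sigma> (R - r) (R - r') - E t0 < 0" unfolding g_def by simp
    moreover have "E t0 = \<epsilon>" unfolding E_def by simp
    ultimately show "w r t0 - w r' t0 \<le> \<Sigma> (R - r) (R - r') + \<epsilon>" by simp
  qed
  show ?thesis
  proof (cases "Y0 = 0")
    case False
    have "w R t0 - w (R - Y0) t0 \<le> \<Sigma> 0 Y0"
      using bound[of "R - Y0" R] Y0 False by simp
    also have "\<Sigma> 0 Y0 \<le> G1 * Y0 - \<alpha> * Y0\<^sup>2 + \<beta> * (L * Y0\<^sup>2 / 2) + ln G * (2 * Y0\<^sup>2 / L\<^sup>2)"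
    proof -
      have "corner L 0 Y0 \<le> 2 * Y0\<^sup>2 / (L\<^sup>2 - 0\<^sup>2)" by (rule corner_bounds) (use Y0 L in auto)
      then have "ln G * corner L 0 Y0 \<le> ln G * (2 * Y0\<^sup>2 / L\<^sup>2)" using ln_G by (intro mult_left_mono) auto
      moreover have "\<beta> * (L * Y0\<^sup>2 / 2 - Y0 ^ 3 / 6) \<le> \<beta> * (L * Y0\<^sup>2 / 2)"
        using \<beta> Y0 by (intro mult_left_mono) auto
      ultimately show ?thesis unfolding \<Sigma>_def S_def by simp
    qed
    also have "\<dots> \<le> G1 * Y0 - G / (8 * L) * Y0\<^sup>2"
    proof -
      have "\<beta> * L / 2 \<le> G / (32 * L)"
        using \<beta>(2) L by (simp add: field_simps power2_eq_square)
      then have "\<beta> * L / 2 * Y0\<^sup>2 \<le> G / (32 * L) * Y0\<^sup>2" by (intro mult_right_mono) auto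
      moreover have "ln G * (2 * Y0\<^sup>2 / L\<^sup>2) = G / (32 * L) * Y0\<^sup>2"
        unfolding lnGL using L by (simp add: field_simps power2_eq_square)
      moreover have "\<alpha> * Y0\<^sup>2 = 8 * (G / (32 * L) * Y0\<^sup>2)" "G / (8 * L) * Y0\<^sup>2 = 4 * (G / (32 * L) * Y0\<^sup>2)"
        unfolding \<alpha>_def using L by (simp_all add: field_simps)
      moreover have "0 \<le> G / (32 * L) * Y0\<^sup>2" using G L by simp
      ultimately show ?thesis by (simp add: algebra_simps)
    qed
    finally show ?thesis .
  qed simp
qed

end

section \<open>Blow-up forced by a steep profile\<close>

lemma cosh_half_bound:
  fixes x :: real
  assumes "\<bar>x\<bar> \<le> 1"
  shows "(exp x + exp (- x)) / 2 \<le> 1 + x\<^sup>2"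
proof -
  have pos: "exp z \<le> 1 + z + z\<^sup>2" "exp (- z) \<le> 1 - z + z\<^sup>2" if z: "0 \<le> z" "z \<le> 1" for z :: real
  proof -
    show "exp z \<le> 1 + z + z\<^sup>2" using z by (rule exp_bound)
    have "1 \<le> (1 - z + z\<^sup>2) * (1 + z + z\<^sup>2 / 2)"
    proof -
      have "(1 - z + z\<^sup>2) * (1 + z + z\<^sup>2 / 2) = 1 + (z\<^sup>2 + z ^ 3 + z ^ 4) / 2"
        by (simp add: field_simps power2_eq_square power3_eq_cube power4_eq_xxxx)
      then show ?thesis using z by simp
    qed
    also have "\<dots> \<le> (1 - z + z\<^sup>2) * exp z"
    proof (rule mult_left_mono)
      show "1 + z + z\<^sup>2 / 2 \<le> exp z" using z(1) by (rule exp_lower_Taylor_quadratic)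
      show "0 \<le> 1 - z + z\<^sup>2" using z by simp
    qed
    finally show "exp (- z) \<le> 1 - z + z\<^sup>2" by (simp add: exp_minus field_simps)
  qed
  show ?thesis
  proof (cases "0 \<le> x")
    case True
    then show ?thesis using pos[of x] assms by simp
  next
    case False
    then show ?thesis using pos[of "- x"] assms by simp
  qed
qed

context radial_system
begin

text \<open>The profile \<open>ln l - l y\<close> is a stationary solution of the scalar problem \<open>w\<^sub>t = w\<^sub>y\<^sub>y\<close> with boundary
  flux \<open>exp w\<close>. It is unstable: after adding \<open>\<epsilon> exp (- l y)\<close> it becomes a subsolution \<open>\<phi>\<close> if the
  parameter grows according to \<open>l' = \<epsilon> l\<^sup>3\<close>, that is \<open>1 / l\<^sup>2\<close> decreases linearly with slope
  \<open>- 2 \<epsilon>\<close>. A profile above \<open>\<phi>\<close> stays above it, so the solution cannot outlive the time \<open>tb\<close> at which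
  \<open>l\<close> becomes infinite. On \<open>y = R / 2\<close> the subsolution is negative, and the radial term and the reaction
  only help.\<close>

lemma remaining_time_bound:
  assumes t0: "0 \<le> t0" "t0 < T" and \<epsilon>: "0 < \<epsilon>" and l0: "0 < l0"
    and inner: "\<And>l. l0 \<le> l \<Longrightarrow> ln l - l * (R / 2) + \<epsilon> < 0"
    and init: "\<And>y. \<lbrakk>0 \<le> y; y \<le> R / 2\<rbrakk> \<Longrightarrow> ln l0 - l0 * y + \<epsilon> * exp (- (l0 * y)) < w (R - y) t0"
  shows "T - t0 \<le> 1 / (2 * \<epsilon> * l0\<^sup>2)"
proof (rule ccontr)
  assume "\<not> T - t0 \<le> 1 / (2 * \<epsilon> * l0\<^sup>2)"
  define tb where "tb = t0 + 1 / (2 * \<epsilon> * l0\<^sup>2)"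
  have tb: "t0 < tb" "tb < T"
    using \<open>\<not> T - t0 \<le> 1 / (2 * \<epsilon> * l0\<^sup>2)\<close> \<epsilon> l0 unfolding tb_def by auto
  define Q where "Q t = 2 * \<epsilon> * (tb - t)" for t
  define l where "l t = exp (- (ln (Q t) / 2))" for t
  have Q_pos: "0 < Q t" if "t < tb" for t using that \<epsilon> unfolding Q_def by simp
  have Q0: "Q t0 = 1 / l0\<^sup>2" unfolding Q_def tb_def using \<epsilon> l0 by (simp add: field_simps)
  have l_sq: "l t * l t = 1 / Q t" if "t < tb" for t
    using Q_pos[OF that] unfolding l_def by (simp add: exp_minus inverse_eq_divide flip: exp_add)
  have l_pos: "0 < l t" for t unfolding l_def by simp
  have l_init: "l t0 = l0"
  proof -
    have "ln (Q t0) = - (2 * ln l0)" unfolding Q0 using l0 by (simp add: ln_div ln_realpow)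
    then show ?thesis unfolding l_def using l0 by simp
  qed
  have l_mono: "l0 \<le> l t" if t: "t0 \<le> t" "t < tb" for t
  proof -
    have "Q t \<le> Q t0" using t \<epsilon> unfolding Q_def by simp
    then have "ln (Q t) \<le> ln (Q t0)" using Q_pos[OF t(2)] by (rule ln_mono)
    then have "l t0 \<le> l t" unfolding l_def by simp
    then show ?thesis unfolding l_init .
  qed
  have l': "(l has_real_derivative l t * (\<epsilon> * (l t * l t))) (at t)" if t: "t < tb" for t
  proof -
    have "((\<lambda>t. - (ln (Q t) / 2)) has_real_derivative \<epsilon> / Q t) (at t)"
      using Q_pos[OF t] \<epsilon> t unfolding Q_def by (auto intro!: derivative_eq_intros simp: field_simps)
    from DERIV_chain2[OF DERIV_exp this] show ?thesis
      unfolding l_sq[OF t] unfolding l_def[abs_def] by simp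
  qed
  define \<phi> where "\<phi> y t = ln (l t) - l t * y + \<epsilon> * exp (- (l t * y))" for y t
  have \<phi>_y: "((\<lambda>y. \<phi> y t) has_real_derivative - (l t) - \<epsilon> * l t * exp (- (l t * y))) (at y)" for y t
    unfolding \<phi>_def by (auto intro!: derivative_eq_intros)
  have \<phi>_yy: "has_second_derivative (\<lambda>y. \<phi> y t) (\<epsilon> * (l t * l t) * exp (- (l t * y))) y" for y t
    by (rule has_second_derivativeI[where S = UNIV, OF _ _ \<phi>_y]) (auto intro!: derivative_eq_intros)
  have \<phi>_t: "(\<phi> y has_real_derivative
      \<epsilon> * (l t * l t) * (1 - l t * y - \<epsilon> * (l t * y) * exp (- (l t * y)))) (at t)" if t: "t < tb" for y t
  proof -
    have ln_l: "((\<lambda>t. ln (l t)) has_real_derivative inverse (l t) * (l t * (\<epsilon> * (l t * l t)))) (at t)"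
      by (rule DERIV_chain2[where f = ln and g = l, OF DERIV_ln[OF l_pos] l'[OF t]])
    have exp_l: "((\<lambda>t. exp (- (l t * y))) has_real_derivative
        exp (- (l t * y)) * - (l t * (\<epsilon> * (l t * l t)) * y)) (at t)"
      by (rule DERIV_chain2[where f = exp and g = "\<lambda>t. - (l t * y)",
            OF DERIV_exp DERIV_minus[OF DERIV_cmult_right[OF l'[OF t]]]])
    have "(\<phi> y has_real_derivative inverse (l t) * (l t * (\<epsilon> * (l t * l t))) - l t * (\<epsilon> * (l t * l t)) * y +
        \<epsilon> * (exp (- (l t * y)) * - (l t * (\<epsilon> * (l t * l t)) * y))) (at t)"
      unfolding \<phi>_def
      by (intro DERIV_add DERIV_diff DERIV_cmult DERIV_cmult_right ln_l exp_l l' t)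
    then show ?thesis
      by (rule DERIV_cong) (use l_pos[of t] in \<open>simp add: algebra_simps\<close>)
  qed
  have below: "\<phi> 0 t1 < w R t1" if t1: "t0 < t1" "t1 < tb" for t1
  proof -
    have "\<phi> (R - R) t1 - w R t1 < 0"
    proof (rule first_touch[where g = "\<lambda>r t. \<phi> (R - r) t - w r t" and X = "{R / 2..R}" and a = t0 and b = t1])
      show "continuous_on ({R / 2..R} \<times> {t0..t1}) (\<lambda>(r, t). \<phi> (R - r) t - w r t)"
      proof -
        have "continuous_on ({R / 2..R} \<times> {t0..t1}) (\<lambda>p. l (snd p))"
        proof -
          have "Q (snd p) \<noteq> 0" if "p \<in> {R / 2..R} \<times> {t0..t1}" for p
            using Q_pos[of "snd p"] that t1 by auto
          then show ?thesis unfolding l_def Q_def by (intro continuous_intros) auto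
        qed
        then have "continuous_on ({R / 2..R} \<times> {t0..t1}) (\<lambda>p. \<phi> (R - fst p) (snd p))"
          unfolding \<phi>_def by (intro continuous_intros) (use l_pos in \<open>auto simp: less_imp_neq[symmetric]\<close>)
        moreover have "continuous_on ({R / 2..R} \<times> {t0..t1}) (\<lambda>p. w (fst p) (snd p))"
          by (rule continuous_w_compose) (use t0 t1 tb R_pos in \<open>auto intro: continuous_intros\<close>)
        ultimately show ?thesis unfolding case_prod_beta by (rule continuous_on_diff)
      qed
    next
      fix r assume "r \<in> {R / 2..R}"
      then show "\<phi> (R - r) t0 - w r t0 < 0"
        using init[of "R - r"] unfolding \<phi>_def l_init by simp
    next
      fix r t
      assume r: "r \<in> {R / 2..R}" and t: "t0 < t" "t \<le> t1" and g0: "\<phi> (R - r) t - w r t = 0"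
        and le: "\<And>z. z \<in> {R / 2..R} \<Longrightarrow> \<phi> (R - z) t - w z t \<le> 0"
        and before: "\<And>\<tau>. \<lbrakk>t0 \<le> \<tau>; \<tau> < t\<rbrakk> \<Longrightarrow> \<phi> (R - r) \<tau> - w r \<tau> < 0"
      have tT: "0 < t" "t < T" "t < tb" "t0 \<le> t" using t t0 t1 tb by auto
      have max: "\<phi> (R - z) t - w z t \<le> \<phi> (R - r) t - w r t" if "R / 2 \<le> z" "z \<le> R" for z
        using le[of z] g0 that by simp
      let ?s = "l t + \<epsilon> * l t * exp (- (l t * (R - r)))"
      have \<phi>_r: "((\<lambda>r. \<phi> (R - r) t) has_real_derivative ?s) (at r)"
        by (rule DERIV_cong[OF has_real_derivative_reflect[OF \<phi>_y[of t "R - r"]]]) simp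
      consider "r = R / 2" | "r = R" | "R / 2 < r" "r < R" using r by fastforce
      then show False
      proof cases
        case 1
        have "exp (- (l t * (R / 2))) \<le> 1" using l_pos[of t] R_pos by simp
        then have "\<epsilon> * exp (- (l t * (R / 2))) \<le> \<epsilon> * 1" using \<epsilon> by (intro mult_left_mono) auto
        moreover have half: "R - r = R / 2" using 1 by simp
        ultimately have "\<phi> (R - r) t < 0"
          using inner[OF l_mono[OF tT(4,3)]] unfolding \<phi>_def half by linarith
        moreover have "0 \<le> w r t" using 1 R_pos tT by (intro w_nonneg) auto
        ultimately show False using g0 by simp
      next
        case 2
        have \<phi>_R: "((\<lambda>r. \<phi> (R - r) t) has_real_derivative ?s) (at R within {..R})"
          using has_field_derivative_at_within[OF \<phi>_r] unfolding 2 .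
        have "0 \<le> ?s - flux t"
          by (rule left_derivative_at_max[OF DERIV_diff[OF \<phi>_R w_R[OF tT(1,2)]], where a = "R / 2"])
            (use max 2 R_pos in auto)
        then have "flux t \<le> l t * (1 + \<epsilon>)" using 2 by (simp add: algebra_simps)
        moreover have "exp (w R t) = l t * exp \<epsilon>"
        proof -
          have "w R t = ln (l t) + \<epsilon>" using g0 2 unfolding \<phi>_def by simp
          then show ?thesis using l_pos[of t] by (simp add: exp_add)
        qed
        moreover have "l t * (1 + \<epsilon>) < l t * exp \<epsilon>"
        proof (rule mult_strict_left_mono[OF _ l_pos])
          have "1 + \<epsilon> + \<epsilon>\<^sup>2 / 2 \<le> exp \<epsilon>" using \<epsilon> by (intro exp_lower_Taylor_quadratic) simp
          moreover have "0 < \<epsilon>\<^sup>2 / 2" using \<epsilon> by simp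
          ultimately show "1 + \<epsilon> < exp \<epsilon>" by linarith
        qed
        ultimately show False using exp_w_le_flux[of t] by simp
      next
        case 3
        have r0: "0 < r" using 3 R_pos by simp
        define \<xi> where "\<xi> = l t * (R - r)"
        have \<xi>: "0 \<le> \<xi>" using l_pos[of t] 3 unfolding \<xi>_def by simp
        have \<phi>_rr: "has_second_derivative (\<lambda>r. \<phi> (R - r) t) (\<epsilon> * (l t * l t) * exp (- \<xi>)) r"
          unfolding \<xi>_def by (rule has_second_derivative_reflect[OF \<phi>_yy])
        note m = interior_max_derivatives[OF 3 \<phi>_r \<phi>_rr w_r[OF r0 3(2) tT(1,2)] w_second[OF r0 3(2) tT(1,2)]]
        have slope: "?s = (Ur r t + Vr r t) / 2" by (rule m(1)) (use max in auto)
        have curv: "\<epsilon> * (l t * l t) * exp (- \<xi>) \<le> (Urr r t + Vrr r t) / 2" by (rule m(2)) (use max in auto)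
        have "0 \<le> ?s" using l_pos[of t] \<epsilon> by simp
        then have drift: "0 \<le> k / r * ((Ur r t + Vr r t) / 2)"
          unfolding slope using k_nonneg r0 by (intro mult_nonneg_nonneg) auto
        have source: "0 < (lam1 * exp (V r t) + lam2 * exp (U r t)) / 2"
          using lam1_pos lam2_pos by (simp add: add_pos_pos)
        have "0 \<le> \<epsilon> * (l t * l t) * (1 - \<xi> - \<epsilon> * \<xi> * exp (- \<xi>)) -
            ((Urr r t + Vrr r t) / 2 + k / r * ((Ur r t + Vr r t) / 2) +
              (lam1 * exp (V r t) + lam2 * exp (U r t)) / 2)"
        proof (rule time_derivative_at_touch[where a = t0 and t = t])
          show "((\<lambda>t. \<phi> (R - r) t - w r t) has_real_derivative
              \<epsilon> * (l t * l t) * (1 - \<xi> - \<epsilon> * \<xi> * exp (- \<xi>)) -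
              ((Urr r t + Vrr r t) / 2 + k / r * ((Ur r t + Vr r t) / 2) +
              (lam1 * exp (V r t) + lam2 * exp (U r t)) / 2)) (at t)"
            unfolding \<xi>_def by (intro DERIV_diff \<phi>_t w_t r0 3 tT)
        qed (use t g0 before in auto)
        moreover have "\<epsilon> * (l t * l t) * (1 - \<xi> - \<epsilon> * \<xi> * exp (- \<xi>)) \<le> \<epsilon> * (l t * l t) * exp (- \<xi>)"
        proof (rule mult_left_mono)
          have "0 \<le> \<epsilon> * \<xi> * exp (- \<xi>)" using \<epsilon> \<xi> by simp
          then show "1 - \<xi> - \<epsilon> * \<xi> * exp (- \<xi>) \<le> exp (- \<xi>)"
            using exp_ge_add_one_self[of "- \<xi>"] by linarith
        qed (use \<epsilon> l_pos[of t] in simp)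
        ultimately show False using curv drift source by linarith
      qed
    qed (use t1 R_pos in auto)
    then show ?thesis by simp
  qed
  have "continuous_on {t0..tb} (\<lambda>t. w R t)"
    by (rule continuous_w_compose) (use t0 tb R_pos in \<open>auto intro: continuous_intros\<close>)
  then have "bdd_above ((\<lambda>t. w R t) ` {t0..tb})"
    by (intro bounded_imp_bdd_above compact_imp_bounded compact_continuous_image) auto
  then obtain M where "\<And>x. x \<in> (\<lambda>t. w R t) ` {t0..tb} \<Longrightarrow> x \<le> M"
    unfolding bdd_above_def by blast
  then have M: "w R t \<le> M" if "t0 \<le> t" "t \<le> tb" for t using that by auto
  define d where "d = min ((tb - t0) / 2) (exp (- (2 * M)) / (2 * \<epsilon>))"
  have d: "0 < d" "d < tb - t0" "2 * \<epsilon> * d \<le> exp (- (2 * M))"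
  proof -
    show "0 < d" using tb \<epsilon> unfolding d_def by simp
    have "(tb - t0) / 2 < tb - t0" using tb by simp
    then show "d < tb - t0" unfolding d_def by linarith
    have "2 * \<epsilon> * d \<le> 2 * \<epsilon> * (exp (- (2 * M)) / (2 * \<epsilon>))"
      using \<epsilon> unfolding d_def by (intro mult_left_mono) auto
    then show "2 * \<epsilon> * d \<le> exp (- (2 * M))" using \<epsilon> by simp
  qed
  have "ln (Q (tb - d)) \<le> ln (exp (- (2 * M)))"
    using d \<epsilon> unfolding Q_def by (intro ln_mono) auto
  then have "M \<le> ln (l (tb - d))" unfolding l_def by simp
  moreover have "\<phi> 0 (tb - d) < w R (tb - d)" using d by (intro below) auto
  ultimately show False
    using M[of "tb - d"] d \<epsilon> unfolding \<phi>_def by simp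
qed

text \<open>At a record time the boundary value \<open>w R t0\<close> is within \<open>\<kappa> / 8\<close> of \<open>ln G\<close>, because the components are
  close to each other, and the slope estimate gains \<open>\<kappa> (G y)\<^sup>2\<close> over the slope \<open>G1\<close>, where
  \<open>\<kappa> = 1 / (512 ln G)\<close>. Lowering the slope from \<open>G1\<close> to \<open>l0 = G1 (1 - \<kappa>)\<close> then leaves room for a
  perturbation of size \<open>\<epsilon> = \<kappa> / 8\<close> under the profile, and the remaining time is at most a multiple of
  \<open>1 / (\<kappa> G\<^sup>2)\<close>, that is \<open>ln G / G\<^sup>2\<close>.\<close>

lemma record_flux_bound:
  "\<forall>\<^sub>F G in at_top. \<forall>t0. record_flux G t0 \<longrightarrow> T - t0 \<le> 8192 / G"
proof -
  define b where "b G = (2 * K + 1) * exp (- decay_rate * (ln G + ln (decay_rate / (8 * (lam1 + lam2)))))" for G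
  have rate: "0 < decay_rate" unfolding decay_rate_def using robin_const_pos by auto
  have "\<forall>\<^sub>F l in at_top. ln l - l * (R / 2) + 1 < (0::real)"
    using R_pos by real_asymp
  then obtain l1 where l1: "\<And>l. l1 \<le> l \<Longrightarrow> ln l - l * (R / 2) + 1 < 0"
    unfolding eventually_at_top_linorder by auto
  have gap_U: "\<forall>\<^sub>F G in at_top. \<forall>t0. record_flux G t0 \<longrightarrow> U R t0 - V R t0 \<le> b G"
    unfolding b_def by (rule component_gap_at_record)
  have gap_V: "\<forall>\<^sub>F G in at_top. \<forall>t0. record_flux G t0 \<longrightarrow> V R t0 - U R t0 \<le> b G"
  proof -
    interpret vu: radial_system R T lam2 lam1 k K c P V U Vr Ur Vrr Urr by (rule swapped)
    have "vu.decay_rate = decay_rate"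
      unfolding vu.decay_rate_def vu.robin_const_def decay_rate_def robin_const_def ..
    then show ?thesis
      using vu.component_gap_at_record unfolding record_flux_swapped b_def by (simp add: add.commute)
  qed
  have small: "\<forall>\<^sub>F G in at_top. (b G)\<^sup>2 \<le> 1 / (1024 * ln G)"
    unfolding b_def using rate K_nonneg by real_asymp
  have "0 < reaction_const" by (rule reaction_const_pos)
  then have size: "\<forall>\<^sub>F G in at_top. 1 \<le> ln G \<and> 64 * ln G / G \<le> R / 2 \<and>
      16 * reaction_const * G * (64 * ln G / G)\<^sup>2 \<le> 1"
    using R_pos by (intro eventually_conj) real_asymp+
  have large: "\<forall>\<^sub>F G in at_top. 2 * P \<le> G \<and> 2 * l1 \<le> G"
    by (intro eventually_conj eventually_ge_at_top)
  show ?thesis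
    using gap_U gap_V small size large
  proof eventually_elim
    case (elim G)
    show ?case
    proof (intro allI impI)
      fix t0 assume rec: "record_flux G t0"
      then have t0: "T / 2 \<le> t0" "t0 < T" "flux t0 = G" unfolding record_flux_def by auto
      have t0_nonneg: "0 \<le> t0" using t0 T_pos by simp
      have G: "1 \<le> G" using flux_ge_1[of t0] t0 T_pos by auto
      define L where "L = 64 * ln G / G"
      have ln_G: "1 \<le> ln G" using elim by simp
      have L: "0 < L" unfolding L_def using ln_G G by (intro divide_pos_pos mult_pos_pos; linarith)
      define \<kappa> where "\<kappa> = 1 / (512 * ln G)"
      have \<kappa>: "0 < \<kappa>" "\<kappa> \<le> 1 / 512"
      proof -
        have "512 * 1 \<le> 512 * ln G" using ln_G by (rule mult_left_mono) simp
        then show "\<kappa> \<le> 1 / 512" unfolding \<kappa>_def by (intro divide_left_mono mult_pos_pos) auto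
        show "0 < \<kappa>" unfolding \<kappa>_def using ln_G by (intro divide_pos_pos mult_pos_pos; linarith)
      qed
      have slope_coeff: "G / (8 * L) = \<kappa> * G\<^sup>2"
        unfolding L_def \<kappa>_def using G by (simp add: field_simps power2_eq_square)
      define G1 where "G1 = G * (1 + \<kappa> / 8)"
      have G1: "G < G1" "G1 \<le> 3 / 2 * G" "G1 \<le> 2 * G"
      proof -
        have "G * (1 + \<kappa> / 8) \<le> G * (3 / 2)" using G \<kappa> by (intro mult_left_mono) auto
        then show "G1 \<le> 3 / 2 * G" "G1 \<le> 2 * G" using G unfolding G1_def by auto
      qed (use G \<kappa> in \<open>simp add: G1_def\<close>)
      define l0 where "l0 = G1 * (1 - \<kappa>)"
      have l0: "G / 2 \<le> l0" "0 < l0"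
      proof -
        have "G * (1 / 2) \<le> G1 * (1 - \<kappa>)" using G G1 \<kappa> by (intro mult_mono) auto
        then show "G / 2 \<le> l0" unfolding l0_def by simp
        then show "0 < l0" using G by linarith
      qed
      have ln_G1: "ln G1 \<le> ln G + \<kappa> / 8"
        unfolding G1_def using G \<kappa> ln_add_one_self_le_self[of "\<kappa> / 8"] by (simp add: ln_mult)
      have ln_l0: "ln l0 \<le> ln G1 - \<kappa>"
        unfolding l0_def using G G1 \<kappa> ln_add_one_self_le_self2[of "- \<kappa>"] by (simp add: ln_mult)
      \<comment> \<open>the arithmetic and the geometric mean of the boundary fluxes nearly agree\<close>
      have defect: "ln G \<le> w R t0 + \<kappa> / 8"
      proof -
        define x where "x = (U R t0 - V R t0) / 2"
        have "\<bar>2 * x\<bar> \<le> \<bar>b G\<bar>" using elim(1,2) rec unfolding x_def by (auto simp: abs_le_iff)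
        then have "(2 * x)\<^sup>2 \<le> (b G)\<^sup>2" by (rule abs_le_square_iff[THEN iffD1])
        also have "\<dots> \<le> \<kappa> / 2" using elim(3) unfolding \<kappa>_def by simp
        finally have x2: "x\<^sup>2 \<le> \<kappa> / 8" by (simp add: power_mult_distrib)
        then have "x\<^sup>2 \<le> 1\<^sup>2" using \<kappa> by simp
        then have "\<bar>x\<bar> \<le> \<bar>1\<bar>" by (rule abs_le_square_iff[THEN iffD2])
        then have "\<bar>x\<bar> \<le> 1" by simp
        have "G = exp (w R t0) * ((exp x + exp (- x)) / 2)"
          unfolding t0(3)[symmetric] flux_def w_def x_def
          by (simp add: algebra_simps add_divide_distrib diff_divide_distrib flip: exp_add)
        also have "\<dots> \<le> exp (w R t0) * (1 + x\<^sup>2)"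
          using cosh_half_bound[OF \<open>\<bar>x\<bar> \<le> 1\<close>] by (intro mult_left_mono) auto
        also have "\<dots> \<le> exp (w R t0) * exp (x\<^sup>2)" by (intro mult_left_mono exp_ge_add_one_self) auto
        finally have "ln G \<le> ln (exp (w R t0 + x\<^sup>2))" using G by (intro ln_mono) (auto simp: exp_add)
        then show ?thesis using x2 by simp
      qed
      have "T - t0 \<le> 1 / (2 * (\<kappa> / 8) * l0\<^sup>2)"
      proof (rule remaining_time_bound)
        show "ln l - l * (R / 2) + \<kappa> / 8 < 0" if "l0 \<le> l" for l
          using l1[of l] that l0 elim(5) \<kappa> by simp
        fix y assume y: "0 \<le> y" "y \<le> R / 2"
        have "exp (- (l0 * y)) \<le> 1" using l0 y by simp
        then have "\<kappa> / 8 * exp (- (l0 * y)) \<le> \<kappa> / 8 * 1" using \<kappa> by (intro mult_left_mono) auto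
        then have upper: "ln l0 - l0 * y + \<kappa> / 8 * exp (- (l0 * y)) \<le> ln G1 - \<kappa> - l0 * y + \<kappa> / 8"
          using ln_l0 by simp
        show "ln l0 - l0 * y + \<kappa> / 8 * exp (- (l0 * y)) < w (R - y) t0"
        proof (cases "y \<le> L")
          case True
          have "w R t0 - w (R - y) t0 \<le> G1 * y - G / (8 * L) * y\<^sup>2"
            by (rule slope_bound_at_record[OF rec]) (use G1 L_def elim True y in auto)
          then have lower: "ln G1 - \<kappa> / 4 - G1 * y + \<kappa> * G\<^sup>2 * y\<^sup>2 \<le> w (R - y) t0"
            unfolding slope_coeff using defect ln_G1 by simp
          have "0 < \<kappa> * (5 / 8 - G1 * y + (G * y)\<^sup>2)"
          proof (rule mult_pos_pos[OF \<kappa>(1)])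
            have "G1 * y \<le> 3 / 2 * (G * y)" using mult_right_mono[OF G1(2) y(1)] by simp
            moreover have "0 \<le> (G * y - 3 / 4)\<^sup>2" by simp
            then have "0 \<le> (G * y)\<^sup>2 - 3 / 2 * (G * y) + 9 / 16" by (simp add: power2_eq_square algebra_simps)
            ultimately show "0 < 5 / 8 - G1 * y + (G * y)\<^sup>2" by linarith
          qed
          then have "ln G1 - \<kappa> - l0 * y + \<kappa> / 8 < ln G1 - \<kappa> / 4 - G1 * y + \<kappa> * G\<^sup>2 * y\<^sup>2"
            unfolding l0_def by (simp add: algebra_simps power_mult_distrib)
          with upper lower show ?thesis by linarith
        next
          case False
          have "32 * ln G = G / 2 * L" unfolding L_def using G by simp
          also have "\<dots> \<le> l0 * y" using l0 L False by (intro mult_mono) auto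
          finally have "32 * ln G \<le> l0 * y" .
          moreover have "0 \<le> w (R - y) t0" using y t0 t0_nonneg R_pos by (intro w_nonneg) auto
          ultimately show ?thesis using upper ln_G1 ln_G \<kappa> by linarith
        qed
      qed (use t0 t0_nonneg \<kappa> l0 in auto)
      also have "\<dots> \<le> 1 / (2 * (\<kappa> / 8) * (G / 2)\<^sup>2)"
      proof (rule divide_left_mono)
        have "(G / 2)\<^sup>2 \<le> l0\<^sup>2" using l0 G by (intro power_mono) auto
        then show "2 * (\<kappa> / 8) * (G / 2)\<^sup>2 \<le> 2 * (\<kappa> / 8) * l0\<^sup>2" using \<kappa> by (intro mult_left_mono) auto
      qed (use \<kappa> G l0 in auto)
      also have "\<dots> = 8192 * ln G / G\<^sup>2"
        unfolding \<kappa>_def using G by (simp add: field_simps power2_eq_square)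
      also have "\<dots> \<le> 8192 * G / G\<^sup>2"
        using G ln_le_minus_one[of G] by (intro divide_right_mono) auto
      also have "\<dots> = 8192 / G" using G by (simp add: power2_eq_square)
      finally show "T - t0 \<le> 8192 / G" .
    qed
  qed
qed

lemma continuous_flux: "\<lbrakk>0 \<le> a; b < T\<rbrakk> \<Longrightarrow> continuous_on {a..b} flux"
  unfolding flux_def
  by (intro continuous_intros continuous_U_compose continuous_V_compose) (use R_pos in auto)

text \<open>At an arbitrary time \<open>t\<close>, the flux is at most the largest value \<open>G\<close> up to \<open>t\<close>, and this value is a
  record at an earlier time \<open>t0\<close>, so that \<open>G \<le> 8192 / (T - t0) \<le> 8192 / (T - t)\<close> once \<open>G\<close> is large.\<close>

lemma boundary_blow_up_rate:
  "\<exists>C>0. \<forall>t\<in>{0<..<T}. U R t \<le> ln C - ln (T - t) \<and> V R t \<le> ln C - ln (T - t)"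
proof -
  obtain G0 where G0: "\<And>G t0. \<lbrakk>G0 \<le> G; record_flux G t0\<rbrakk> \<Longrightarrow> T - t0 \<le> 8192 / G"
    using record_flux_bound unfolding eventually_at_top_linorder by blast
  have "bdd_above (flux ` {0..T / 2})"
    using T_pos by (intro bounded_imp_bdd_above compact_imp_bounded compact_continuous_image continuous_flux) auto
  then obtain M where "\<And>x. x \<in> flux ` {0..T / 2} \<Longrightarrow> x \<le> M"
    unfolding bdd_above_def by blast
  then have M: "flux t \<le> M" if "0 \<le> t" "t \<le> T / 2" for t using that by auto
  define G2 where "G2 = max G0 (M + 1)"
  define C where "C = 8192 + \<bar>G2\<bar> * T"
  have C: "0 < C" unfolding C_def using T_pos by (simp add: add_pos_nonneg)
  have rate: "flux t * (T - t) \<le> C" if t: "0 < t" "t < T" for t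
  proof -
    obtain t0 where t0: "t0 \<in> {0..t}" and max: "\<And>s. s \<in> {0..t} \<Longrightarrow> flux s \<le> flux t0"
      using continuous_attains_sup[OF compact_Icc _ continuous_flux[of 0 t]] t by auto
    have "0 < flux t" using flux_ge_1[of t] t by simp
    show ?thesis
    proof (cases "G2 \<le> flux t0")
      case True
      have "T / 2 < t0"
        using M[of t0] True t0 unfolding G2_def by force
      then have "record_flux (flux t0) t0"
        unfolding record_flux_def using t0 t max by auto
      then have "T - t0 \<le> 8192 / flux t0" using True unfolding G2_def by (intro G0) auto
      moreover have "0 < flux t0" using flux_ge_1[of t0] t0 t by auto
      ultimately have "flux t0 * (T - t0) \<le> 8192" by (simp add: field_simps)
      moreover have "flux t * (T - t) \<le> flux t0 * (T - t0)"
        using max[of t] t t0 \<open>0 < flux t\<close> by (intro mult_mono) auto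
      moreover have "0 \<le> \<bar>G2\<bar> * T" using T_pos by simp
      ultimately show ?thesis unfolding C_def by linarith
    next
      case False
      then have "flux t \<le> \<bar>G2\<bar>" using max[of t] t by auto
      then have "flux t * (T - t) \<le> \<bar>G2\<bar> * T" using t \<open>0 < flux t\<close> by (intro mult_mono) auto
      then show ?thesis unfolding C_def by simp
    qed
  qed
  have "a \<le> ln (2 * C) - ln (T - t)" if "exp a \<le> 2 * flux t" "0 < t" "t < T" for a t
  proof -
    have "exp a * (T - t) \<le> 2 * flux t * (T - t)" using that by (intro mult_right_mono) auto
    also have "\<dots> \<le> 2 * C" using rate[of t] that by simp
    finally have "exp a \<le> 2 * C / (T - t)" using that by (simp add: field_simps)
    then have "ln (exp a) \<le> ln (2 * C / (T - t))" by (intro ln_mono) auto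
    then show ?thesis using that C by (simp add: ln_div)
  qed
  moreover have "exp (U R t) \<le> 2 * flux t" "exp (V R t) \<le> 2 * flux t" for t
    unfolding two_flux by auto
  ultimately show ?thesis using C by (intro exI[of _ "2 * C"]) auto
qed

end

section \<open>The blow-up rate\<close>

lemma (in classical_system) radial_system_exists:
  assumes e: "e \<in> Basis"
  obtains K c P Ur Vr Urr Vrr where "radial_system R T lam1 lam2 (real DIM('a) - 1) K c P
    (\<lambda>r. u (r *\<^sub>R e)) (\<lambda>r. v (r *\<^sub>R e)) Ur Vr Urr Vrr"
proof -
  interpret vu: classical_system lam2 lam1 R T v0 u0 v u by (rule swapped)
  have n: "norm e = 1" using e by simp
  obtain K1 where K1: "0 \<le> K1" "\<And>x t. \<lbrakk>norm x \<le> R; 0 \<le> t; t < T\<rbrakk> \<Longrightarrow> u x t - v x t \<le> K1"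
    using difference_bounded by blast
  obtain K2 where K2: "0 \<le> K2" "\<And>x t. \<lbrakk>norm x \<le> R; 0 \<le> t; t < T\<rbrakk> \<Longrightarrow> v x t - u x t \<le> K2"
    using vu.difference_bounded by blast
  obtain c where c: "0 < c" and growth: "\<And>m s t x. \<lbrakk>0 \<le> m; 0 \<le> s; s \<le> t; t < T; (t - s) * exp (2 * m) \<le> c;
      \<And>y. norm y \<le> R \<Longrightarrow> u y s < m \<and> v y s < m; norm x \<le> R\<rbrakk> \<Longrightarrow> u x t < m + 1 \<and> v x t < m + 1"
    using slow_growth by blast
  have T2: "0 < T / 2" "T / 2 < T" using T_pos by auto
  obtain P1 where P1: "0 \<le> P1" "\<And>r r'. \<lbrakk>0 \<le> r'; r' \<le> r; r \<le> R\<rbrakk> \<Longrightarrow>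
      u (r *\<^sub>R e) (T / 2) - u (r' *\<^sub>R e) (T / 2) \<le> P1 * (r - r')"
    using radial_lipschitz[OF e T2] by blast
  obtain P2 where P2: "0 \<le> P2" "\<And>r r'. \<lbrakk>0 \<le> r'; r' \<le> r; r \<le> R\<rbrakk> \<Longrightarrow>
      v (r *\<^sub>R e) (T / 2) - v (r' *\<^sub>R e) (T / 2) \<le> P2 * (r - r')"
    using vu.radial_lipschitz[OF e T2] by blast
  have ball: "r *\<^sub>R e \<in> ball 0 R" if "0 < r" "r < R" for r using that n by simp
  have "radial_system R T lam1 lam2 (real DIM('a) - 1) (max K1 K2) c (max P1 P2)
    (\<lambda>r. u (r *\<^sub>R e)) (\<lambda>r. v (r *\<^sub>R e))
    (\<lambda>r t. partial e (\<lambda>y. u y t) (r *\<^sub>R e)) (\<lambda>r t. partial e (\<lambda>y. v y t) (r *\<^sub>R e))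
    (\<lambda>r t. partial e (partial e (\<lambda>y. u y t)) (r *\<^sub>R e)) (\<lambda>r t. partial e (partial e (\<lambda>y. v y t)) (r *\<^sub>R e))"
  proof
    show "0 \<le> real DIM('a) - 1" using DIM_positive[where 'a = 'a] by (simp add: Suc_le_eq[symmetric])
    show "continuous_on ({0..R} \<times> {0..<T}) (\<lambda>(r, t). u (r *\<^sub>R e) t)"
      "continuous_on ({0..R} \<times> {0..<T}) (\<lambda>(r, t). v (r *\<^sub>R e) t)"
      unfolding case_prod_beta
      by (rule continuous_u_compose vu.continuous_u_compose; (intro continuous_intros)?; use n in auto)+
    fix r t :: real
    show "((\<lambda>r. u (r *\<^sub>R e) t) has_real_derivative exp (v (R *\<^sub>R e) t)) (at R within {..R})"
      "((\<lambda>r. v (r *\<^sub>R e) t) has_real_derivative exp (u (R *\<^sub>R e) t)) (at R within {..R})"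
      if "0 < t" "t < T"
      using boundary_derivative_u[OF n that] vu.boundary_derivative_u[OF n that] .
    show "(u (r *\<^sub>R e) has_real_derivative partial e (partial e (\<lambda>y. u y t)) (r *\<^sub>R e) +
        (real DIM('a) - 1) / r * partial e (\<lambda>y. u y t) (r *\<^sub>R e) + lam1 * exp (v (r *\<^sub>R e) t)) (at t)"
      "(v (r *\<^sub>R e) has_real_derivative partial e (partial e (\<lambda>y. v y t)) (r *\<^sub>R e) +
        (real DIM('a) - 1) / r * partial e (\<lambda>y. v y t) (r *\<^sub>R e) + lam2 * exp (u (r *\<^sub>R e) t)) (at t)"
      if "0 < r" "r < R" "0 < t" "t < T"
      using time_derivative_u[OF ball, of r t] vu.time_derivative_u[OF ball, of r t] that
        radial_laplacian[OF e that] vu.radial_laplacian[OF e that] by simp_all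
    show "u (r' *\<^sub>R e) t \<le> u (r *\<^sub>R e) t" "v (r' *\<^sub>R e) t \<le> v (r *\<^sub>R e) t"
      if "0 \<le> r'" "r' \<le> r" "r \<le> R" "0 \<le> t" "t < T" for r'
      using that n by (intro radially_monotone vu.radially_monotone; simp)+
    show "0 \<le> u (r *\<^sub>R e) t" "0 \<le> v (r *\<^sub>R e) t" if "0 \<le> r" "r \<le> R" "0 \<le> t" "t < T"
      using that n by (intro u_nonneg vu.u_nonneg; simp)+
    show "\<bar>u (r *\<^sub>R e) t - v (r *\<^sub>R e) t\<bar> \<le> max K1 K2" if "0 \<le> r" "r \<le> R" "0 \<le> t" "t < T"
      using K1(2)[of "r *\<^sub>R e" t] K2(2)[of "r *\<^sub>R e" t] that n by auto
    show "u (R *\<^sub>R e) t < m + 1 \<and> v (R *\<^sub>R e) t < m + 1"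
      if "0 \<le> m" "0 \<le> s" "s \<le> t" "t < T" "(t - s) * exp (2 * m) \<le> c"
        "u (R *\<^sub>R e) s < m" "v (R *\<^sub>R e) s < m" for m s
    proof (rule growth[OF that(1-5)])
      fix y :: 'a assume y: "norm y \<le> R"
      have "u y s \<le> u (R *\<^sub>R e) s" "v y s \<le> v (R *\<^sub>R e) s"
        using that y n R_pos by (intro radially_monotone vu.radially_monotone; simp)+
      then show "u y s < m \<and> v y s < m" using that by simp
    qed (use n R_pos in simp)
    show "u (r *\<^sub>R e) (T / 2) - u (r' *\<^sub>R e) (T / 2) \<le> max P1 P2 * (r - r')"
      "v (r *\<^sub>R e) (T / 2) - v (r' *\<^sub>R e) (T / 2) \<le> max P1 P2 * (r - r')"
      if "0 \<le> r'" "r' \<le> r" "r \<le> R" for r'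
    proof -
      have "P1 * (r - r') \<le> max P1 P2 * (r - r')" "P2 * (r - r') \<le> max P1 P2 * (r - r')"
        using that by (intro mult_right_mono; simp)+
      then show "u (r *\<^sub>R e) (T / 2) - u (r' *\<^sub>R e) (T / 2) \<le> max P1 P2 * (r - r')"
        "v (r *\<^sub>R e) (T / 2) - v (r' *\<^sub>R e) (T / 2) \<le> max P1 P2 * (r - r')"
        using P1(2)[OF that] P2(2)[OF that] by linarith+
    qed
  qed (use R_pos T_pos lam1_pos lam2_pos K1(1) c P1(1) radial_derivatives[OF e] vu.radial_derivatives[OF e] in auto)
  then show thesis by (rule that)
qed

theorem theorem3p2:
  fixes u0 v0 :: "'a::euclidean_space \<Rightarrow> real"
    and u v :: "'a \<Rightarrow> real \<Rightarrow> real"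
    and R T lam1 lam2 :: real
  assumes "0 < R"
    and "0 < lam1" and "0 < lam2"
    and "admissible_data R u0 v0"
    and "blow_up_solution lam1 lam2 R u0 v0 T u v"
  shows "\<exists>C>0. \<forall>t\<in>{0<..<T}. \<forall>x\<in>sphere 0 R.
           u x t \<le> ln C - ln (T - t) \<and> v x t \<le> ln C - ln (T - t)"
proof -
  have "0 < T" "classical_solution lam1 lam2 R u0 v0 T u v"
    using assms(5) unfolding blow_up_solution_def by simp_all
  then interpret uv: classical_system lam1 lam2 R T u0 v0 u v
    using assms(1-4) by unfold_locales
  interpret vu: classical_system lam2 lam1 R T v0 u0 v u by (rule uv.swapped)
  obtain e :: 'a where e: "e \<in> Basis" using nonempty_Basis by blast
  obtain K c P Ur Vr Urr Vrr where "radial_system R T lam1 lam2 (real DIM('a) - 1) K c P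
      (\<lambda>r. u (r *\<^sub>R e)) (\<lambda>r. v (r *\<^sub>R e)) Ur Vr Urr Vrr"
    by (rule uv.radial_system_exists[OF e])
  from radial_system.boundary_blow_up_rate[OF this]
  obtain C where "0 < C" and C: "\<And>t. t \<in> {0<..<T} \<Longrightarrow>
      u (R *\<^sub>R e) t \<le> ln C - ln (T - t) \<and> v (R *\<^sub>R e) t \<le> ln C - ln (T - t)"
    by blast
  have "u x t = u (R *\<^sub>R e) t" "v x t = v (R *\<^sub>R e) t" if "x \<in> sphere 0 R" "t \<in> {0<..<T}" for x t
  proof -
    have x: "norm x = R" using that(1) by simp
    have Re: "norm (R *\<^sub>R e) = R" using e assms(1) by simp
    have t: "0 \<le> t" "t < T" using that(2) by auto
    have "norm x \<le> R" "norm (R *\<^sub>R e) = norm x" unfolding x Re by (rule order_refl, rule refl)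
    then show "u x t = u (R *\<^sub>R e) t" "v x t = v (R *\<^sub>R e) t"
      by (rule uv.radial_u[OF t], rule vu.radial_u[OF t])
  qed
  with \<open>0 < C\<close> C show ?thesis by (intro exI[of _ C]) simp
qed

end
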